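(* If $U$ is a bounded open set with Lipschitz boundary in $\mathbb{R}^n$, then there exists a regular Lipschitz deformation $\Psi(x,\tau)=\Psi_\tau(x)$ of $\partial U$, that is, a Lipschitz deformation $\Psi$ of $\partial U$ satisfying $$\lim_{\tau\to0^+}J^{\partial U}\Psi_\tau=1\qquad\text{in }L^1(\partial U;\mathcal{H}^{n-1}).$$
   Context: An open set $U\subset\mathbb{R}^n$ has Lipschitz boundary if for each $x\in\partial U$ there exist $r>0$ and a Lipschitz map $\gamma:\mathbb{R}^{n-1}\to\mathbb{R}$ such that, upon rotating and relabeling the coordinate axes if necessary, $U\cap Q(x,r)=\{y\in\mathbb{R}^n: y_n>\gamma(y_1,\dots,y_{n-1})\}\cap Q(x,r)$, where $Q(x,r)=\{y:|y_i-x_i|\le r,\ i=1,\dots,n\}$. A Lipschitz deformation of $\partial U$ is a map $\Psi:\partial U\times[0,1]\to\overline U$ such that $\Psi$ is a bi-Lipschitz homeomorphism over its image and $\Psi(\cdot,0)=\mathrm{Id}$ on $\partial U$; one denotes $\partial U_\tau=\Psi(\partial U\times\{\tau\})$ for $\tau\in(0,1]$ and by $U_\tau$ the open subset of $U$ whose boundary is $\partial U_\tau$. $\Psi_\tau:=\Psi(\cdot,\tau)$ and $J^{\partial U}\Psi_\tau$ denotes the tangential ($(n-1)$-dimensional) Jacobian of $\Psi_\tau$ on $\partial U$. *)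

theory Defs
  imports "HOL-Analysis.Analysis"
begin

section \<open>Hausdorff measure\<close>

text \<open>
  Federer's normalisation: \<open>\<omega>\<^sub>k (diam S / 2)\<^sup>k\<close>, where \<open>\<omega>\<^sub>k\<close> is the volume of the unit ball
  of \<open>\<real>\<^sup>k\<close>. For \<open>k = 0\<close> a nonempty set has gauge \<open>1\<close> (as \<open>0 ^ 0 = 1\<close>), so that the
  \<open>0\<close>-dimensional measure counts points; the empty set has gauge \<open>0\<close> for every \<open>k\<close>.
\<close>

definition hausdorff_gauge :: "nat \<Rightarrow> 'a::metric_space set \<Rightarrow> ennreal" where
  "hausdorff_gauge k S =
     (if S = {} then 0 else ennreal (unit_ball_vol (real k) * (diameter S / 2) ^ k))"

text \<open>
  The library's \<^const>\<open>diameter\<close> is not meaningful on unbounded sets, hence the boundedness condition.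
\<close>

definition hausdorff_covers :: "real \<Rightarrow> 'a::metric_space set \<Rightarrow> (nat \<Rightarrow> 'a set) set" where
  "hausdorff_covers \<delta> A = {C. A \<subseteq> (\<Union>i. C i) \<and> (\<forall>i. bounded (C i) \<and> diameter (C i) \<le> \<delta>)}"

definition hausdorff_premeasure :: "nat \<Rightarrow> real \<Rightarrow> 'a::metric_space set \<Rightarrow> ennreal" where
  "hausdorff_premeasure k \<delta> A = (INF C\<in>hausdorff_covers \<delta> A. \<Sum>i. hausdorff_gauge k (C i))"

definition hausdorff_outer :: "nat \<Rightarrow> 'a::metric_space set \<Rightarrow> ennreal" where
  "hausdorff_outer k A = (SUP \<delta>\<in>{0<..}. hausdorff_premeasure k \<delta> A)"

text \<open>
  The measure lives on the Caratheodory-measurable sets of the outer measure, so it is complete;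
  all Borel sets are measurable, see \<open>borel_sets_hausdorff_measure\<close> below.
\<close>

definition hausdorff_measure :: "nat \<Rightarrow> 'a::metric_space measure" where
  "hausdorff_measure k =
     measure_of UNIV (lambda_system UNIV UNIV (hausdorff_outer k)) (hausdorff_outer k)"

lemma hausdorff_gauge_empty [simp]: "hausdorff_gauge k {} = 0"
  by (simp add: hausdorff_gauge_def)

lemma hausdorff_covers_mono:
  "A \<subseteq> B \<Longrightarrow> \<delta> \<le> \<epsilon> \<Longrightarrow> hausdorff_covers \<delta> B \<subseteq> hausdorff_covers \<epsilon> A"
proof
  fix C assume "A \<subseteq> B" "\<delta> \<le> \<epsilon>" "C \<in> hausdorff_covers \<delta> B"
  then show "C \<in> hausdorff_covers \<epsilon> A"
    unfolding hausdorff_covers_def mem_Collect_eq by (meson order_trans)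
qed

lemma hausdorff_premeasure_mono:
  "A \<subseteq> B \<Longrightarrow> \<delta> \<le> \<epsilon> \<Longrightarrow> hausdorff_premeasure k \<epsilon> A \<le> hausdorff_premeasure k \<delta> B"
  unfolding hausdorff_premeasure_def by (intro INF_superset_mono hausdorff_covers_mono) auto

lemma hausdorff_premeasure_le_outer:
  "\<delta> > 0 \<Longrightarrow> hausdorff_premeasure k \<delta> A \<le> hausdorff_outer k A"
  unfolding hausdorff_outer_def by (intro SUP_upper) auto

lemma hausdorff_premeasure_empty: "\<delta> > 0 \<Longrightarrow> hausdorff_premeasure k \<delta> {} = 0"
proof -
  assume "\<delta> > 0"
  then have "(\<lambda>_. {}) \<in> hausdorff_covers \<delta> ({} :: 'a set)"
    by (auto simp: hausdorff_covers_def)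
  then have "hausdorff_premeasure k \<delta> ({} :: 'a set) \<le> (\<Sum>i::nat. hausdorff_gauge k ({}::'a set))"
    unfolding hausdorff_premeasure_def by (rule INF_lower)
  then show ?thesis by simp
qed

lemma hausdorff_outer_empty [simp]: "hausdorff_outer k {} = 0"
  by (simp add: hausdorff_outer_def hausdorff_premeasure_empty cong: SUP_cong_simp)

lemma hausdorff_outer_mono: "A \<subseteq> B \<Longrightarrow> hausdorff_outer k A \<le> hausdorff_outer k B"
  unfolding hausdorff_outer_def by (intro SUP_mono) (auto intro: hausdorff_premeasure_mono)

lemma hausdorff_premeasure_UN_le:
  fixes A :: "nat \<Rightarrow> 'a::metric_space set"
  shows "hausdorff_premeasure k \<delta> (\<Union>n. A n) \<le> (\<Sum>n. hausdorff_premeasure k \<delta> (A n))"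
proof (rule ennreal_le_epsilon)
  fix e :: real assume fin: "(\<Sum>n. hausdorff_premeasure k \<delta> (A n)) < top" and e: "0 < e"
  have "\<exists>C\<in>hausdorff_covers \<delta> (A n).
      (\<Sum>i. hausdorff_gauge k (C i)) < hausdorff_premeasure k \<delta> (A n) + ennreal (e * (1/2) ^ Suc n)"
    for n
  proof -
    have "hausdorff_premeasure k \<delta> (A n) < top"
      using ennreal_suminf_lessD[OF fin] .
    then have "hausdorff_premeasure k \<delta> (A n)
        < hausdorff_premeasure k \<delta> (A n) + ennreal (e * (1/2) ^ Suc n)"
      using e by (auto simp: ennreal_zero_less_mult_iff ennreal_less_zero_iff less_top)
    then show ?thesis
      by (subst (asm) (1) hausdorff_premeasure_def) (simp add: INF_less_iff)
  qed
  then obtain C where C: "\<And>n. C n \<in> hausdorff_covers \<delta> (A n)"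
    and le: "\<And>n. (\<Sum>i. hausdorff_gauge k (C n i))
               < hausdorff_premeasure k \<delta> (A n) + ennreal (e * (1/2) ^ Suc n)"
    by metis
  define D where "D p = (\<lambda>(n, i). C n i) (prod_decode p)" for p
  have "D \<in> hausdorff_covers \<delta> (\<Union>n. A n)"
    unfolding hausdorff_covers_def
  proof (safe)
    fix x n assume "x \<in> A n"
    then obtain i where "x \<in> C n i" using C[of n] by (auto simp: hausdorff_covers_def)
    then have "x \<in> D (prod_encode (n, i))" by (simp add: D_def)
    then show "x \<in> (\<Union>i. D i)" by blast
  qed (use C in \<open>auto simp: D_def hausdorff_covers_def split: prod.split\<close>)
  then have "hausdorff_premeasure k \<delta> (\<Union>n. A n) \<le> (\<Sum>p. hausdorff_gauge k (D p))"
    unfolding hausdorff_premeasure_def by (rule INF_lower)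
  also have "\<dots> = (\<Sum>p. (\<lambda>(n, i). hausdorff_gauge k (C n i)) (prod_decode p))"
    by (simp add: D_def case_prod_beta)
  also have "\<dots> = (\<Sum>n. \<Sum>i. hausdorff_gauge k (C n i))"
    using suminf_ennreal_2dimen[of "\<lambda>n. \<Sum>i. hausdorff_gauge k (C n i)"
        "\<lambda>(n, i). hausdorff_gauge k (C n i)"] by (simp add: o_def)
  also have "\<dots> \<le> (\<Sum>n. hausdorff_premeasure k \<delta> (A n) + ennreal (e * (1/2) ^ Suc n))"
    using le by (intro suminf_le) (auto intro: less_imp_le)
  also have "\<dots> = (\<Sum>n. hausdorff_premeasure k \<delta> (A n)) + (\<Sum>n. ennreal (e * (1/2) ^ Suc n))"
    by (intro suminf_add[symmetric]) auto
  also have "(\<Sum>n. ennreal (e * (1/2) ^ Suc n)) = ennreal e"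
  proof -
    have "(\<lambda>n. e * (1/2) ^ Suc n) sums (e * 1)"
      by (intro sums_mult power_half_series)
    then show ?thesis
      using e by (intro suminf_ennreal_eq) auto
  qed
  finally show "hausdorff_premeasure k \<delta> (\<Union>n. A n)
      \<le> (\<Sum>n. hausdorff_premeasure k \<delta> (A n)) + ennreal e" .
qed

lemma hausdorff_outer_UN_le:
  fixes A :: "nat \<Rightarrow> 'a::metric_space set"
  shows "hausdorff_outer k (\<Union>n. A n) \<le> (\<Sum>n. hausdorff_outer k (A n))"
  unfolding hausdorff_outer_def[of k "\<Union>n. A n"]
proof (rule SUP_least)
  fix \<delta> :: real assume "\<delta> \<in> {0<..}"
  then have "(\<Sum>n. hausdorff_premeasure k \<delta> (A n)) \<le> (\<Sum>n. hausdorff_outer k (A n))"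
    by (intro suminf_le hausdorff_premeasure_le_outer) auto
  with hausdorff_premeasure_UN_le
  show "hausdorff_premeasure k \<delta> (\<Union>n. A n) \<le> (\<Sum>n. hausdorff_outer k (A n))"
    by (rule order_trans)
qed

lemma outer_measure_space_hausdorff: "outer_measure_space UNIV (hausdorff_outer k)"
  unfolding outer_measure_space_def positive_def increasing_def countably_subadditive_def
  by (auto intro: hausdorff_outer_mono hausdorff_outer_UN_le)

lemma measure_space_hausdorff:
  "measure_space UNIV (lambda_system UNIV UNIV (hausdorff_outer k)) (hausdorff_outer k)"
  using sigma_algebra.caratheodory_lemma[OF sigma_algebra_Pow[of UNIV]] outer_measure_space_hausdorff
  by (metis Pow_UNIV)

lemma space_hausdorff_measure [simp]: "space (hausdorff_measure k) = UNIV"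
  by (simp add: hausdorff_measure_def space_measure_of_conv)

lemma sets_hausdorff_measure:
  "sets (hausdorff_measure k) = lambda_system UNIV UNIV (hausdorff_outer k)"
proof -
  have "sigma_algebra UNIV (lambda_system UNIV UNIV (hausdorff_outer k :: 'a set \<Rightarrow> ennreal))"
    using measure_space_hausdorff by (auto simp: measure_space_def)
  then show ?thesis
    unfolding hausdorff_measure_def by (rule sigma_algebra.sets_measure_of_eq)
qed

lemma emeasure_hausdorff_measure:
  "A \<in> sets (hausdorff_measure k) \<Longrightarrow> emeasure (hausdorff_measure k) A = hausdorff_outer k A"
  using measure_space_hausdorff[of k] unfolding sets_hausdorff_measure
  by (auto simp: hausdorff_measure_def measure_space_def intro: emeasure_measure_of_sigma)

lemma hausdorff_outer_Un_le: "hausdorff_outer k (A \<union> B) \<le> hausdorff_outer k A + hausdorff_outer k B"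
proof -
  have "hausdorff_outer k (\<Union>n. if n = 0 then A else if n = Suc 0 then B else {})
     \<le> (\<Sum>n. hausdorff_outer k (if n = 0 then A else if n = Suc 0 then B else {}))"
    by (rule hausdorff_outer_UN_le)
  also have "(\<Union>n. if n = 0 then A else if n = Suc 0 then B else {}) = A \<union> B"
    by (auto split: if_splits)
  also have "(\<Sum>n. hausdorff_outer k (if n = 0 then A else if n = Suc 0 then B else {}))
      = hausdorff_outer k A + hausdorff_outer k B"
    by (subst suminf_finite[of "{0, Suc 0}"]) auto
  finally show ?thesis .
qed

lemma hausdorff_outer_separated:
  fixes A B :: "'a::metric_space set"
  assumes d: "d > 0" and sep: "\<And>x y. x \<in> A \<Longrightarrow> y \<in> B \<Longrightarrow> d \<le> dist x y"
  shows "hausdorff_outer k (A \<union> B) = hausdorff_outer k A + hausdorff_outer k B"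
proof (rule antisym[OF hausdorff_outer_Un_le])
  have pre: "hausdorff_premeasure k \<delta> A + hausdorff_premeasure k \<delta> B \<le> hausdorff_premeasure k \<delta> (A \<union> B)"
    if \<delta>: "0 < \<delta>" "\<delta> < d" for \<delta>
    unfolding hausdorff_premeasure_def[of k \<delta> "A \<union> B"]
  proof (rule INF_greatest)
    fix C assume C: "C \<in> hausdorff_covers \<delta> (A \<union> B)"
    define CA where "CA i = (if C i \<inter> A = {} then {} else C i)" for i
    define CB where "CB i = (if C i \<inter> A = {} then C i else {})" for i
    have "B \<subseteq> (\<Union>i. CB i)"
    proof
      fix y assume "y \<in> B"
      then obtain i where i: "y \<in> C i" using C by (auto simp: hausdorff_covers_def)
      have "C i \<inter> A = {}"
      proof (rule ccontr)
        assume "C i \<inter> A \<noteq> {}"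
        then obtain x where "x \<in> C i" "x \<in> A" by auto
        then have "d \<le> dist x y" "dist x y \<le> diameter (C i)"
          using sep \<open>y \<in> B\<close> C i
          by (auto simp: hausdorff_covers_def intro: diameter_bounded_bound)
        moreover have "diameter (C i) \<le> \<delta>" using C by (auto simp: hausdorff_covers_def)
        ultimately show False using \<delta> by linarith
      qed
      then have "y \<in> CB i" using i by (simp add: CB_def)
      then show "y \<in> (\<Union>i. CB i)" by blast
    qed
    then have "CB \<in> hausdorff_covers \<delta> B"
      using C \<delta> by (auto simp: hausdorff_covers_def CB_def)
    moreover have "A \<subseteq> (\<Union>i. CA i)"
    proof
      fix y assume "y \<in> A"
      then obtain i where i: "y \<in> C i" using C by (auto simp: hausdorff_covers_def)
      then have "y \<in> CA i" using \<open>y \<in> A\<close> by (auto simp add: CA_def)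
      then show "y \<in> (\<Union>i. CA i)" by blast
    qed
    then have "CA \<in> hausdorff_covers \<delta> A"
      using C \<delta> by (auto simp: hausdorff_covers_def CA_def)
    ultimately have "hausdorff_premeasure k \<delta> A + hausdorff_premeasure k \<delta> B
        \<le> (\<Sum>i. hausdorff_gauge k (CA i)) + (\<Sum>i. hausdorff_gauge k (CB i))"
      unfolding hausdorff_premeasure_def by (intro add_mono INF_lower)
    also have "\<dots> = (\<Sum>i. hausdorff_gauge k (CA i) + hausdorff_gauge k (CB i))"
      by (intro suminf_add) auto
    also have "\<dots> = (\<Sum>i. hausdorff_gauge k (C i))"
      by (intro arg_cong[where f = suminf] ext) (simp add: CA_def CB_def)
    finally show "hausdorff_premeasure k \<delta> A + hausdorff_premeasure k \<delta> B
        \<le> (\<Sum>i. hausdorff_gauge k (C i))" .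
  qed
  have lim: "((\<lambda>\<delta>. hausdorff_premeasure k \<delta> X) \<longlongrightarrow> hausdorff_outer k X) (at_right 0)"
    for X :: "'a set"
  proof (rule order_tendstoI)
    fix a assume "a < hausdorff_outer k X"
    then obtain \<epsilon> where \<epsilon>: "\<epsilon> > 0" "a < hausdorff_premeasure k \<epsilon> X"
      by (auto simp: hausdorff_outer_def less_SUP_iff)
    have "eventually (\<lambda>\<delta>. \<delta> \<in> {0<..<\<epsilon>}) (at_right 0)"
      using \<epsilon> by (intro eventually_at_right_real) auto
    then show "eventually (\<lambda>\<delta>. a < hausdorff_premeasure k \<delta> X) (at_right 0)"
      by eventually_elim
        (use \<epsilon> in \<open>auto elim!: less_le_trans intro!: hausdorff_premeasure_mono\<close>)
  next
    fix a assume a: "hausdorff_outer k X < a"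
    show "eventually (\<lambda>\<delta>. hausdorff_premeasure k \<delta> X < a) (at_right 0)"
      using eventually_at_right_less[of "0::real"]
      by eventually_elim (use a in \<open>auto intro: le_less_trans hausdorff_premeasure_le_outer\<close>)
  qed
  show "hausdorff_outer k A + hausdorff_outer k B \<le> hausdorff_outer k (A \<union> B)"
  proof (rule tendsto_le[OF _ lim tendsto_add[OF lim lim]])
    have "eventually (\<lambda>\<delta>. \<delta> \<in> {0<..<d}) (at_right 0)"
      using d by (intro eventually_at_right_real) auto
    then show "eventually (\<lambda>\<delta>. hausdorff_premeasure k \<delta> A + hausdorff_premeasure k \<delta> B
        \<le> hausdorff_premeasure k \<delta> (A \<union> B)) (at_right 0)"
      by eventually_elim (auto intro: pre)
  qed simp
qed

lemma hausdorff_outer_infdist_layers: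
  fixes A C :: "'a::metric_space set" and r :: "nat \<Rightarrow> real"
  assumes r: "strict_antimono_on UNIV r"
  shows "(\<Sum>j<N. hausdorff_outer k {x\<in>A. r (2*j + m + 1) \<le> infdist x C \<and> infdist x C < r (2*j + m)})
    = hausdorff_outer k (\<Union>j<N. {x\<in>A. r (2*j + m + 1) \<le> infdist x C \<and> infdist x C < r (2*j + m)})"
    (is "(\<Sum>j<N. hausdorff_outer k (?R j)) = _")
proof (induction N)
  case (Suc N)
  have anti: "i < j \<Longrightarrow> r j < r i" for i j
    using r by (auto simp: monotone_on_def)
  have anti': "i \<le> j \<Longrightarrow> r j \<le> r i" for i j
    using anti[of i j] by (cases "i = j") (auto simp: less_imp_le)
  have eq: "(\<Union>j<Suc N. ?R j) = (\<Union>j<N. ?R j) \<union> ?R N"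
    by (auto simp: lessThan_Suc)
  show ?case
  proof (cases "N = 0")
    case False
    have "hausdorff_outer k ((\<Union>j<N. ?R j) \<union> ?R N)
        = hausdorff_outer k (\<Union>j<N. ?R j) + hausdorff_outer k (?R N)"
    proof (rule hausdorff_outer_separated)
      show "0 < r (2*N + m - 1) - r (2*N + m)"
        using anti[of "2*N + m - 1" "2*N + m"] False by simp
      fix x y assume "x \<in> (\<Union>j<N. ?R j)" and y: "y \<in> ?R N"
      then obtain j where j: "j < N" "r (2*j + m + 1) \<le> infdist x C" by auto
      have "r (2*N + m - 1) \<le> r (2*j + m + 1)"
        using j by (intro anti') auto
      moreover have "infdist x C \<le> infdist y C + dist x y"
        by (rule infdist_triangle)
      ultimately show "r (2*N + m - 1) - r (2*N + m) \<le> dist x y"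
        using j y by auto
    qed
    then show ?thesis using Suc eq by simp
  qed (simp add: lessThan_Suc)
qed simp

lemma closed_in_lambda_system_hausdorff:
  fixes C :: "'a::metric_space set"
  assumes "closed C"
  shows "C \<in> lambda_system UNIV UNIV (hausdorff_outer k)"
proof (cases "C = {}")
  case False
  have "hausdorff_outer k (C \<inter> A) + hausdorff_outer k (A - C) \<le> hausdorff_outer k A" for A
  proof (cases "hausdorff_outer k A = top")
    case fin: False
    define r :: "nat \<Rightarrow> real" where "r n = 1 / (real n + 1)" for n
    have r: "strict_antimono_on UNIV r"
      by (auto simp: r_def monotone_on_def intro!: divide_strict_left_mono)
    have rpos: "r n > 0" for n by (simp add: r_def)
    have rlim: "r \<longlonglongrightarrow> 0"
      unfolding r_def using LIMSEQ_inverse_real_of_nat by (simp add: inverse_eq_divide add.commute)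
    define R where "R n = {x\<in>A. r (n + 1) \<le> infdist x C \<and> infdist x C < r n}" for n
    define G where "G n = {x\<in>A. r n \<le> infdist x C}" for n
    have half: "(\<Sum>j. hausdorff_outer k (R (2*j + m))) < top" for m
    proof -
      have "(\<Sum>j<N. hausdorff_outer k (R (2*j + m))) \<le> hausdorff_outer k A" for N
        using hausdorff_outer_infdist_layers[OF r, where N = N and k = k and A = A and m = m and C = C]
        by (auto simp: R_def intro!: hausdorff_outer_mono)
      then have "(\<Sum>j. hausdorff_outer k (R (2*j + m))) \<le> hausdorff_outer k A"
        by (intro suminf_le_const) auto
      then show ?thesis using fin by (simp add: less_top order_le_less_trans)
    qed
    have tail0: "(\<lambda>n. \<Sum>j. hausdorff_outer k (R (2*(j + n) + m))) \<longlonglongrightarrow> 0" for m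
    proof -
      define a where "a j = enn2real (hausdorff_outer k (R (2*j + m)))" for j
      have f: "hausdorff_outer k (R (2*j + m)) < top" for j
        using ennreal_suminf_lessD[OF half] .
      then have e: "hausdorff_outer k (R (2*j + m)) = ennreal (a j)" for j
        by (simp add: a_def)
      have nn: "a j \<ge> 0" for j by (simp add: a_def)
      have sm: "summable a"
        using half[of m] nn by (intro summable_suminf_not_top) (auto simp: e)
      have "(\<lambda>n. ennreal (\<Sum>j. a (j + n))) \<longlonglongrightarrow> ennreal 0"
        using suminf_exist_split2[OF sm] by (intro tendsto_ennrealI)
      moreover have "(\<Sum>j. hausdorff_outer k (R (2*(j + n) + m))) = ennreal (\<Sum>j. a (j + n))" for n
        unfolding e using sm nn by (intro suminf_ennreal2) (auto simp: summable_iff_shift)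
      ultimately show ?thesis by simp
    qed
    have le: "hausdorff_outer k (C \<inter> A) + hausdorff_outer k (A - C) \<le> hausdorff_outer k A
        + ((\<Sum>j. hausdorff_outer k (R (2*(j + n) + 0))) + (\<Sum>j. hausdorff_outer k (R (2*(j + n) + 1))))"
      for n
    proof -
      have "A - C \<subseteq> G (2*n) \<union> ((\<Union>j. R (2*(j + n) + 0)) \<union> (\<Union>j. R (2*(j + n) + 1)))"
      proof
        fix x assume x: "x \<in> A - C"
        then have pos: "infdist x C > 0"
          using \<open>closed C\<close> False in_closed_iff_infdist_zero[of C x] infdist_nonneg[of x C] by force
        then have "eventually (\<lambda>i. r i < infdist x C) sequentially"
          using order_tendstoD(2)[OF rlim] by simp
        then have ex: "\<exists>i. r i \<le> infdist x C"
          by (auto simp: eventually_sequentially intro: less_imp_le)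
        define i where "i = (LEAST i. r i \<le> infdist x C)"
        have i: "r i \<le> infdist x C" unfolding i_def using ex by (rule LeastI_ex)
        have ni: "j < i \<Longrightarrow> infdist x C < r j" for j
          unfolding i_def using not_less_Least[of j "\<lambda>i. r i \<le> infdist x C"] by force
        show "x \<in> G (2*n) \<union> ((\<Union>j. R (2*(j + n) + 0)) \<union> (\<Union>j. R (2*(j + n) + 1)))"
        proof (cases "i \<le> 2*n")
          case True
          then have "r (2*n) \<le> r i"
            using r by (cases "i = 2*n") (auto simp: monotone_on_def less_imp_le)
          then show ?thesis using x i by (auto simp: G_def)
        next
          case False
          then obtain l where l: "i = Suc l" "l \<ge> 2*n" by (cases i) auto
          then have xl: "x \<in> R l" using x i ni[of l] by (auto simp: R_def)
          have "\<exists>j. l = 2*(j + n) + 0 \<or> l = 2*(j + n) + 1"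
            using l by presburger
          then obtain j where "l = 2*(j + n) + 0 \<or> l = 2*(j + n) + 1" ..
          then show ?thesis using xl by blast
        qed
      qed
      then have "hausdorff_outer k (A - C)
         \<le> hausdorff_outer k (G (2*n) \<union> ((\<Union>j. R (2*(j + n) + 0)) \<union> (\<Union>j. R (2*(j + n) + 1))))"
        by (rule hausdorff_outer_mono)
      also have "\<dots> \<le> hausdorff_outer k (G (2*n))
          + ((\<Sum>j. hausdorff_outer k (R (2*(j + n) + 0))) + (\<Sum>j. hausdorff_outer k (R (2*(j + n) + 1))))"
        by (intro order_trans[OF hausdorff_outer_Un_le] add_mono order_refl hausdorff_outer_UN_le)
      finally have 1: "hausdorff_outer k (A - C) \<le> \<dots>" .
      have "hausdorff_outer k ((C \<inter> A) \<union> G (2*n)) = hausdorff_outer k (C \<inter> A) + hausdorff_outer k (G (2*n))"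
      proof (rule hausdorff_outer_separated)
        show "0 < r (2*n)" by (rule rpos)
        show "r (2*n) \<le> dist x y" if "x \<in> C \<inter> A" "y \<in> G (2*n)" for x y
          using that infdist_le[of x C y] by (auto simp: G_def dist_commute)
      qed
      moreover have "hausdorff_outer k ((C \<inter> A) \<union> G (2*n)) \<le> hausdorff_outer k A"
        by (intro hausdorff_outer_mono) (auto simp: G_def)
      ultimately show ?thesis
        using add_left_mono[OF 1, of "hausdorff_outer k (C \<inter> A)"]
        by (metis (no_types, lifting) add.assoc add_right_mono order_trans)
    qed
    have "(\<lambda>n. hausdorff_outer k A
        + ((\<Sum>j. hausdorff_outer k (R (2*(j + n) + 0))) + (\<Sum>j. hausdorff_outer k (R (2*(j + n) + 1)))))
        \<longlonglongrightarrow> hausdorff_outer k A + (0 + 0)"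
      by (intro tendsto_add tendsto_const tail0)
    then show ?thesis
      using le by (intro LIMSEQ_le_const) auto
  qed simp
  moreover have "hausdorff_outer k A \<le> hausdorff_outer k (C \<inter> A) + hausdorff_outer k (A - C)" for A
    by (rule order_trans[OF hausdorff_outer_mono hausdorff_outer_Un_le]) auto
  moreover have "- C \<inter> A = A - C" for A by auto
  ultimately show ?thesis
    by (auto simp: lambda_system_def Compl_eq_Diff_UNIV[symmetric] intro: antisym)
qed (simp add: lambda_system_def)

lemma borel_sets_hausdorff_measure: "sets borel \<subseteq> sets (hausdorff_measure k)"
proof -
  have "sigma_sets UNIV (Collect closed) \<subseteq> sets (hausdorff_measure k :: 'a measure)"
    using sets.sigma_sets_subset[of "Collect closed" "hausdorff_measure k :: 'a measure"]
      closed_in_lambda_system_hausdorff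
    by (auto simp: sets_hausdorff_measure)
  then show ?thesis by (simp add: borel_eq_closed)
qed

section \<open>Tangential Jacobian\<close>

text \<open>
  The (Bouligand) tangent cone. On a Lipschitz graph it coincides at every point with the
  approximate tangent cone of geometric measure theory, and at almost every point it is a
  hyperplane through the origin.
\<close>

definition tangent_cone :: "'a::real_normed_vector set \<Rightarrow> 'a \<Rightarrow> 'a set" where
  "tangent_cone M x = {v. \<exists>y t. (\<forall>i::nat. y i \<in> M \<and> t i > (0::real)) \<and> y \<longlonglongrightarrow> x \<and>
                              (\<lambda>i. t i *\<^sub>R (y i - x)) \<longlonglongrightarrow> v}"

text \<open>
  The determinant of a square matrix indexed by a finite set, by the same formula as the
  library's \<^const>\<open>det\<close>, which is restricted to matrices indexed by a type.
\<close>

definition det_on :: "'i set \<Rightarrow> ('i \<Rightarrow> 'i \<Rightarrow> real) \<Rightarrow> real" where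
  "det_on I A = (\<Sum>p | p permutes I. of_int (sign p) * (\<Prod>i\<in>I. A i (p i)))"

text \<open>
  \<open>sqrt (det (L\<^sup>* L))\<close> for the restriction of the linear map \<open>L\<close> to the subspace \<open>T\<close>; in an
  orthonormal basis \<open>B\<close> of \<open>T\<close> the matrix of \<open>L\<^sup>* L\<close> is the Gram matrix of the vectors \<open>L b\<close>.
  The value does not depend on the choice of \<open>B\<close>.
\<close>

definition orthonormal_basis_of :: "'a::euclidean_space set \<Rightarrow> 'a set \<Rightarrow> bool" where
  "orthonormal_basis_of T B \<longleftrightarrow>
     B \<subseteq> T \<and> span B = T \<and> pairwise orthogonal B \<and> (\<forall>b\<in>B. norm b = 1)"

definition jacobian_on :: "'a::euclidean_space set \<Rightarrow> ('a \<Rightarrow> 'b::real_inner) \<Rightarrow> real" where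
  "jacobian_on T L = (let B = (SOME B. orthonormal_basis_of T B)
                      in sqrt (det_on B (\<lambda>b c. L b \<bullet> L c)))"

text \<open>
  The \<open>k\<close>-dimensional tangential Jacobian of \<open>f\<close> along \<open>M\<close>. A derivative of \<open>f\<close> within \<open>M\<close> is
  not unique as a linear map on the whole space, but its restriction to the tangent space is.
  For a Lipschitz \<open>f\<close> on a Lipschitz hypersurface \<open>M\<close> the condition holds almost everywhere;
  the value \<open>0\<close> elsewhere is a dummy.
\<close>

definition tangential_jacobian ::
  "nat \<Rightarrow> 'a::euclidean_space set \<Rightarrow> ('a \<Rightarrow> 'b::real_inner) \<Rightarrow> 'a \<Rightarrow> real" where
  "tangential_jacobian k M f x =
     (if subspace (tangent_cone M x) \<and> dim (tangent_cone M x) = k \<and> f differentiable (at x within M)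
      then jacobian_on (tangent_cone M x) (frechet_derivative f (at x within M))
      else 0)"

section \<open>Lipschitz boundaries and Lipschitz deformations\<close>

definition cube :: "real ^ 'n \<Rightarrow> real \<Rightarrow> (real ^ 'n) set" where
  "cube x r = {y. \<forall>i. \<bar>y $ i - x $ i\<bar> \<le> r}"

text \<open>
  The rotated and relabelled coordinates of \<open>y\<close> are the components of \<open>R y\<close>, with \<open>R\<close> orthogonal,
  and \<open>k\<close> is the coordinate singled out as the vertical one. The space \<open>\<real>\<^sup>n\<^sup>-\<^sup>1\<close> of the other
  coordinates is represented by the hyperplane \<open>{z. z $ k = 0}\<close>, the \<open>k\<close>-th coordinate being
  replaced by \<open>0\<close> before \<open>\<gamma>\<close> is applied.
\<close>

definition lipschitz_boundary :: "(real ^ 'n) set \<Rightarrow> bool" where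
  "lipschitz_boundary U \<longleftrightarrow>
     (\<forall>x\<in>frontier U. \<exists>r>0. \<exists>(R :: real ^ 'n \<Rightarrow> real ^ 'n) (k :: 'n) \<gamma> C.
        orthogonal_transformation R \<and> C-lipschitz_on {z. z $ k = 0} \<gamma> \<and>
        R ` U \<inter> cube (R x) r
          = {y. y $ k > \<gamma> (\<chi> i. if i = k then 0 else y $ i)} \<inter> cube (R x) r)"

definition bilipschitz_homeomorphism_onto_image ::
  "'a::metric_space set \<Rightarrow> ('a \<Rightarrow> 'b::metric_space) \<Rightarrow> bool" where
  "bilipschitz_homeomorphism_onto_image D f \<longleftrightarrow>
     (\<exists>g. homeomorphism D (f ` D) f g \<and> (\<exists>C. C-lipschitz_on D f) \<and> (\<exists>C. C-lipschitz_on (f ` D) g))"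

definition lipschitz_deformation ::
  "(real ^ 'n) set \<Rightarrow> ((real ^ 'n) \<times> real \<Rightarrow> real ^ 'n) \<Rightarrow> bool" where
  "lipschitz_deformation U \<Psi> \<longleftrightarrow>
     \<Psi> ` (frontier U \<times> {0..1}) \<subseteq> closure U \<and>
     bilipschitz_homeomorphism_onto_image (frontier U \<times> {0..1}) \<Psi> \<and>
     (\<forall>x\<in>frontier U. \<Psi> (x, 0) = x)"

text \<open>
  Convergence in \<open>L\<^sup>1(A; M)\<close> along a filter: the functions and the limit belong to the space
  (the former eventually), and the norms of the differences tend to \<open>0\<close>.
\<close>

definition tendsto_L1_on ::
  "'a measure \<Rightarrow> 'a set \<Rightarrow> ('t \<Rightarrow> 'a \<Rightarrow> real) \<Rightarrow> ('a \<Rightarrow> real) \<Rightarrow> 't filter \<Rightarrow> bool" where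
  "tendsto_L1_on M A f g F \<longleftrightarrow>
     (\<forall>\<^sub>F t in F. set_integrable M A (f t)) \<and> set_integrable M A g \<and>
     ((\<lambda>t. LINT x:A|M. \<bar>f t x - g x\<bar>) \<longlongrightarrow> 0) F"

definition regular_lipschitz_deformation ::
  "(real ^ 'n) set \<Rightarrow> ((real ^ 'n) \<times> real \<Rightarrow> real ^ 'n) \<Rightarrow> bool" where
  "regular_lipschitz_deformation U \<Psi> \<longleftrightarrow>
     lipschitz_deformation U \<Psi> \<and>
     tendsto_L1_on (hausdorff_measure (CARD('n) - 1)) (frontier U)
       (\<lambda>\<tau>. tangential_jacobian (CARD('n) - 1) (frontier U) (\<lambda>x. \<Psi> (x, \<tau>))) (\<lambda>x. 1) (at_right 0)"

end

theory Submission
  imports Defs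
begin

text \<open>
  The deformation is \<open>\<Psi>(x, \<tau>) = x + \<epsilon> \<tau> X(x)\<close> for a \<open>C\<^sup>1\<close> vector field \<open>X\<close> that is transversal to the
  boundary. Locally such a field is the constant vertical direction of a graph chart; since the
  inward directions at a point form an open convex cone, a combination of these directions with
  \<open>C\<^sup>1\<close> bump functions as coefficients is again inward. No difference of two boundary points is
  close to a short positive multiple of \<open>X\<close>, hence \<open>\<Psi>\<close> is bi-Lipschitz for small \<open>\<epsilon>\<close>.

  The differential \<open>I + \<epsilon> \<tau> DX\<close> of \<open>\<Psi>\<^sub>\<tau>\<close> tends to \<open>I\<close>, so its Jacobian on any hyperplane tends
  boundedly to \<open>1\<close>. It remains that the tangent cone of the boundary is a hyperplane almost everywhere
  and depends measurably on the point. This is Rademacher's theorem for the chart functions,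
  together with the fact that the \<open>(n-1)\<close>-dimensional Hausdorff measure of a piece of a Lipschitz
  graph is bounded by the Lebesgue measure of the cylinder over it.
\<close>

text \<open>The field is smooth, so every \<Psi>\<tau> has a differential at each point of the
  space; all roughness lies in the boundary, where the tangential Jacobian has its default value 0
  off the points with a genuine tangent hyperplane. Exceptional points of positive surface measure
  would spoil the limit, so Rademacher's theorem must be brought to surface measure. For this the
  chart functions are extended to the whole space, constant along the vertical direction
  \<open>e\<close>: their nondifferentiability set is then Lebesgue null in the ambient space and a
  union of lines parallel to \<open>e\<close>, so cylinders over the bad boundary points have open
  neighbourhoods of small volume. The same estimate makes the surface measure of the compact
  boundary finite, so that a constant can dominate the Jacobians. Measurability is an obstacle of
  its own: the Jacobian is defined through an arbitrarily chosen orthonormal basis, which has to be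
  eliminated in favour of a formula in the unit normal, and it is controlled only off null sets, all
  of whose subsets are measurable.\<close>

section \<open>Rademacher's theorem\<close>

text \<open>A one-sided density theorem, with \<open>E\<close> not assumed measurable. Enclose
  \<open>A\<close> in an open \<open>T\<close> of excess measure below \<open>c * e\<close>. The
  given balls that lie in \<open>T\<close> form a Vitali cover of \<open>E\<close>; each spends the
  proportion \<open>c\<close> of its volume on \<open>T - A\<close>, so a disjoint selection has
  total measure at most \<open>e\<close> while missing only a null part of \<open>E\<close>.\<close>

lemma negligible_if_not_density_points:
  fixes A E :: "'a::euclidean_space set"
  assumes A: "A \<in> sets lebesgue" and "c > 0"
    and *: "\<And>x e. x \<in> E \<Longrightarrow> e > 0 \<Longrightarrow> \<exists>s. 0 < s \<and> s < e \<and>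
       c * measure lebesgue (ball x s) \<le> measure lebesgue (ball x s - A)"
    and "E \<subseteq> A"
  shows "negligible E"
  unfolding negligible_outer_le
proof (intro allI impI)
  fix e :: real assume "e > 0"
  then have "c * e > 0" using \<open>c > 0\<close> by simp
  then obtain T where T: "open T" "A \<subseteq> T" "T - A \<in> lmeasurable"
      "emeasure lebesgue (T - A) < ennreal (c * e)"
    using sets_lebesgue_outer_open[OF A] by metis
  define K where "K = {(x, s). x \<in> E \<and> 0 < s \<and> ball x s \<subseteq> T \<and>
     c * measure lebesgue (ball x s) \<le> measure lebesgue (ball x s - A)}"
  have "\<exists>i. i \<in> K \<and> x \<in> ball (fst i) (snd i) \<and> snd i < d" if x: "x \<in> E" "0 < d" for x d
  proof -
    obtain r where r: "r > 0" "ball x r \<subseteq> T"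
      using T(1,2) \<open>E \<subseteq> A\<close> \<open>x \<in> E\<close> by (meson openE subset_iff)
    obtain s where s: "0 < s" "s < min r d"
        "c * measure lebesgue (ball x s) \<le> measure lebesgue (ball x s - A)"
      using *[OF x(1), of "min r d"] r x by auto
    then have "ball x s \<subseteq> T" using r by (meson min_less_iff_conj less_imp_le order_trans subset_ball)
    then show ?thesis using s x by (intro exI[of _ "(x, s)"]) (auto simp: K_def)
  qed
  then obtain D where D: "countable D" "D \<subseteq> K"
     "pairwise (\<lambda>i j. disjnt (ball (fst i) (snd i)) (ball (fst j) (snd j))) D"
     "negligible (E - (\<Union>i\<in>D. ball (fst i) (snd i)))"
    using Vitali_covering_theorem_balls[of E K fst snd] by blast
  define B where "B i = ball (fst i) (snd i)" for i :: "'a \<times> real"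
  have disj: "disjoint_family_on B D"
    using D(3) by (auto simp: disjoint_family_on_def pairwise_def disjnt_def B_def)
  have "ennreal c * emeasure lebesgue (\<Union>i\<in>D. B i)
      = (\<integral>\<^sup>+i. ennreal c * emeasure lebesgue (B i) \<partial>count_space D)"
    using D(1) disj by (subst emeasure_UN_countable) (auto simp: nn_integral_cmult B_def)
  also have "\<dots> \<le> (\<integral>\<^sup>+i. emeasure lebesgue (B i - A) \<partial>count_space D)"
  proof (rule nn_integral_mono)
    fix i assume "i \<in> space (count_space D)"
    then have "i \<in> K" using D by auto
    have fin: "B i \<in> lmeasurable" "B i - A \<in> lmeasurable"
      using A by (auto simp: B_def intro: fmeasurable_Diff)
    have "c * measure lebesgue (B i) \<le> measure lebesgue (B i - A)"
      using \<open>i \<in> K\<close> by (auto simp: K_def B_def)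
    then show "ennreal c * emeasure lebesgue (B i) \<le> emeasure lebesgue (B i - A)"
      using fin \<open>c > 0\<close> by (simp add: emeasure_eq_measure2 flip: ennreal_mult)
  qed
  also have "\<dots> = emeasure lebesgue (\<Union>i\<in>D. B i - A)"
  proof (rule emeasure_UN_countable[symmetric])
    show "disjoint_family_on (\<lambda>i. B i - A) D"
      using disj unfolding disjoint_family_on_def by blast
  qed (use D(1) A in \<open>auto simp: B_def\<close>)
  also have "\<dots> \<le> emeasure lebesgue (T - A)"
  proof (rule emeasure_mono)
    have "B i \<subseteq> T" if "i \<in> D" for i using subsetD[OF D(2) that] by (auto simp: K_def B_def)
    then show "(\<Union>i\<in>D. B i - A) \<subseteq> T - A" by blast
  qed (use T(3) in auto)
  also have "\<dots> \<le> ennreal c * ennreal e"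
    using T(4) \<open>c > 0\<close> \<open>e > 0\<close> by (simp add: ennreal_mult less_imp_le)
  finally have le: "emeasure lebesgue (\<Union>i\<in>D. B i) \<le> ennreal e"
    using \<open>c > 0\<close> by (subst (asm) ennreal_mult_le_mult_iff) auto
  have BU: "(\<Union>i\<in>D. B i) \<in> sets lebesgue"
    using D(1) by (auto simp: B_def)
  define V where "V = (E - (\<Union>i\<in>D. B i)) \<union> (\<Union>i\<in>D. B i)"
  have null: "E - (\<Union>i\<in>D. B i) \<in> null_sets lebesgue"
    using D(4) by (simp add: negligible_iff_null_sets B_def)
  have "emeasure lebesgue V \<le> ennreal e"
    using le emeasure_Un_null_set[OF BU null] by (simp add: V_def Un_commute)
  moreover have "V \<in> sets lebesgue" unfolding V_def using BU null by (intro sets.Un) auto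
  ultimately have "V \<in> lmeasurable"
    by (intro fmeasurableI) (auto intro: le_less_trans)
  moreover have "E \<subseteq> V" by (auto simp: V_def)
  moreover have "measure lebesgue V \<le> e"
    using \<open>emeasure lebesgue V \<le> ennreal e\<close> \<open>e > 0\<close> \<open>V \<in> lmeasurable\<close>
    by (simp add: emeasure_eq_measure2)
  ultimately show "\<exists>T. E \<subseteq> T \<and> T \<in> lmeasurable \<and> measure lebesgue T \<le> e" by blast
qed

text \<open>\<open>g\<close> is the density of the Stieltjes measure of \<open>F\<close>, obtained
  as the image of Lebesgue measure under the inverse \<open>G\<close>. The lower slope bound makes
  \<open>F\<close> a bijection of the line; the upper one makes \<open>F\<close> map null sets to
  null sets, which is the absolute continuity that Radon-Nikodym asks for.\<close>

lemma expanding_lipschitz_density: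
  fixes F :: "real \<Rightarrow> real"
  assumes low: "\<And>x y. x \<le> y \<Longrightarrow> y - x \<le> F y - F x"
    and up: "\<And>x y. x \<le> y \<Longrightarrow> F y - F x \<le> L * (y - x)"
  obtains g :: "real \<Rightarrow> ennreal" where "g \<in> borel_measurable borel"
    "\<And>a b. a \<le> b \<Longrightarrow> emeasure (density lborel g) {a<..<b} = ennreal (F b - F a)"
proof -
  have mono: "x < y \<Longrightarrow> F x < F y" for x y
    using low[of x y] by simp
  have inj: "inj F"
    using mono by (metis injI linorder_neqE_linordered_idom order_less_irrefl)
  have "0 \<le> L" using low[of 0 1] up[of 0 1] by simp
  have lip: "L-lipschitz_on UNIV F"
  proof (rule lipschitz_onI)
    fix x y :: real
    show "dist (F x) (F y) \<le> L * dist x y"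
      using low[of x y] up[of x y] low[of y x] up[of y x]
      by (cases "x \<le> y") (auto simp: dist_real_def abs_if algebra_simps)
  qed fact
  have cont: "continuous_on UNIV F"
    using lip by (rule lipschitz_on_continuous_on)
  have "surj F"
    unfolding surj_def
  proof
    fix y
    \<comment> \<open>With slope at least 1, \<open>F\<close> takes the value \<open>y\<close>
      within distance \<open>d\<close> of 0.\<close>
    define d where "d = \<bar>y - F 0\<bar>"
    have "F (-d) \<le> y" "y \<le> F d"
      using low[of 0 d] low[of "-d" 0] by (auto simp: d_def)
    then have "\<exists>x. -d \<le> x \<and> x \<le> d \<and> F x = y"
      using cont by (intro IVT') (auto intro: continuous_on_subset simp: d_def)
    then show "\<exists>x. y = F x" by auto
  qed
  define G where "G = inv F"
  have GF [simp]: "G (F x) = x" "F (G x) = x" for x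
    using inj \<open>surj F\<close> by (auto simp: G_def surj_f_inv_f)
  have mono': "F x < F y \<longleftrightarrow> x < y" for x y
    using mono by (metis linorder_neqE order_less_asym order_less_irrefl)
  have "mono G"
    by (metis GF(2) linorder_not_less mono' monoI)
  then have [measurable]: "G \<in> borel_measurable borel"
    by (rule borel_measurable_mono)
  define M where "M = distr lborel borel G"
  have vimage: "G -` A = F ` A" for A
  proof (intro set_eqI iffI)
    fix x assume "x \<in> G -` A"
    then have "F (G x) \<in> F ` A" by blast
    then show "x \<in> F ` A" by simp
  qed auto
  have "absolutely_continuous lborel M"
    unfolding absolutely_continuous_def
  proof
    fix N assume N: "N \<in> null_sets (lborel :: real measure)"
    then have [measurable]: "N \<in> sets borel" by auto
    have "negligible N" using N by (simp add: negligible_iff_null_sets null_sets_completionI)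
    then have "negligible (F ` N)"
      by (rule negligible_locally_Lipschitz_image[rotated])
         (use lip in \<open>auto simp: lipschitz_on_def dist_norm intro!: exI[of _ UNIV] exI[of _ L]\<close>)
    then have "F ` N \<in> null_sets lebesgue" by (simp add: negligible_iff_null_sets)
    moreover have "F ` N \<in> sets borel"
      using measurable_sets[of G borel borel N] by (simp add: vimage)
    ultimately have "emeasure lborel (F ` N) = 0"
      by (auto simp: null_sets_def)
    then show "N \<in> null_sets M"
      by (auto simp: null_sets_def M_def emeasure_distr vimage)
  qed
  then obtain g where g: "g \<in> borel_measurable lborel" "density lborel g = M"
    using sigma_finite_measure.Radon_Nikodym[OF sigma_finite_lborel, of M] by (auto simp: M_def)
  have "emeasure M {a<..<b} = ennreal (F b - F a)" if "a \<le> b" for a b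
  proof -
    have "G -` {a<..<b} = {F a<..<F b}"
      by (auto simp flip: mono'[of _ "G _"] mono'[of "G _"])
    then show ?thesis using low[OF that] that by (simp add: M_def emeasure_distr)
  qed
  then show thesis using that g by simp
qed


text \<open>Let \<open>I\<close> be the interval between \<open>x\<close> and a point
  \<open>y\<close> with quotient at most \<open>q\<close>. Since \<open>g\<close> exceeds
  \<open>p\<close> on \<open>A\<close>, the part of \<open>I\<close> in \<open>A\<close> has at most
  the proportion \<open>q / p\<close> of its length. As \<open>I\<close> fills half of the ball of
  radius \<open>s\<close> about \<open>x\<close>, the complement of \<open>A\<close> keeps at least
  the proportion \<open>(1 - q / p) / 2\<close> of that ball.\<close>

lemma negligible_lower_derivative_less_density:
  fixes F :: "real \<Rightarrow> real" and g :: "real \<Rightarrow> ennreal"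
  assumes [measurable]: "g \<in> borel_measurable borel"
    and g: "\<And>a b. a \<le> b \<Longrightarrow> emeasure (density lborel g) {a<..<b} = ennreal (F b - F a)"
    and qp: "0 < q" "q < p"
  shows "negligible {x. ennreal p < g x \<and>
    (\<forall>e>0. \<exists>y. y \<noteq> x \<and> \<bar>y - x\<bar> < e \<and> (F y - F x) / (y - x) \<le> q)}" (is "negligible ?E")
proof -
  define A where "A = {x. ennreal p < g x}"
  have [measurable]: "A \<in> sets borel" by (simp add: A_def)
  show ?thesis
  proof (rule negligible_if_not_density_points[of A "(1 - q / p) / 2"])
    show "0 < (1 - q / p) / 2" using qp by simp
    fix x e :: real assume "x \<in> ?E" "e > 0"
    then obtain y where y: "y \<noteq> x" "\<bar>y - x\<bar> < e" "(F y - F x) / (y - x) \<le> q" by auto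
    define s where "s = \<bar>y - x\<bar>"
    define a where "a = min x y"
    define b where "b = max x y"
    define I where "I = {a<..<b}"
    have ab: "a \<le> b" "b - a = s" "s > 0" using y by (auto simp: a_def b_def s_def)
    have I: "I \<subseteq> ball x s" by (auto simp: I_def a_def b_def s_def dist_real_def)
    have F: "F b - F a \<le> q * s"
      using y by (cases "x \<le> y") (auto simp: a_def b_def s_def field_simps)
    have fin: "I \<inter> A \<in> lmeasurable"
      by (rule fmeasurable_Int_fmeasurable) (auto simp: I_def)
    have "ennreal p * emeasure lborel (I \<inter> A) = (\<integral>\<^sup>+x. ennreal p * indicator (I \<inter> A) x \<partial>lborel)"
      by (subst nn_integral_cmult_indicator) (auto simp: I_def)
    also have "\<dots> \<le> (\<integral>\<^sup>+x. g x * indicator I x \<partial>lborel)"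
      by (intro nn_integral_mono) (auto simp: A_def indicator_def)
    also have "\<dots> = emeasure (density lborel g) I"
      by (simp add: emeasure_density I_def)
    also have "\<dots> \<le> ennreal (q * s)"
      unfolding I_def using g[OF ab(1)] F by (simp add: ennreal_leI)
    finally have "ennreal p * emeasure lebesgue (I \<inter> A) \<le> ennreal (q * s)"
      by (simp add: I_def)
    then have "p * measure lebesgue (I \<inter> A) \<le> q * s"
      using fin qp ab by (simp add: emeasure_eq_measure2 flip: ennreal_mult)
    then have le: "measure lebesgue (I \<inter> A) \<le> q / p * s"
      using qp by (simp add: field_simps)
    have "(1 - q / p) / 2 * measure lebesgue (ball x s) = s - q / p * s"
      using ab qp by (simp add: ball_eq_greaterThanLessThan field_simps)
    also have "\<dots> \<le> measure lebesgue I - measure lebesgue (I \<inter> A)"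
      using le ab by (simp add: I_def)
    also have "\<dots> = measure lebesgue (I - A)"
      by (subst measurable_measure_Diff[symmetric]) (auto simp: I_def Diff_Int2 Diff_Int)
    also have "\<dots> \<le> measure lebesgue (ball x s - A)"
      using I by (intro measure_mono_fmeasurable fmeasurable_Diff) (auto simp: I_def)
    finally show "\<exists>s. 0 < s \<and> s < e \<and> (1 - q / p) / 2 * measure lebesgue (ball x s)
        \<le> measure lebesgue (ball x s - A)"
      using y ab(3) by (intro exI[of _ s]) (simp add: s_def)
  qed (auto simp: A_def)
qed

text \<open>
  The density bounds the lower derivative of \<open>F\<close> from below. Applied to \<open>F\<^sub>\<plusminus>(x) = \<plusminus>f(x) + (C + 1) x\<close>,
  whose densities have the constant sum \<open>2 (C + 1)\<close>, this also bounds the upper derivative.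
\<close>

lemma negligible_lipschitz_not_differentiable_real:
  fixes f :: "real \<Rightarrow> real"
  assumes "C-lipschitz_on UNIV f"
  shows "negligible {x. \<not> f differentiable (at x)}"
proof -
  \<comment> \<open>The summand \<open>(C + 1) * x\<close> turns slopes between \<open>-C\<close>
    and \<open>C\<close> into slopes between 1 and \<open>2 * C + 1\<close>, for either sign of
    \<open>f\<close>.\<close>
  define F where "F \<sigma> x = \<sigma> * f x + (C + 1) * x" for \<sigma> x :: real
  have "0 \<le> C" using assms by (rule lipschitz_on_nonneg)
  have lip: "\<bar>f y - f x\<bar> \<le> C * (y - x)" if "x \<le> y" for x y
    using lipschitz_onD[OF assms, of y x] that by (simp add: dist_real_def)
  have low: "y - x \<le> F \<sigma> y - F \<sigma> x" and up: "F \<sigma> y - F \<sigma> x \<le> (2 * C + 1) * (y - x)"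
    if "x \<le> y" "\<sigma> \<in> {-1, 1}" for x y \<sigma>
    using lip[OF that(1)] that(2) by (auto simp: F_def algebra_simps)
  have "\<exists>g \<in> borel_measurable borel.
     \<forall>a b. a \<le> b \<longrightarrow> emeasure (density lborel g) {a<..<b} = ennreal (F \<sigma> b - F \<sigma> a)" if "\<sigma> \<in> {-1,1}" for \<sigma>
    using expanding_lipschitz_density[of "F \<sigma>" "2 * C + 1"] low up that by metis
  then obtain g where g: "\<sigma> \<in> {-1,1} \<Longrightarrow> g \<sigma> \<in> borel_measurable borel"
     "\<sigma> \<in> {-1,1} \<Longrightarrow> a \<le> b \<Longrightarrow> emeasure (density lborel (g \<sigma>)) {a<..<b} = ennreal (F \<sigma> b - F \<sigma> a)"
    for \<sigma> a b by metis
  note [measurable] = g(1)[of 1, simplified] g(1)[of "-1", simplified]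
  define K where "K = 2 * (C + 1)"
  have "K > 0" using \<open>0 \<le> C\<close> by (simp add: K_def)
  define h where "h x = (g 1 x + g (-1) x) / ennreal K" for x
  \<comment> \<open>The increments of \<open>F 1\<close> and \<open>F (-1)\<close> add up to
    \<open>K\<close> times the length of the interval. So \<open>h\<close> gives every interval its
    length and equals 1 almost everywhere by uniqueness of densities.\<close>
  have "lborel = density lborel h"
  proof (rule lborel_eqI)
    fix a b :: real assume "\<And>i. i \<in> Basis \<Longrightarrow> a \<bullet> i \<le> b \<bullet> i"
    then have ab: "a \<le> b" by simp
    have "emeasure (density lborel h) {a<..<b}
       = (\<integral>\<^sup>+x. (g 1 x * indicator {a<..<b} x + g (-1) x * indicator {a<..<b} x) / ennreal K \<partial>lborel)"
      unfolding h_def by (subst emeasure_density)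
        (auto intro!: nn_integral_cong simp: indicator_def)
    also have "\<dots> = (emeasure (density lborel (g 1)) {a<..<b}
        + emeasure (density lborel (g (-1))) {a<..<b}) / ennreal K"
      by (simp add: nn_integral_divide nn_integral_add emeasure_density)
    also have "\<dots> = ennreal ((F 1 b - F 1 a) + (F (-1) b - F (-1) a)) / ennreal K"
      using g(2)[of 1 a b] g(2)[of "-1" a b] ab low[OF ab, of 1] low[OF ab, of "-1"]
      by (simp flip: ennreal_plus)
    also have "\<dots> = ennreal (K * (b - a)) / ennreal K"
      by (simp add: F_def K_def algebra_simps)
    also have "\<dots> = ennreal (b - a)"
      using \<open>K > 0\<close> ab by (simp add: divide_ennreal)
    finally show "emeasure (density lborel h) (box a b) = ennreal (\<Prod>i\<in>Basis. (b - a) \<bullet> i)"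
      by (simp add: box_real)
  qed simp
  moreover have [measurable]: "h \<in> borel_measurable borel"
    unfolding h_def by measurable
  ultimately have "AE x in lborel. h x = 1"
    using sigma_finite_measure.density_unique_iff[OF sigma_finite_lborel, of h "\<lambda>_. 1"]
    by (simp add: density_1)
  then have "AE x in lebesgue. h x = 1" by (rule AE_completion)
  then have N0: "negligible {x. h x \<noteq> 1}"
    by (simp add: negligible_iff_null_sets AE_iff_null)
  define E where "E \<sigma> q p = {x. ennreal p < g \<sigma> x \<and>
    (\<forall>e>0. \<exists>y. y \<noteq> x \<and> \<bar>y - x\<bar> < e \<and> (F \<sigma> y - F \<sigma> x) / (y - x) \<le> q)}" for \<sigma> q p
  \<comment> \<open>Rational thresholds keep the union of exceptional sets countable.\<close>
  define I where "I = {(\<sigma>::real, q::real, p::real). \<sigma> \<in> {-1,1} \<and> q \<in> \<rat> \<and> p \<in> \<rat> \<and> 0 < q \<and> q < p}"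
  have "countable I"
    by (rule countable_subset[of _ "{-1,1} \<times> \<rat> \<times> \<rat>"])
       (auto simp: I_def countable_rat intro!: countable_SIGMA)
  define N where "N = (\<Union>(\<sigma>, q, p) \<in> I. E \<sigma> q p)"
  have "negligible N"
    unfolding N_def
  proof (rule negligible_countable_Union)
    fix S assume "S \<in> (\<lambda>(\<sigma>, q, p). E \<sigma> q p) ` I"
    then obtain \<sigma> q p where "\<sigma> \<in> {-1,1}" "0 < q" "q < p" "S = E \<sigma> q p" by (auto simp: I_def)
    then show "negligible S"
      unfolding E_def by (auto intro!: negligible_lower_derivative_less_density g)
  qed (use \<open>countable I\<close> in auto)
  have "f differentiable (at x)" if x: "h x = 1" "x \<notin> N" for x
  proof -
    define Q where "Q \<sigma> y = (F \<sigma> y - F \<sigma> x) / (y - x)" for \<sigma> y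
    define d where "d \<sigma> = enn2real (g \<sigma> x)" for \<sigma>
    have hx: "g 1 x + g (-1) x = ennreal K"
      using x(1) \<open>K > 0\<close> unfolding h_def
      by (metis divide_eq_1_ennreal ennreal_neq_top ennreal_eq_0_iff not_less)
    then have fin: "g 1 x \<noteq> top" "g (-1) x \<noteq> top"
      by (auto simp: top_add)
    then have gd: "g \<sigma> x = ennreal (d \<sigma>)" if "\<sigma> \<in> {-1,1}" for \<sigma>
      using that by (auto simp: d_def less_top)
    have d0: "d \<sigma> \<ge> 0" for \<sigma> by (simp add: d_def)
    have dK: "d 1 + d (-1) = K"
      using hx \<open>K > 0\<close> d0 by (simp add: gd flip: ennreal_plus)
    have QK: "Q 1 y + Q (-1) y = K" if "y \<noteq> x" for y
    proof -
      have "(F 1 y - F 1 x) + (F (-1) y - F (-1) x) = K * (y - x)"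
        by (simp add: F_def K_def algebra_simps)
      then show ?thesis using that by (simp add: Q_def flip: add_divide_distrib)
    qed
    have lowQ: "\<forall>\<^sub>F y in at x. d \<sigma> - e < Q \<sigma> y" if "e > 0" "\<sigma> \<in> {-1,1}" for e \<sigma>
    proof (cases "d \<sigma> = 0")
      \<comment> \<open>No positive \<open>p\<close> lies below the density here, so the sets
        \<open>E \<sigma> q p\<close> say nothing; the slope bound 1 gives the estimate
        directly.\<close>
      case True
      have "1 \<le> Q \<sigma> y" if "y \<noteq> x" for y
        using low[of x y \<sigma>] low[of y x \<sigma>] \<open>\<sigma> \<in> {-1,1}\<close> that
        by (cases "x \<le> y") (auto simp: Q_def field_simps)
      then show ?thesis using True \<open>e > 0\<close>
        by (auto simp: eventually_at_filter intro!: always_eventually) force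
    next
      case False
      then have "max 0 (d \<sigma> - e) < d \<sigma>" using \<open>e > 0\<close> d0[of \<sigma>] by auto
      then obtain p where p: "p \<in> \<rat>" "max 0 (d \<sigma> - e) < p" "p < d \<sigma>"
        using Rats_dense_in_real by blast
      obtain q where q: "q \<in> \<rat>" "max 0 (d \<sigma> - e) < q" "q < p"
        using Rats_dense_in_real[OF p(2)] by blast
      have "x \<notin> E \<sigma> q p"
        using x(2) p q that(2) unfolding N_def I_def by force
      moreover have "ennreal p < g \<sigma> x"
        using gd[OF that(2)] p by (simp add: ennreal_less_iff)
      ultimately obtain r where r: "r > 0" "\<And>y. y \<noteq> x \<Longrightarrow> \<bar>y - x\<bar> < r \<Longrightarrow> q < Q \<sigma> y"
        unfolding E_def Q_def by (auto simp: not_le)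
      have "d \<sigma> - e < Q \<sigma> y" if "y \<noteq> x" "dist y x < r" for y
        using r(2)[of y] that q by (auto simp: dist_real_def)
      then show ?thesis
        using r(1) by (auto simp: eventually_at)
    qed
    \<comment> \<open>\<open>Q 1 + Q (-1)\<close> and \<open>d 1 + d (-1)\<close> are both
      \<open>K\<close>, so the lower estimate for \<open>Q (-1)\<close> is the upper estimate for
      \<open>Q 1\<close>.\<close>
    have "(Q 1 \<longlongrightarrow> d 1) (at x)"
    proof (rule tendstoI)
      fix e :: real assume "e > 0"
      have "\<forall>\<^sub>F y in at x. y \<noteq> x" by (simp add: eventually_at_filter)
      with lowQ[OF \<open>e > 0\<close>, of 1, simplified] lowQ[OF \<open>e > 0\<close>, of "-1", simplified]
      show "\<forall>\<^sub>F y in at x. dist (Q 1 y) (d 1) < e"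
      proof eventually_elim
        case (elim y)
        then show ?case using QK[of y] dK by (auto simp: dist_real_def)
      qed
    qed
    then have "(F 1 has_field_derivative d 1) (at x)"
      by (simp add: has_field_derivative_iff Q_def[abs_def])
    then have "((\<lambda>y. F 1 y - (C + 1) * y) has_field_derivative d 1 - (C + 1)) (at x)"
      by (auto intro!: derivative_eq_intros)
    then have "(f has_field_derivative d 1 - (C + 1)) (at x)" by (simp add: F_def)
    then show ?thesis using real_differentiable_def by blast
  qed
  then have "{x. \<not> f differentiable (at x)} \<subseteq> {x. h x \<noteq> 1} \<union> N" by auto
  then show ?thesis
    using N0 \<open>negligible N\<close> by (meson negligible_Un negligible_subset)
qed

text \<open>Fubini by translation: the measure of \<open>N\<close> is the average over
  \<open>t\<close> in [0,1] of the measures of its translates by multiples of \<open>e\<close>, and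
  after exchanging the integrals each inner integral runs along a line.\<close>

lemma null_set_if_null_on_lines:
  fixes N :: "'a::euclidean_space set"
  assumes [measurable]: "N \<in> sets borel"
    and null: "\<And>x. negligible {t::real. x + t *\<^sub>R e \<in> N}"
  shows "negligible N"
proof -
  have line0: "(\<integral>\<^sup>+t. indicator {0..1} t * indicator N (x + t *\<^sub>R e) \<partial>lborel) = (0::ennreal)" for x
  proof -
    have [measurable]: "{t::real. x + t *\<^sub>R e \<in> N} \<in> sets borel" by measurable
    have "(\<integral>\<^sup>+t. indicator {0..1} t * indicator N (x + t *\<^sub>R e) \<partial>lborel)
        \<le> (\<integral>\<^sup>+t. indicator {t. x + t *\<^sub>R e \<in> N} t \<partial>lborel)"
      by (intro nn_integral_mono) (auto simp: indicator_def)
    also have "\<dots> = 0"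
      using null[of x] by (simp add: negligible_iff_null_sets null_sets_def)
    finally show ?thesis by simp
  qed
  have "emeasure lborel N = (\<integral>\<^sup>+t. indicator {0..1::real} t * emeasure lborel N \<partial>lborel)"
    by (subst nn_integral_multc) auto
  also have "\<dots> = (\<integral>\<^sup>+t. \<integral>\<^sup>+x. indicator {0..1} t * indicator N (x + t *\<^sub>R e) \<partial>lborel \<partial>lborel)"
  proof (rule nn_integral_cong)
    fix t :: real
    have "emeasure lborel N = emeasure (distr lborel borel ((+) (t *\<^sub>R e))) N"
      by (simp add: lborel_distr_plus)
    also have "\<dots> = (\<integral>\<^sup>+x. indicator N x \<partial>(distr lborel borel ((+) (t *\<^sub>R e))))"
      by simp
    also have "\<dots> = (\<integral>\<^sup>+x. indicator N (x + t *\<^sub>R e) \<partial>lborel)"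
      by (subst nn_integral_distr) (auto simp: add.commute)
    finally show "indicator {0..1} t * emeasure lborel N
        = (\<integral>\<^sup>+x. indicator {0..1} t * indicator N (x + t *\<^sub>R e) \<partial>lborel)"
      by (subst nn_integral_cmult) auto
  qed
  also have "\<dots> = (\<integral>\<^sup>+x. \<integral>\<^sup>+t. indicator {0..1} t * indicator N (x + t *\<^sub>R e) \<partial>lborel \<partial>lborel)"
    by (intro lborel_pair.Fubini') measurable
  also have "\<dots> = 0" by (simp add: line0)
  finally have "N \<in> null_sets lborel" by auto
  then show ?thesis by (simp add: negligible_iff_null_sets null_sets_completionI)
qed

text \<open>The points where the derivative in direction \<open>e\<close> exists, as the Cauchy
  condition for the difference quotients. Without the limit, and with the thresholds
  \<open>1 / (m + 1)\<close> and \<open>1 / (k + 1)\<close>, this is a countable intersection of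
  countable unions of closed sets if \<open>f\<close> is continuous, hence a Borel set, as Fubini's
  theorem demands.\<close>

definition line_quotient_cauchy :: "('a::real_normed_vector \<Rightarrow> real) \<Rightarrow> 'a \<Rightarrow> 'a set" where
  "line_quotient_cauchy f e = (\<Inter>k::nat. \<Union>m::nat.
     \<Inter>s\<in>{s. s \<noteq> 0 \<and> \<bar>s\<bar> < 1 / (real m + 1)}. \<Inter>t\<in>{t. t \<noteq> 0 \<and> \<bar>t\<bar> < 1 / (real m + 1)}.
     {x. \<bar>(f (x + s *\<^sub>R e) - f x) / s - (f (x + t *\<^sub>R e) - f x) / t\<bar> \<le> 1 / (real k + 1)})"

lemma negligible_not_line_quotient_cauchy:
  fixes f :: "'a::euclidean_space \<Rightarrow> real"
  assumes lip: "L-lipschitz_on UNIV f"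
  shows "negligible (- line_quotient_cauchy f e)"
proof (rule null_set_if_null_on_lines[where e = e])
  have [continuous_intros]: "continuous_on S (\<lambda>x. f (g x))"
    if "continuous_on S g" for S :: "'b::topological_space set" and g
    using continuous_on_compose2[OF lipschitz_on_continuous_on[OF lip] that] by simp
  have cl: "closed {x. \<bar>(f (x + s *\<^sub>R e) - f x) / s - (f (x + t *\<^sub>R e) - f x) / t\<bar> \<le> 1 / (real k + 1)}"
    if "s \<noteq> 0" "t \<noteq> 0" for s t and k :: nat
    using that by (intro closed_Collect_le continuous_intros) auto
  have "closed (\<Inter>s\<in>{s. s \<noteq> 0 \<and> \<bar>s\<bar> < 1 / (real m + 1)}. \<Inter>t\<in>{t. t \<noteq> 0 \<and> \<bar>t\<bar> < 1 / (real m + 1)}.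
     {x. \<bar>(f (x + s *\<^sub>R e) - f x) / s - (f (x + t *\<^sub>R e) - f x) / t\<bar> \<le> 1 / (real k + 1)})" for k m :: nat
    by (intro closed_INT ballI cl) auto
  then show "- line_quotient_cauchy f e \<in> sets borel"
    unfolding line_quotient_cauchy_def
    by (intro borel_comp sets.countable_INT'' sets.countable_UN'' borel_closed) simp_all
  fix x
  define g where "g t = f (x + t *\<^sub>R e)" for t :: real
  have "(L * norm e)-lipschitz_on UNIV g"
  proof (rule lipschitz_onI)
    fix s t :: real
    have "dist (g s) (g t) \<le> L * dist (x + s *\<^sub>R e) (x + t *\<^sub>R e)"
      unfolding g_def by (rule lipschitz_onD[OF lip]) auto
    also have "\<dots> = L * norm e * dist s t"
      by (simp add: dist_norm flip: scaleR_left_diff_distrib)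
    finally show "dist (g s) (g t) \<le> L * norm e * dist s t" .
  qed (use lipschitz_on_nonneg[OF lip] in simp)
  then have "negligible {t. \<not> g differentiable (at t)}"
    by (rule negligible_lipschitz_not_differentiable_real)
  moreover have "x + t *\<^sub>R e \<in> line_quotient_cauchy f e" if diff: "g differentiable (at t)" for t
  proof -
    obtain d where "(g has_field_derivative d) (at t)"
      using diff real_differentiable_def by blast
    then have lim: "((\<lambda>s. (g (t + s) - g t) / s) \<longlongrightarrow> d) (at 0)"
      by (simp add: DERIV_def)
    have "\<exists>m::nat. \<forall>s. s \<noteq> 0 \<and> \<bar>s\<bar> < 1 / (real m + 1) \<longrightarrow> \<bar>(g (t + s) - g t) / s - d\<bar> < 1 / (real k + 1) / 2"
      for k :: nat
    proof -
      have "\<forall>\<^sub>F s in at 0. dist ((g (t + s) - g t) / s) d < 1 / (real k + 1) / 2"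
        by (rule tendstoD[OF lim]) simp
      then obtain r where r: "r > 0" "\<And>s. s \<noteq> 0 \<Longrightarrow> \<bar>s\<bar> < r \<Longrightarrow> \<bar>(g (t + s) - g t) / s - d\<bar> < 1 / (real k + 1) / 2"
        by (auto simp: eventually_at dist_real_def)
      obtain m :: nat where "1 / (real m + 1) < r"
        using reals_Archimedean[OF r(1)] by (auto simp: inverse_eq_divide add.commute)
      then show ?thesis using r(2) by (intro exI[of _ m]) auto
    qed
    then obtain m :: "nat \<Rightarrow> nat" where m: "\<And>k s. s \<noteq> 0 \<Longrightarrow> \<bar>s\<bar> < 1 / (real (m k) + 1) \<Longrightarrow>
        \<bar>(g (t + s) - g t) / s - d\<bar> < 1 / (real k + 1) / 2" by metis
    have "\<bar>(g (t + s) - g t) / s - (g (t + u) - g t) / u\<bar> \<le> 1 / (real k + 1)"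
      if "s \<noteq> 0" "\<bar>s\<bar> < 1 / (real (m k) + 1)" "u \<noteq> 0" "\<bar>u\<bar> < 1 / (real (m k) + 1)" for k s u
      proof -
      have "\<bar>a - b\<bar> \<le> c" if "\<bar>a - d\<bar> < c / 2" "\<bar>b - d\<bar> < c / 2" for a b c :: real
        using that by linarith
      then show ?thesis using m[OF that(1,2)] m[OF that(3,4)] .
    qed
    moreover have "g (t + s) = f (x + t *\<^sub>R e + s *\<^sub>R e)" for s
      by (simp add: g_def scaleR_add_left add.assoc)
    ultimately show ?thesis
      unfolding line_quotient_cauchy_def by (auto simp: g_def intro!: exI[of _ "m _"])
  qed
  ultimately show "negligible {t. x + t *\<^sub>R e \<in> - line_quotient_cauchy f e}"
    by (elim negligible_subset) auto
qed

text \<open>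
  Nekvinda and Zajicek's route from partial to total derivatives: near a density point of the set
  \<open>A\<close> of points with nearly the same partial derivatives, every corner of a coordinate path from
  \<open>x\<close> to \<open>x + h\<close> is close to a point of \<open>A\<close>, and \<open>f\<close> is Lipschitz.
\<close>

lemma increment_along_coordinates:
  fixes f :: "'a::euclidean_space \<Rightarrow> real" and \<delta> \<epsilon> \<eta> :: real
  assumes lip: "L-lipschitz_on UNIV f"
    and A: "\<And>y b s. y \<in> A \<Longrightarrow> b \<in> Basis \<Longrightarrow> \<bar>s\<bar> < \<delta> \<Longrightarrow> \<bar>f (y + s *\<^sub>R b) - f y - s * (c \<bullet> b)\<bar> \<le> \<epsilon> * \<bar>s\<bar>"
    and "norm h < \<delta>" "0 \<le> \<epsilon>"
    and near: "\<And>p. norm (p - x) \<le> norm h \<Longrightarrow> \<exists>y\<in>A. dist p y \<le> \<eta> * norm h"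
  shows "\<bar>f (x + h) - f x - c \<bullet> h\<bar> \<le> DIM('a) * (\<epsilon> + 2 * L * \<eta>) * norm h"
proof -
  define hS where "hS S = (\<Sum>b\<in>S. (h \<bullet> b) *\<^sub>R b)" for S
  have "\<bar>f (x + hS S) - f x - c \<bullet> hS S\<bar> \<le> card S * ((\<epsilon> + 2 * L * \<eta>) * norm h)"
    if "S \<subseteq> Basis" for S
    using finite_subset[OF that finite_Basis] that
  proof (induction S rule: finite_induct)
    case (insert b S)
    define p where "p = x + hS S"
    define s where "s = h \<bullet> b"
    \<comment> \<open>The corner reached so far is within \<open>norm h\<close> of \<open>x\<close>,
      so \<open>near\<close> supplies a point of \<open>A\<close> close to it.\<close>
    have "norm (hS S) \<le> norm h"
    proof (rule norm_le_componentwise)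
      fix i :: 'a assume i: "i \<in> Basis"
      have "hS S \<bullet> i = (\<Sum>j\<in>S. if i = j then h \<bullet> i else 0)"
        unfolding hS_def inner_sum_left using insert.prems i
        by (intro sum.cong) (auto simp: inner_Basis)
      also have "\<dots> = (if i \<in> S then h \<bullet> i else 0)"
        using insert.hyps by simp
      finally show "\<bar>hS S \<bullet> i\<bar> \<le> \<bar>h \<bullet> i\<bar>" by auto
    qed
    then obtain y where y: "y \<in> A" "dist p y \<le> \<eta> * norm h"
      using near[of p] by (auto simp: p_def)
    have s: "\<bar>s\<bar> \<le> norm h"
      using insert.prems by (auto simp: s_def Basis_le_norm)
    have "\<bar>f (y + s *\<^sub>R b) - f y - s * (c \<bullet> b)\<bar> \<le> \<epsilon> * \<bar>s\<bar>"
      using A[OF y(1), of b s] s assms(3) insert.prems by auto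
    also have "\<dots> \<le> \<epsilon> * norm h" using s \<open>0 \<le> \<epsilon>\<close> by (rule mult_left_mono)
    finally have 1: "\<bar>f (y + s *\<^sub>R b) - f y - s * (c \<bullet> b)\<bar> \<le> \<epsilon> * norm h" .
    have "L * dist p y \<le> L * (\<eta> * norm h)"
      using y(2) lipschitz_on_nonneg[OF lip] by (rule mult_left_mono)
    \<comment> \<open>Moving both ends of the edge from \<open>p\<close> to \<open>y\<close> costs
      the Lipschitz bound twice, hence \<open>2 * L * \<eta>\<close> per coordinate.\<close>
    then have 2: "\<bar>f p - f y\<bar> \<le> L * (\<eta> * norm h)"
        "\<bar>f (p + s *\<^sub>R b) - f (y + s *\<^sub>R b)\<bar> \<le> L * (\<eta> * norm h)"
      using lipschitz_onD[OF lip, of p y] lipschitz_onD[OF lip, of "p + s *\<^sub>R b" "y + s *\<^sub>R b"]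
      by (auto simp: dist_real_def)
    have "hS (insert b S) = s *\<^sub>R b + hS S"
      using insert.hyps by (simp add: hS_def s_def)
    then have 3: "x + hS (insert b S) = p + s *\<^sub>R b" "c \<bullet> hS (insert b S) = s * (c \<bullet> b) + c \<bullet> hS S"
      by (auto simp: p_def inner_add_right)
    have "\<bar>f (x + hS S) - f x - c \<bullet> hS S\<bar> \<le> card S * ((\<epsilon> + 2 * L * \<eta>) * norm h)"
      using insert by auto
    then have "\<bar>f (p + s *\<^sub>R b) - f x - (s * (c \<bullet> b) + c \<bullet> hS S)\<bar>
        \<le> card S * ((\<epsilon> + 2 * L * \<eta>) * norm h) + (\<epsilon> * norm h + 2 * (L * (\<eta> * norm h)))"
      using 1 2 unfolding p_def by linarith
    also have "\<dots> = card (insert b S) * ((\<epsilon> + 2 * L * \<eta>) * norm h)"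
      using insert.hyps by (simp add: algebra_simps)
    finally show ?case unfolding 3 .
  qed (simp add: hS_def)
  from this[of Basis] show ?thesis by (simp add: hS_def euclidean_representation mult.assoc)
qed

text \<open>The candidates \<open>c\<close> may depend on \<open>e\<close>. Two of them, for the
  errors \<open>1 / (j + 1)\<close> and \<open>1 / (k + 1)\<close>, are compared on a vector
  \<open>h\<close> parallel to their difference, where the inner product is the product of the
  norms. So they form a Cauchy sequence, whose limit is the gradient.\<close>

lemma differentiable_at_if_approximable:
  fixes f :: "'a::euclidean_space \<Rightarrow> real"
  assumes "\<And>e. e > 0 \<Longrightarrow> \<exists>c. \<exists>r>0. \<forall>h. norm h < r \<longrightarrow> \<bar>f (x + h) - f x - c \<bullet> h\<bar> \<le> e * norm h"
  shows "f differentiable (at x)"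
proof -
  have "\<forall>k::nat. \<exists>c. \<exists>r>0. \<forall>h. norm h < r \<longrightarrow> \<bar>f (x + h) - f x - c \<bullet> h\<bar> \<le> 1 / (real k + 1) * norm h"
    by (intro allI assms) simp
  then obtain c r where r: "\<And>k::nat. r k > 0" and
    c: "\<And>k h. norm h < r k \<Longrightarrow> \<bar>f (x + h) - f x - c k \<bullet> h\<bar> \<le> 1 / (real k + 1) * norm h"
    by metis
  have close: "norm (c j - c k) \<le> 1 / (real j + 1) + 1 / (real k + 1)" for j k
  proof (cases "c j = c k")
    case False
    \<comment> \<open>Scales \<open>h\<close> to half the smaller radius, so that both
      approximations apply to it.\<close>
    define t where "t = min (r j) (r k) / 2 / norm (c j - c k)"
    have "t > 0" using False r[of j] r[of k] by (simp add: t_def)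
    define h where "h = t *\<^sub>R (c j - c k)"
    have nh: "norm h = min (r j) (r k) / 2" "norm h > 0"
      using False r[of j] r[of k] by (auto simp: h_def t_def)
    then have "norm h < r j" "norm h < r k" using r[of j] r[of k] by auto
    then have "\<bar>(c j - c k) \<bullet> h\<bar> \<le> 1 / (real j + 1) * norm h + 1 / (real k + 1) * norm h"
      using c[of h j] c[of h k] unfolding inner_diff_left by linarith
    also have "\<dots> = (1 / (real j + 1) + 1 / (real k + 1)) * norm h" by (simp add: distrib_right)
    also have "(c j - c k) \<bullet> h = norm (c j - c k) * norm h"
      using \<open>t > 0\<close> by (simp add: h_def power2_norm_eq_inner[symmetric] power2_eq_square)
    finally have "norm (c j - c k) * norm h \<le> (1 / (real j + 1) + 1 / (real k + 1)) * norm h"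
      by (rule order_trans[OF abs_ge_self])
    then show ?thesis using nh(2) by (rule mult_right_le_imp_le)
  qed auto
  have "Cauchy c"
  proof (rule metric_CauchyI)
    fix e :: real assume "e > 0"
    obtain M :: nat where M: "1 / (real M + 1) < e / 2"
      using reals_Archimedean[of "e / 2"] \<open>e > 0\<close> by (auto simp: inverse_eq_divide add.commute)
    have "dist (c m) (c n) < e" if "m \<ge> M" "n \<ge> M" for m n
    proof -
      have "1 / (real m + 1) \<le> 1 / (real M + 1)" "1 / (real n + 1) \<le> 1 / (real M + 1)"
        using that by (auto intro!: divide_left_mono)
      then show ?thesis using close[of m n] M by (simp add: dist_norm)
    qed
    then show "\<exists>M. \<forall>m\<ge>M. \<forall>n\<ge>M. dist (c m) (c n) < e" by blast
  qed
  then obtain g where g: "c \<longlonglongrightarrow> g"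
    using Cauchy_convergent_iff convergent_def by blast
  have cg: "norm (c j - g) \<le> 1 / (real j + 1)" for j
  proof (rule LIMSEQ_le)
    show "(\<lambda>k. norm (c j - c k)) \<longlonglongrightarrow> norm (c j - g)"
      by (intro tendsto_intros g)
    show "(\<lambda>k. 1 / (real j + 1) + 1 / (real k + 1)) \<longlonglongrightarrow> 1 / (real j + 1)"
      using tendsto_add[OF tendsto_const LIMSEQ_inverse_real_of_nat, of "1 / (real j + 1)"]
      by (simp add: inverse_eq_divide add.commute)
  qed (use close in auto)
  have "(f has_derivative (\<lambda>h. g \<bullet> h)) (at x)"
    unfolding has_derivative_at_alt
  proof (intro conjI allI impI)
    show "bounded_linear ((\<bullet>) g)" by (rule bounded_linear_inner_right)
    fix e :: real assume "e > 0"
    obtain k :: nat where k: "1 / (real k + 1) < e / 2"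
      using reals_Archimedean[of "e / 2"] \<open>e > 0\<close> by (auto simp: inverse_eq_divide add.commute)
    have "norm (f y - f x - g \<bullet> (y - x)) \<le> e * norm (y - x)" if "norm (y - x) < r k" for y
    proof -
      have "\<bar>(c k - g) \<bullet> (y - x)\<bar> \<le> 1 / (real k + 1) * norm (y - x)"
        by (rule order_trans[OF Cauchy_Schwarz_ineq2 mult_right_mono[OF cg]]) simp
      then have "\<bar>f y - f x - g \<bullet> (y - x)\<bar> \<le> 2 * (1 / (real k + 1) * norm (y - x))"
        using c[of "y - x" k] that by (simp add: inner_diff_left)
      also have "\<dots> = 2 * (1 / (real k + 1)) * norm (y - x)" by simp
      also have "\<dots> \<le> e * norm (y - x)"
        using k by (intro mult_right_mono) auto
      finally show ?thesis by simp
    qed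
    then show "\<exists>d>0. \<forall>y. norm (y - x) < d \<longrightarrow> norm (f y - f x - g \<bullet> (y - x)) \<le> e * norm (y - x)"
      using r by blast
  qed
  then show ?thesis by (auto simp: differentiable_def)
qed


text \<open>The approximate gradient is taken from a countable dense set, so that countably many
  closed sets account for all points. One \<open>1 / (k + 1)\<close> of the error is the oscillation
  of the quotients, the other the distance to \<open>D\<close>.\<close>

lemma ex_coordinatewise_approximation:
  fixes f :: "'a::euclidean_space \<Rightarrow> real"
  assumes x: "\<And>b. b \<in> Basis \<Longrightarrow> x \<in> line_quotient_cauchy f b"
    and D: "\<And>X. open X \<Longrightarrow> X \<noteq> {} \<Longrightarrow> \<exists>d\<in>D. d \<in> X"
  shows "\<exists>c\<in>D. \<exists>m::nat. \<forall>b\<in>Basis. \<forall>s. \<bar>s\<bar> < 1 / (real m + 1) \<longrightarrow>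
    \<bar>f (x + s *\<^sub>R b) - f x - s * (c \<bullet> b)\<bar> \<le> 2 / (real k + 1) * \<bar>s\<bar>"
proof -
  define q where "q s b = (f (x + s *\<^sub>R b) - f x) / s" for s b
  have "\<exists>m::nat. \<forall>s t. s \<noteq> 0 \<longrightarrow> t \<noteq> 0 \<longrightarrow> \<bar>s\<bar> < 1 / (real m + 1) \<longrightarrow> \<bar>t\<bar> < 1 / (real m + 1) \<longrightarrow>
      \<bar>q s b - q t b\<bar> \<le> 1 / (real k + 1)" if "b \<in> Basis" for b
    using x[OF that] unfolding line_quotient_cauchy_def q_def INT_iff UN_iff mem_Collect_eq by blast
  then obtain m :: "'a \<Rightarrow> nat" where m: "\<And>b s t. b \<in> Basis \<Longrightarrow> s \<noteq> 0 \<Longrightarrow> t \<noteq> 0 \<Longrightarrow>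
      \<bar>s\<bar> < 1 / (real (m b) + 1) \<Longrightarrow> \<bar>t\<bar> < 1 / (real (m b) + 1) \<Longrightarrow> \<bar>q s b - q t b\<bar> \<le> 1 / (real k + 1)"
    by metis
  define M where "M = Max (m ` Basis)"
  have M: "1 / (real M + 1) \<le> 1 / (real (m b) + 1)" if "b \<in> Basis" for b
    using that by (intro divide_left_mono) (auto simp: M_def)
  \<comment> \<open>One admissible step width; its quotients stand in for the partial
    derivatives.\<close>
  define t where "t = 1 / (real M + 2)"
  have t: "t \<noteq> 0" "\<bar>t\<bar> < 1 / (real M + 1)"
    by (auto simp: t_def intro!: divide_strict_left_mono)
  define c0 where "c0 = (\<Sum>b\<in>Basis. q t b *\<^sub>R b)"
  have "\<exists>c\<in>D. c \<in> ball c0 (1 / (real k + 1))"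
    by (rule D) auto
  then obtain c where c: "c \<in> D" "dist c0 c < 1 / (real k + 1)" by auto
  have "\<bar>f (x + s *\<^sub>R b) - f x - s * (c \<bullet> b)\<bar> \<le> 2 / (real k + 1) * \<bar>s\<bar>"
    if b: "b \<in> Basis" and s: "\<bar>s\<bar> < 1 / (real M + 1)" for b s
  proof (cases "s = 0")
    case False
    have "\<bar>q s b - q t b\<bar> \<le> 1 / (real k + 1)"
      using M[OF b] s t False by (intro m b) auto
    moreover have "\<bar>q t b - c \<bullet> b\<bar> \<le> 1 / (real k + 1)"
    proof -
      have "q t b - c \<bullet> b = (c0 - c) \<bullet> b"
        using b by (simp add: c0_def inner_diff_left)
      then show ?thesis
        using Basis_le_norm[OF b, of "c0 - c"] c(2) by (simp add: dist_norm)
    qed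
    ultimately have "\<bar>q s b - c \<bullet> b\<bar> \<le> 2 / (real k + 1)" by simp
    then have "\<bar>q s b - c \<bullet> b\<bar> * \<bar>s\<bar> \<le> 2 / (real k + 1) * \<bar>s\<bar>"
      by (rule mult_right_mono) simp
    moreover have "\<bar>q s b - c \<bullet> b\<bar> * \<bar>s\<bar> = \<bar>f (x + s *\<^sub>R b) - f x - s * (c \<bullet> b)\<bar>"
    proof -
      have "q s b * s = f (x + s *\<^sub>R b) - f x" using False by (simp add: q_def)
      then have "(q s b - c \<bullet> b) * s = f (x + s *\<^sub>R b) - f x - s * (c \<bullet> b)"
        by (simp add: left_diff_distrib mult.commute[of s "c \<bullet> b"])
      then show ?thesis by (metis abs_mult)
    qed
    ultimately show ?thesis by simp
  qed simp
  then show ?thesis using c(1) by blast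
qed

theorem rademacher:
  fixes f :: "'a::euclidean_space \<Rightarrow> real"
  assumes lip: "L-lipschitz_on UNIV f"
  shows "negligible {x. \<not> f differentiable (at x)}"
proof -
  have "0 \<le> L" using lip by (rule lipschitz_on_nonneg)
  have [continuous_intros]: "continuous_on S (\<lambda>x. f (g x))" if "continuous_on S g" for S :: "'a set" and g
    using continuous_on_compose2[OF lipschitz_on_continuous_on[OF lip] that] by simp
  obtain D :: "'a set" where D: "countable D" "\<And>X. open X \<Longrightarrow> X \<noteq> {} \<Longrightarrow> \<exists>d\<in>D. d \<in> X"
    using countable_dense_exists by metis
  define A where "A c k m = (\<Inter>b\<in>Basis. \<Inter>s\<in>{s. \<bar>s\<bar> < 1 / (real m + 1)}.
     {x. \<bar>f (x + s *\<^sub>R b) - f x - s * (c \<bullet> b)\<bar> \<le> 2 / (real k + 1) * \<bar>s\<bar>})" for c and k m :: nat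
  have "closed (A c k m)" for c k m
    unfolding A_def by (intro closed_INT ballI closed_Collect_le continuous_intros)
  then have Aleb: "A c k m \<in> sets lebesgue" for c k m
    by (simp add: borel_closed)
  \<comment> \<open>Points of \<open>A c k m\<close> at which its complement keeps the proportion
    \<open>1 / (j + 1)\<close> of arbitrarily small balls. Discarding them for all \<open>j\<close>
    leaves the density points.\<close>
  define Z where "Z c k m j = {x \<in> A c k m. \<forall>e>0. \<exists>s. 0 < s \<and> s < e \<and>
     1 / (real j + 1) * measure lebesgue (ball x s) \<le> measure lebesgue (ball x s - A c k m)}"
    for c and k m j :: nat
  have Z: "negligible (Z c k m j)" for c k m j
    by (rule negligible_if_not_density_points[OF Aleb, of "1 / (real j + 1)"]) (auto simp: Z_def)
  define N where "N = (\<Union>c\<in>D. \<Union>k. \<Union>m. \<Union>j. Z c k m j)"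
  have "negligible N"
    unfolding N_def using D(1) by (intro negligible_countable_Union countable_image)
      (auto intro!: negligible_countable_Union Z)
  define N' where "N' = (\<Union>b\<in>Basis. - line_quotient_cauchy f b)"
  have "negligible N'"
    unfolding N'_def by (intro negligible_Union finite_imageI)
      (auto intro: negligible_not_line_quotient_cauchy[OF lip])
  have "f differentiable (at x)" if x: "x \<notin> N" "x \<notin> N'" for x
  proof (rule differentiable_at_if_approximable)
    fix e :: real assume "e > 0"
    define n where "n = real DIM('a)"
    have "n > 0" by (simp add: n_def)
    \<comment> \<open>Makes \<open>n * (2 * L * \<eta>)\<close> at most \<open>e / 2\<close>; the
      \<open>+ 1\<close> covers \<open>L = 0\<close>, and \<open>\<eta> \<le> 1\<close> keeps the
      ball of radius \<open>\<eta> * norm h\<close> about \<open>p\<close> inside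
      \<open>ball x (2 * norm h)\<close>.\<close>
    define \<eta> where "\<eta> = min 1 (e / 2 / (n * (2 * L + 1)))"
    have \<eta>: "0 < \<eta>" "\<eta> \<le> 1" using \<open>e > 0\<close> \<open>0 \<le> L\<close> \<open>n > 0\<close> by (auto simp: \<eta>_def)
    have "\<eta> * (n * (2 * L + 1)) \<le> e / 2"
      using \<open>n > 0\<close> \<open>0 \<le> L\<close> \<open>e > 0\<close>
      by (subst pos_le_divide_eq[symmetric]) (auto simp: \<eta>_def)
    then have \<eta>L: "n * (2 * L * \<eta>) \<le> e / 2"
      using \<eta> \<open>n > 0\<close> by (simp add: algebra_simps) (smt (verit) mult_pos_pos)
    obtain k :: nat where "1 / (real k + 1) < e / 4 / n"
      using reals_Archimedean[of "e / 4 / n"] \<open>e > 0\<close> \<open>n > 0\<close>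
      by (auto simp: inverse_eq_divide add.commute)
    then have k: "n * (2 / (real k + 1)) \<le> e / 2"
      using \<open>n > 0\<close> by (simp add: field_simps)
    obtain c m where c: "c \<in> D" "x \<in> A c k m"
      using ex_coordinatewise_approximation[of x f D k] x(2) D(2)
      unfolding A_def N'_def by fastforce
    have "(\<eta> / 2) ^ DIM('a) > 0" using \<eta> by simp
    \<comment> \<open>The power is the volume ratio of balls of radii \<open>\<eta> * norm h\<close>
      and \<open>2 * norm h\<close>. A ball about \<open>p\<close> that missed
      \<open>A c k m\<close> would leave too large a part of \<open>ball x (2 * norm h)\<close>
      uncovered.\<close>
    from reals_Archimedean[OF this] obtain j :: nat
      where j: "1 / (real j + 1) \<le> (\<eta> / 2) ^ DIM('a)"
      by (auto simp: inverse_eq_divide add.commute intro: less_imp_le)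
    have "x \<notin> Z c k m j" using x(1) c(1) by (auto simp: N_def)
    then obtain r where r: "r > 0" "\<And>s. 0 < s \<Longrightarrow> s < r \<Longrightarrow>
       measure lebesgue (ball x s - A c k m) < 1 / (real j + 1) * measure lebesgue (ball x s)"
      using c(2) unfolding Z_def by (auto simp: not_le)
    define \<rho> where "\<rho> = min (r / 2) (1 / (real m + 1))"
    have "\<bar>f (x + h) - f x - c \<bullet> h\<bar> \<le> e * norm h" if h: "norm h < \<rho>" for h
    proof (cases "h = 0")
      case False
      have "\<bar>f (x + h) - f x - c \<bullet> h\<bar> \<le> DIM('a) * (2 / (real k + 1) + 2 * L * \<eta>) * norm h"
      proof (rule increment_along_coordinates[OF lip])
        show "norm h < 1 / (real m + 1)" using h by (simp add: \<rho>_def)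
        show "\<bar>f (y + s *\<^sub>R b) - f y - s * (c \<bullet> b)\<bar> \<le> 2 / (real k + 1) * \<bar>s\<bar>"
          if "y \<in> A c k m" "b \<in> Basis" "\<bar>s\<bar> < 1 / (real m + 1)" for y b s
          using that by (auto simp: A_def)
        fix p assume p: "norm (p - x) \<le> norm h"
        show "\<exists>y\<in>A c k m. dist p y \<le> \<eta> * norm h"
        proof (rule ccontr)
          assume "\<not> ?thesis"
          then have "ball p (\<eta> * norm h) \<inter> A c k m = {}" by (auto simp: not_le)
          moreover have "ball p (\<eta> * norm h) \<subseteq> ball x (2 * norm h)"
          proof
            fix z assume "z \<in> ball p (\<eta> * norm h)"
            moreover have "\<eta> * norm h \<le> 1 * norm h"
              using \<eta>(2) by (rule mult_right_mono) simp
            ultimately have "dist p z < norm h" by simp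
            then show "z \<in> ball x (2 * norm h)"
              using p dist_triangle[of x z p] by (simp add: dist_norm norm_minus_commute)
          qed
          ultimately have "measure lebesgue (ball p (\<eta> * norm h)) \<le> measure lebesgue (ball x (2 * norm h) - A c k m)"
            using Aleb by (intro measure_mono_fmeasurable fmeasurable_Diff) auto
          also have "\<dots> < 1 / (real j + 1) * measure lebesgue (ball x (2 * norm h))"
            using h False by (intro r) (auto simp: \<rho>_def)
          also have "\<dots> \<le> (\<eta> / 2) ^ DIM('a) * measure lebesgue (ball x (2 * norm h))"
            using j by (intro mult_right_mono) auto
          also have "\<dots> = measure lebesgue (ball p (\<eta> * norm h))"
            using \<eta> by (simp add: content_ball power_mult_distrib power_divide)
          finally show False by simp
        qed
      qed auto
      also have "DIM('a) * (2 / (real k + 1) + 2 * L * \<eta>) = n * (2 / (real k + 1)) + n * (2 * L * \<eta>)"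
        by (simp add: n_def distrib_left)
      also have "\<dots> * norm h \<le> e * norm h"
        using k \<eta>L by (intro mult_right_mono) auto
      finally show ?thesis .
    qed simp
    moreover have "\<rho> > 0" using r(1) by (simp add: \<rho>_def)
    ultimately show "\<exists>c. \<exists>r>0. \<forall>h. norm h < r \<longrightarrow> \<bar>f (x + h) - f x - c \<bullet> h\<bar> \<le> e * norm h"
      by blast
  qed
  then have "{x. \<not> f differentiable (at x)} \<subseteq> N \<union> N'" by auto
  then show ?thesis
    using \<open>negligible N\<close> \<open>negligible N'\<close> by (meson negligible_Un negligible_subset)
qed

section \<open>Hausdorff measure of Lipschitz graphs\<close>

text \<open>The gauge \<open>g\<close> forces every box of the dyadic subdivision to be small and to
  lie in \<open>G\<close>; equal sides of the initial box make all boxes cubes. Their interiors are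
  disjoint subsets of \<open>G\<close>, which bounds the sum of the volumes.\<close>

lemma fine_cube_cover:
  fixes S G :: "'a::euclidean_space set"
  assumes "bounded S" "open G" "S \<subseteq> G" "\<delta> > 0"
  shows "\<exists>(I :: nat set) s u. (\<forall>i\<in>I. 0 < s i) \<and> S \<subseteq> (\<Union>i\<in>I. cbox (u i) (u i + s i *\<^sub>R One)) \<and>
    (\<forall>i\<in>I. \<forall>x\<in>cbox (u i) (u i + s i *\<^sub>R One). \<forall>y\<in>cbox (u i) (u i + s i *\<^sub>R One). dist x y \<le> \<delta>) \<and>
    (\<Sum>i. if i \<in> I then ennreal (s i ^ DIM('a)) else 0) \<le> emeasure lborel G"
proof -
  obtain R where R: "R > 0" "\<And>x. x \<in> S \<Longrightarrow> norm x \<le> R"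
    using \<open>bounded S\<close> by (auto simp: bounded_pos)
  define a :: 'a where "a = - R *\<^sub>R One"
  define b :: 'a where "b = R *\<^sub>R One"
  have "S \<subseteq> cbox a b"
  proof
    fix x assume "x \<in> S"
    have "\<bar>x \<bullet> i\<bar> \<le> R" if "i \<in> Basis" for i
      using R(2)[OF \<open>x \<in> S\<close>] Basis_le_norm[OF that, of x] by simp
    then show "x \<in> cbox a b"
      by (auto simp: mem_box a_def b_def abs_le_iff minus_le_iff)
  qed
  moreover have "box a b \<noteq> {}"
    using R(1) by (simp add: box_ne_empty a_def b_def)
  moreover define g where "g x = ball x (\<delta> / 2) \<inter> (if x \<in> G then G else UNIV)" for x
  moreover have "gauge g"
    using \<open>open G\<close> \<open>\<delta> > 0\<close> by (auto simp: gauge_def g_def)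
  ultimately obtain D where D: "countable D"
    "\<And>K. K \<in> D \<Longrightarrow> interior K \<noteq> {} \<and> (\<exists>c d. K = cbox c d)"
    "pairwise (\<lambda>A B. interior A \<inter> interior B = {}) D"
    "\<And>K. K \<in> D \<Longrightarrow> \<exists>x \<in> S \<inter> K. K \<subseteq> g x"
    "\<And>u v. cbox u v \<in> D \<Longrightarrow> \<exists>n. \<forall>i \<in> Basis. v \<bullet> i - u \<bullet> i = (b \<bullet> i - a \<bullet> i) / 2^n"
    "S \<subseteq> \<Union>D"
    using covering_lemma[of S a b g] by metis
  have "\<exists>u s. 0 < s \<and> K = cbox u (u + s *\<^sub>R One)" if K: "K \<in> D" for K
  proof -
    obtain u v where uv: "K = cbox u v" using D(2)[OF K] by auto
    obtain n where n: "\<And>i. i \<in> Basis \<Longrightarrow> v \<bullet> i - u \<bullet> i = (b \<bullet> i - a \<bullet> i) / 2^n"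
      using D(5)[of u v] K uv by auto
    define s where "s = 2 * R / 2 ^ n"
    have "v = u + s *\<^sub>R One"
    proof (rule euclidean_eqI)
      fix i :: 'a assume "i \<in> Basis"
      then show "v \<bullet> i = (u + s *\<^sub>R One) \<bullet> i"
        using n[of i] by (simp add: inner_add_left s_def a_def b_def algebra_simps)
    qed
    then show ?thesis using uv R(1) by (intro exI[of _ u] exI[of _ s]) (simp add: s_def)
  qed
  then obtain u s where us: "\<And>K. K \<in> D \<Longrightarrow> 0 < s K" "\<And>K. K \<in> D \<Longrightarrow> K = cbox (u K) (u K + s K *\<^sub>R One)"
    by metis
  \<comment> \<open>\<open>D\<close> is only known to be countable; with the index set
    \<open>I\<close>, series over all natural numbers serve a finite \<open>D\<close> as
    well.\<close>
  define I where "I = to_nat_on D ` D"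
  define \<kappa> where "\<kappa> = from_nat_into D"
  have I: "\<kappa> i \<in> D" "to_nat_on D (\<kappa> i) = i" if "i \<in> I" for i
    using that D(1) by (auto simp: I_def \<kappa>_def)
  have \<kappa>: "\<exists>i\<in>I. \<kappa> i = K" if "K \<in> D" for K
    using that D(1) by (auto simp: I_def \<kappa>_def)
  define Q where "Q i = (if i \<in> I then box (u (\<kappa> i)) (u (\<kappa> i) + s (\<kappa> i) *\<^sub>R One) else {})" for i
  show ?thesis
  proof (intro exI[of _ I] exI[of _ "s \<circ> \<kappa>"] exI[of _ "u \<circ> \<kappa>"] conjI ballI)
    show "S \<subseteq> (\<Union>i\<in>I. cbox ((u \<circ> \<kappa>) i) ((u \<circ> \<kappa>) i + (s \<circ> \<kappa>) i *\<^sub>R One))"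
    proof
      fix x assume "x \<in> S"
      then obtain K where K: "K \<in> D" "x \<in> K" using D(6) by auto
      then obtain i where "i \<in> I" "\<kappa> i = K" using \<kappa> by auto
      then show "x \<in> (\<Union>i\<in>I. cbox ((u \<circ> \<kappa>) i) ((u \<circ> \<kappa>) i + (s \<circ> \<kappa>) i *\<^sub>R One))"
        using K us(2)[of K] by (intro UN_I[of i]) auto
    qed
    show "dist x y \<le> \<delta>" if i: "i \<in> I" and xy: "x \<in> cbox ((u \<circ> \<kappa>) i) ((u \<circ> \<kappa>) i + (s \<circ> \<kappa>) i *\<^sub>R One)"
      "y \<in> cbox ((u \<circ> \<kappa>) i) ((u \<circ> \<kappa>) i + (s \<circ> \<kappa>) i *\<^sub>R One)" for i x y
    proof -
      have "x \<in> \<kappa> i" "y \<in> \<kappa> i" using xy us(2)[OF I(1)[OF i]] by auto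
      moreover obtain z where "\<kappa> i \<subseteq> ball z (\<delta> / 2)"
        using D(4)[OF I(1)[OF i]] by (auto simp: g_def)
      ultimately have "x \<in> ball z (\<delta> / 2)" "y \<in> ball z (\<delta> / 2)" by auto
      then show ?thesis using dist_triangle3[of x y z] by simp
    qed
    have "disjoint_family Q"
      unfolding disjoint_family_on_def
    proof (intro ballI impI)
      fix i j :: nat assume "i \<noteq> j"
      show "Q i \<inter> Q j = {}"
      proof (cases "i \<in> I \<and> j \<in> I")
        case True
        then have "\<kappa> i \<noteq> \<kappa> j" using I \<open>i \<noteq> j\<close> by metis
        then have "interior (\<kappa> i) \<inter> interior (\<kappa> j) = {}"
          using D(3) I True by (auto simp: pairwise_def)
        then show ?thesis
          using True us(2) I by (metis Q_def interior_cbox)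
      qed (auto simp: Q_def)
    qed
    have "(\<Sum>i. if i \<in> I then ennreal ((s \<circ> \<kappa>) i ^ DIM('a)) else 0) = (\<Sum>i. emeasure lborel (Q i))"
    proof (intro suminf_cong)
      fix i
      have "emeasure lborel (box (u (\<kappa> i)) (u (\<kappa> i) + s (\<kappa> i) *\<^sub>R One)) = ennreal (s (\<kappa> i) ^ DIM('a))" if "i \<in> I"
        using us(1)[OF I(1)[OF that]] by (subst emeasure_lborel_box) (auto simp: inner_add_left)
      then show "(if i \<in> I then ennreal ((s \<circ> \<kappa>) i ^ DIM('a)) else 0) = emeasure lborel (Q i)"
        by (simp add: Q_def)
    qed
    also have "\<dots> = emeasure lborel (\<Union>i. Q i)"
    proof (rule suminf_emeasure)
      show "range Q \<subseteq> sets lborel" by (auto simp: Q_def)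
    qed fact
    also have "\<dots> \<le> emeasure lborel G"
    proof (rule emeasure_mono)
      have "Q i \<subseteq> G" for i
      proof (cases "i \<in> I")
        case True
        have "Q i \<subseteq> \<kappa> i" using us(2)[OF I(1)[OF True]] box_subset_cbox True by (auto simp: Q_def)
        moreover obtain x where "x \<in> S" "\<kappa> i \<subseteq> g x" using D(4)[OF I(1)[OF True]] by auto
        ultimately show ?thesis using \<open>S \<subseteq> G\<close> by (auto simp: g_def split: if_splits)
      qed (simp add: Q_def)
      then show "(\<Union>i. Q i) \<subseteq> G" by blast
    qed (use \<open>open G\<close> in simp)
    finally show "(\<Sum>i. if i \<in> I then ennreal ((s \<circ> \<kappa>) i ^ DIM('a)) else 0) \<le> emeasure lborel G" .
  qed (use us(1) I in auto)
qed

lemma ex_small_value_if_integral_le: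
  fixes h :: "real \<Rightarrow> ennreal"
  assumes [measurable]: "h \<in> borel_measurable borel"
    and "(\<integral>\<^sup>+t. h t * indicator {0..1} t \<partial>lborel) \<le> M" "M < M'"
  shows "\<exists>t\<in>{0..1}. h t \<le> M'"
proof (rule ccontr)
  assume "\<not> ?thesis"
  then have "M' \<le> h t" if "t \<in> {0..1}" for t using that by (auto simp: not_le less_imp_le)
  then have "(\<integral>\<^sup>+t. M' * indicator {0..1::real} t \<partial>lborel) \<le> (\<integral>\<^sup>+t. h t * indicator {0..1} t \<partial>lborel)"
    by (intro nn_integral_mono) (auto simp: indicator_def)
  then show False using assms by (simp add: nn_integral_cmult_indicator)
qed

text \<open>
  Cover the solid cylinder over \<open>S\<close> by small cubes. On average over the height \<open>t\<close>, the cubes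
  meeting the copy of \<open>S\<close> at height \<open>t\<close> form an efficient covering of that copy.
\<close>

lemma hausdorff_outer_graph_le:
  fixes S G :: "'a::euclidean_space set"
  assumes e: "norm e = 1" and lip: "C-lipschitz_on UNIV f"
    and "bounded S" and S: "\<And>y. y \<in> S \<Longrightarrow> e \<bullet> y = f y"
    and inv: "\<And>y t. f (y + t *\<^sub>R e) = f y"
    and "open G" and G: "\<And>y t. y \<in> S \<Longrightarrow> t \<in> {0..1} \<Longrightarrow> y + t *\<^sub>R e \<in> G"
  shows "hausdorff_outer (DIM('a) - 1) S
    \<le> ennreal (unit_ball_vol (real (DIM('a) - 1)) * (real DIM('a) / 2) ^ (DIM('a) - 1) * (2 * (1 + C) * DIM('a)))
        * emeasure lborel G"
    (is "_ \<le> ennreal ?c * _")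
proof (cases "emeasure lborel G = top")
  case False
  define k where "k = DIM('a) - 1"
  define n where "n = real DIM('a)"
  have DIM: "DIM('a) = Suc k" by (simp add: k_def)
  have "n > 0" by (simp add: n_def)
  define K0 where "K0 = unit_ball_vol (real k) * (n / 2) ^ k"
  have "K0 > 0" using \<open>n > 0\<close> by (simp add: K0_def)
  have "0 \<le> C" using lip by (rule lipschitz_on_nonneg)
  define M where "M = ennreal ?c * emeasure lborel G"
  have c: "?c = K0 * (2 * (1 + C) * n)" by (simp add: K0_def k_def n_def)
  have "M < top" using False by (simp add: M_def ennreal_mult_less_top less_top)
  have "hausdorff_premeasure k \<delta> S \<le> M" if "\<delta> > 0" for \<delta>
  proof (rule dense_ge)
    \<comment> \<open>An average bounded by \<open>M\<close> yields a height whose value is at most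
      a prescribed \<open>M' > M\<close>.\<close>
    fix M' assume "M < M'"
    define Cyl where "Cyl = (\<lambda>(y, t). y + t *\<^sub>R e) ` (S \<times> {0..1})"
    have "bounded Cyl"
    proof -
      have "Cyl \<subseteq> (\<Union>x\<in>S. \<Union>y\<in>(\<lambda>t. t *\<^sub>R e) ` {0..1}. {x + y})" by (auto simp: Cyl_def)
      moreover have "bounded ((\<lambda>t. t *\<^sub>R e) ` {0..1::real})"
        by (intro compact_imp_bounded compact_continuous_image continuous_intros compact_Icc)
      ultimately show ?thesis using bounded_subset[OF bounded_sums[OF \<open>bounded S\<close>]] by simp
    qed
    have "Cyl \<subseteq> G" using G by (auto simp: Cyl_def)
    have "\<exists>(I :: nat set) s u. (\<forall>i\<in>I. 0 < s i) \<and> Cyl \<subseteq> (\<Union>i\<in>I. cbox (u i) (u i + s i *\<^sub>R One)) \<and>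
      (\<forall>i\<in>I. \<forall>x\<in>cbox (u i) (u i + s i *\<^sub>R One). \<forall>y\<in>cbox (u i) (u i + s i *\<^sub>R One). dist x y \<le> \<delta>) \<and>
      (\<Sum>i. if i \<in> I then ennreal (s i ^ DIM('a)) else 0) \<le> emeasure lborel G"
      by (rule fine_cube_cover) fact+
    then obtain I :: "nat set" and s u where I':
      "(\<forall>i\<in>I. 0 < s i) \<and> Cyl \<subseteq> (\<Union>i\<in>I. cbox (u i) (u i + s i *\<^sub>R One)) \<and>
      (\<forall>i\<in>I. \<forall>x\<in>cbox (u i) (u i + s i *\<^sub>R One). \<forall>y\<in>cbox (u i) (u i + s i *\<^sub>R One). dist x y \<le> \<delta>) \<and>
      (\<Sum>i. if i \<in> I then ennreal (s i ^ DIM('a)) else 0) \<le> emeasure lborel G"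
      by blast
    then have I: "\<And>i. i \<in> I \<Longrightarrow> 0 < s i" "Cyl \<subseteq> (\<Union>i\<in>I. cbox (u i) (u i + s i *\<^sub>R One))"
      "\<And>i x y. i \<in> I \<Longrightarrow> x \<in> cbox (u i) (u i + s i *\<^sub>R One) \<Longrightarrow> y \<in> cbox (u i) (u i + s i *\<^sub>R One) \<Longrightarrow> dist x y \<le> \<delta>"
      "(\<Sum>i. if i \<in> I then ennreal (s i ^ DIM('a)) else 0) \<le> emeasure lborel G"
      by blast+
    define Q where "Q i = cbox (u i) (u i + s i *\<^sub>R One)" for i
    have dist_u: "dist x y \<le> n * s i" if "x \<in> Q i" "y \<in> Q i" for x y i
    proof -
      have "\<bar>(x - y) \<bullet> b\<bar> \<le> s i" if "b \<in> Basis" for b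
        using \<open>x \<in> Q i\<close> \<open>y \<in> Q i\<close> that
        by (fastforce simp: Q_def mem_box inner_add_left inner_diff_left abs_le_iff)
      then have "(\<Sum>b\<in>Basis. \<bar>(x - y) \<bullet> b\<bar>) \<le> n * s i"
        unfolding n_def by (rule sum_bounded_above)
      then show ?thesis using norm_le_l1[of "x - y"] by (simp add: dist_norm)
    qed
    \<comment> \<open>Height above the graph; it equals \<open>t\<close> at
      \<open>y + t *\<^sub>R e\<close> for \<open>y\<close> in \<open>S\<close>. It is Lipschitz
      with constant \<open>1 + C\<close>, and a cube of side \<open>s i\<close> has diameter at most
      \<open>n * s i\<close>, so \<open>h\<close> maps the cube into \<open>T i\<close>. The length
      of \<open>T i\<close> is the origin of the factor \<open>2 * (1 + C) * n\<close>.\<close>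
    define h where "h q = e \<bullet> q - f q" for q
    define T where "T i = {h (u i) - (1 + C) * n * s i .. h (u i) + (1 + C) * n * s i}" for i
    have hT: "h q \<in> T i" if "q \<in> Q i" "i \<in> I" for q i
    proof -
      have "u i \<in> Q i" using I(1)[OF that(2)] by (simp add: Q_def mem_box inner_add_left)
      then have d: "dist q (u i) \<le> n * s i" using dist_u that by blast
      have "\<bar>h q - h (u i)\<bar> \<le> \<bar>e \<bullet> (q - u i)\<bar> + \<bar>f q - f (u i)\<bar>"
        by (simp add: h_def inner_diff_right)
      also have "\<dots> \<le> dist q (u i) + C * dist q (u i)"
        using Cauchy_Schwarz_ineq2[of e "q - u i"] lipschitz_onD[OF lip, of q "u i"] e
        by (simp add: dist_norm)
      also have "\<dots> = (1 + C) * dist q (u i)" by (simp add: algebra_simps)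
      also have "\<dots> \<le> (1 + C) * (n * s i)" using d \<open>0 \<le> C\<close> by (intro mult_left_mono) auto
      finally show ?thesis by (auto simp: T_def algebra_simps abs_le_iff)
    qed
    \<comment> \<open>Bounds the gauge of a cube of side \<open>s i\<close> by way of the diameter
      \<open>n * s i\<close>. Integration over \<open>T i\<close> contributes one more factor
      \<open>s i\<close>, so that a multiple of the volume of the cube results.\<close>
    define w where "w i = (if i \<in> I then ennreal (K0 * s i ^ k) else 0)" for i
    define H where "H t = (\<Sum>i. w i * indicator (T i) t)" for t
    have [measurable]: "H \<in> borel_measurable borel" unfolding H_def T_def by measurable
    have "(\<integral>\<^sup>+t. H t * indicator {0..1} t \<partial>lborel) \<le> (\<integral>\<^sup>+t. H t \<partial>lborel)"
      by (intro nn_integral_mono) (auto simp: indicator_def)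
    also have "\<dots> = (\<Sum>i. \<integral>\<^sup>+t. w i * indicator (T i) t \<partial>lborel)"
      unfolding H_def by (rule nn_integral_suminf) (simp add: T_def)
    also have "\<dots> = (\<Sum>i. ennreal ?c * (if i \<in> I then ennreal (s i ^ DIM('a)) else 0))"
    proof (intro suminf_cong)
      fix i
      show "(\<integral>\<^sup>+t. w i * indicator (T i) t \<partial>lborel) = ennreal ?c * (if i \<in> I then ennreal (s i ^ DIM('a)) else 0)"
      proof (cases "i \<in> I")
        case True
        then have "s i > 0" by (rule I(1))
        have "(\<integral>\<^sup>+t. w i * indicator (T i) t \<partial>lborel) = w i * emeasure lborel (T i)"
          by (rule nn_integral_cmult_indicator) (simp add: T_def)
        also have "emeasure lborel (T i) = ennreal (2 * ((1 + C) * n * s i))"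
        proof -
          have "0 \<le> (1 + C) * n * s i" using \<open>s i > 0\<close> \<open>0 \<le> C\<close> \<open>n > 0\<close> by simp
          then show ?thesis unfolding T_def by (subst emeasure_lborel_Icc) (linarith, simp add: mult_ac)
        qed
        also have "w i * ennreal (2 * ((1 + C) * n * s i)) = ennreal (K0 * s i ^ k) * ennreal (2 * ((1 + C) * n * s i))"
          using True by (simp add: w_def)
        also have "ennreal (K0 * s i ^ k) * ennreal (2 * ((1 + C) * n * s i)) = ennreal ?c * ennreal (s i ^ DIM('a))"
        proof -
          have "s i ^ DIM('a) = s i * s i ^ k" by (simp add: DIM)
          then have "K0 * s i ^ k * (2 * ((1 + C) * n * s i)) = ?c * s i ^ DIM('a)"
            unfolding c by (simp add: mult_ac)
          moreover have "0 \<le> ?c"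
            unfolding c using \<open>K0 > 0\<close> \<open>0 \<le> C\<close> \<open>n > 0\<close> by simp
          ultimately show ?thesis
            using \<open>K0 > 0\<close> \<open>s i > 0\<close> \<open>0 \<le> C\<close> \<open>n > 0\<close> by (simp flip: ennreal_mult)
        qed
        finally show ?thesis using True by simp
      qed (simp add: w_def)
    qed
    also have "\<dots> \<le> M"
      using I(4) by (simp add: M_def mult_left_mono)
    finally obtain t where t: "t \<in> {0..1}" "H t \<le> M'"
      using ex_small_value_if_integral_le[of H M M'] \<open>M < M'\<close> by auto
    \<comment> \<open>The cubes that can meet the copy of \<open>S\<close> at height
      \<open>t\<close>, moved back down to \<open>S\<close>.\<close>
    define Cov where "Cov i = (if i \<in> I \<and> t \<in> T i then (\<lambda>q. q - t *\<^sub>R e) ` Q i else {})" for i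
    have diam: "diameter (Cov i) \<le> \<delta>" "diameter (Cov i) \<le> n * s i \<or> Cov i = {}" "bounded (Cov i)" for i
    proof -
      show "diameter (Cov i) \<le> \<delta>"
        using I(3)[of i] \<open>\<delta> > 0\<close> by (intro diameter_le) (auto simp: Cov_def dist_norm Q_def split: if_splits)
      show "diameter (Cov i) \<le> n * s i \<or> Cov i = {}"
        using dist_u[of _ i] by (cases "Cov i = {}") (auto intro!: diameter_le simp: Cov_def dist_norm split: if_splits)
      have "bounded ((\<lambda>q. q - t *\<^sub>R e) ` Q i)"
        unfolding Q_def by (intro compact_imp_bounded compact_continuous_image continuous_intros compact_cbox)
      then show "bounded (Cov i)" by (simp add: Cov_def)
    qed
    have "S \<subseteq> (\<Union>i. Cov i)"
    proof
      fix y assume "y \<in> S"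
      then have "y + t *\<^sub>R e \<in> Cyl" using t by (auto simp: Cyl_def)
      then obtain i where i: "i \<in> I" "y + t *\<^sub>R e \<in> Q i" using I(2) by (auto simp: Q_def)
      have "h (y + t *\<^sub>R e) = t"
        using S[OF \<open>y \<in> S\<close>] inv e by (simp add: h_def inner_add_right norm_eq_1)
      then have "t \<in> T i" using hT[OF i(2,1)] by simp
      then have "y \<in> Cov i" using i by (auto simp: Cov_def intro!: image_eqI[of _ _ "y + t *\<^sub>R e"])
      then show "y \<in> (\<Union>i. Cov i)" by blast
    qed
    then have "Cov \<in> hausdorff_covers \<delta> S"
      using diam by (auto simp: hausdorff_covers_def)
    then have "hausdorff_premeasure k \<delta> S \<le> (\<Sum>i. hausdorff_gauge k (Cov i))"
      unfolding hausdorff_premeasure_def by (rule INF_lower)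
    also have "\<dots> \<le> H t"
      unfolding H_def
    proof (intro suminf_le)
      fix i
      show "hausdorff_gauge k (Cov i) \<le> w i * indicator (T i) t"
      proof (cases "Cov i = {}")
        case False
        then have i: "i \<in> I" "t \<in> T i" by (auto simp: Cov_def split: if_splits)
        have "(diameter (Cov i) / 2) ^ k \<le> (n / 2 * s i) ^ k"
          using diam(2)[of i] False diameter_ge_0[OF diam(3)] by (intro power_mono) auto
        then have "unit_ball_vol (real k) * (diameter (Cov i) / 2) ^ k \<le> K0 * s i ^ k"
          unfolding K0_def power_mult_distrib mult.assoc by (rule mult_left_mono) simp
        then show ?thesis using i False by (simp add: hausdorff_gauge_def w_def ennreal_leI)
      qed simp
    qed auto
    finally show "hausdorff_premeasure k \<delta> S \<le> M'" using t(2) by simp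
  qed
  then show ?thesis unfolding hausdorff_outer_def k_def M_def by (intro SUP_least) auto
next
  case True
  \<comment> \<open>\<open>0 * top\<close> is 0 in \<open>ennreal\<close>, so the right-hand side is
    infinite only for a positive constant.\<close>
  have "?c > 0" using lipschitz_on_nonneg[OF lip] by (intro mult_pos_pos zero_less_power) auto
  then have "ennreal ?c \<noteq> 0" by (simp only: ennreal_eq_0_iff not_le)
  then show ?thesis by (simp only: True ennreal_mult_top if_False top_greatest)
qed

lemma hausdorff_outer_graph_finite:
  fixes S :: "'a::euclidean_space set"
  assumes "norm e = 1" "C-lipschitz_on UNIV f" "bounded S" "\<And>y. y \<in> S \<Longrightarrow> e \<bullet> y = f y"
    and "\<And>y t. f (y + t *\<^sub>R e) = f y"
  shows "hausdorff_outer (DIM('a) - 1) S < top"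
proof -
  obtain R where R: "\<And>x. x \<in> S \<Longrightarrow> norm x \<le> R"
    using \<open>bounded S\<close> by (auto simp: bounded_iff)
  have "y + t *\<^sub>R e \<in> ball 0 (R + 2)" if "y \<in> S" "t \<in> {0..1}" for y t
    using R[OF that(1)] that(2) norm_triangle_ineq[of y "t *\<^sub>R e"] assms(1) by auto
  from hausdorff_outer_graph_le[OF assms open_ball this]
  show ?thesis
  proof (rule le_less_trans)
    have "emeasure lborel (ball (0::'a) (R + 2)) < top"
      using emeasure_bounded_finite[OF bounded_ball] by auto
    then show "ennreal c * emeasure lborel (ball (0::'a) (R + 2)) < top" for c
      by (intro ennreal_mult_less_top[THEN iffD2]) auto
  qed
qed

text \<open>\<open>N\<close> contains the full lines over \<open>S\<close>, hence so does every open
  \<open>G\<close> around \<open>N\<close>, and outer regularity makes the measure of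
  \<open>G\<close> at most \<open>\<epsilon> / c\<close>.\<close>

lemma hausdorff_outer_graph_null:
  fixes S N :: "'a::euclidean_space set"
  assumes "norm e = 1" "C-lipschitz_on UNIV f" "bounded S" "\<And>y. y \<in> S \<Longrightarrow> e \<bullet> y = f y"
    and "\<And>y t. f (y + t *\<^sub>R e) = f y"
    and "negligible N" and N: "\<And>y t. y \<in> S \<Longrightarrow> y + t *\<^sub>R e \<in> N"
  shows "hausdorff_outer (DIM('a) - 1) S = 0"
proof -
  define c where "c = unit_ball_vol (real (DIM('a) - 1)) * (real DIM('a) / 2) ^ (DIM('a) - 1) * (2 * (1 + C) * DIM('a))"
  have "c > 0"
    unfolding c_def using lipschitz_on_nonneg[OF assms(2)] by (intro mult_pos_pos zero_less_power) auto
  have "hausdorff_outer (DIM('a) - 1) S \<le> 0 + ennreal \<epsilon>" if "\<epsilon> > 0" for \<epsilon>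
  proof -
    have "N \<in> sets lebesgue" using \<open>negligible N\<close> by (simp add: negligible_imp_sets)
    then obtain G where G: "open G" "N \<subseteq> G" "G - N \<in> lmeasurable" "emeasure lebesgue (G - N) < ennreal (\<epsilon> / c)"
      using sets_lebesgue_outer_open[of N "\<epsilon> / c"] \<open>\<epsilon> > 0\<close> \<open>c > 0\<close> by auto
    have "emeasure lebesgue G = emeasure lebesgue ((G - N) \<union> N)"
      using G(2) by (simp add: Un_absorb2)
    also have "\<dots> = emeasure lebesgue (G - N)"
      using \<open>negligible N\<close> G(3) by (intro emeasure_Un_null_set) (auto simp: negligible_iff_null_sets)
    finally have "emeasure lborel G \<le> ennreal (\<epsilon> / c)"
      using G by simp
    have "hausdorff_outer (DIM('a) - 1) S \<le> ennreal c * emeasure lborel G"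
      unfolding c_def using N G(2) by (intro hausdorff_outer_graph_le[OF assms(1-5) G(1)]) auto
    also have "\<dots> \<le> ennreal c * ennreal (\<epsilon> / c)"
      by (intro mult_left_mono) (fact, simp)
    also have "\<dots> = ennreal \<epsilon>"
      using \<open>c > 0\<close> \<open>\<epsilon> > 0\<close> by (simp flip: ennreal_mult)
    finally show ?thesis by simp
  qed
  then have "hausdorff_outer (DIM('a) - 1) S \<le> 0" by (rule ennreal_le_epsilon)
  then show ?thesis by simp
qed

section \<open>Graph charts and transversal fields\<close>

text \<open>\<open>f\<close> lives on the whole space and ignores the coordinate along
  \<open>e\<close>, in place of a function on a hyperplane; its differential and its exceptional set
  are then objects of the ambient space.\<close>

definition graph_chart :: "'a::euclidean_space set \<Rightarrow> 'a set \<Rightarrow> 'a \<Rightarrow> ('a \<Rightarrow> real) \<Rightarrow> real \<Rightarrow> bool" where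
  "graph_chart U V e f C \<longleftrightarrow> norm e = 1 \<and> C-lipschitz_on UNIV f \<and>
     (\<forall>y t. f (y + t *\<^sub>R e) = f y) \<and> (\<forall>y\<in>V. y \<in> U \<longleftrightarrow> f y < e \<bullet> y)"

text \<open>\<open>e\<close> is the preimage of the vertical axis under the rotation. As
  \<open>R\<close> is an isometry, the Euclidean ball of radius \<open>r\<close> about
  \<open>x\<close> lands in the cube of half side \<open>r\<close>.\<close>

lemma ex_graph_chart:
  fixes U :: "(real ^ 'n) set"
  assumes "lipschitz_boundary U" "x \<in> frontier U"
  shows "\<exists>\<rho>>0. \<exists>e f C. graph_chart U (ball x \<rho>) e f C"
proof -
  obtain r R k \<gamma> C where r: "r > 0" and R: "orthogonal_transformation (R :: real^'n \<Rightarrow> real^'n)"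
    and \<gamma>: "C-lipschitz_on {z. z $ k = 0} \<gamma>"
    and eq: "R ` U \<inter> cube (R x) r
          = {y. y $ k > \<gamma> (\<chi> i. if i = k then 0 else y $ i)} \<inter> cube (R x) r"
    using assms(1)[unfolded lipschitz_boundary_def, rule_format, OF assms(2)] by blast
  define p where "p z = (\<chi> i. if i = k then 0 else z $ i)" for z :: "real^'n"
  define f where "f y = \<gamma> (p (R y))" for y
  obtain e where e: "R e = axis k 1"
    using orthogonal_transformation_surj[OF R] by (metis surj_def)
  have ey: "e \<bullet> y = R y $ k" for y
  proof -
    have "e \<bullet> y = R e \<bullet> R y" using R by (simp add: orthogonal_transformation_def)
    then show ?thesis by (simp add: e inner_axis')
  qed
  have lin: "linear R" using R by (rule orthogonal_transformation_linear)
  have nR: "norm (R z) = norm z" for z using R by (simp add: orthogonal_transformation)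
  have "norm e = 1" using nR[of e] e by simp
  moreover have "C-lipschitz_on UNIV f"
  proof (rule lipschitz_onI)
    fix y z
    have "dist (f y) (f z) \<le> C * dist (p (R y)) (p (R z))"
      unfolding f_def by (rule lipschitz_onD[OF \<gamma>]) (auto simp: p_def)
    also have "dist (p (R y)) (p (R z)) \<le> norm (R y - R z)"
      unfolding dist_norm by (rule norm_le_componentwise_cart) (auto simp: p_def)
    also have "norm (R y - R z) = dist y z"
      using nR[of "y - z"] by (simp add: linear_diff[OF lin] dist_norm)
    finally show "dist (f y) (f z) \<le> C * dist y z"
      using lipschitz_on_nonneg[OF \<gamma>] by (simp add: mult_left_mono)
  qed (rule lipschitz_on_nonneg[OF \<gamma>])
  moreover have "f (y + t *\<^sub>R e) = f y" for y t
  proof -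
    have "p (R (y + t *\<^sub>R e)) = p (R y)"
      by (auto simp: p_def linear_add[OF lin] linear_scale[OF lin] e vec_eq_iff axis_def)
    then show ?thesis by (simp add: f_def)
  qed
  moreover have "y \<in> U \<longleftrightarrow> f y < e \<bullet> y" if "y \<in> ball x r" for y
  proof -
    have "R y \<in> cube (R x) r"
      unfolding cube_def
    proof (clarify)
      fix i
      have "\<bar>R y $ i - R x $ i\<bar> \<le> norm (R y - R x)"
        using component_le_norm_cart[of "R y - R x" i] by simp
      also have "\<dots> = dist x y"
        using nR[of "y - x"] by (simp add: linear_diff[OF lin] dist_norm norm_minus_commute)
      finally show "\<bar>R y $ i - R x $ i\<bar> \<le> r" using that by simp
    qed
    moreover have "y \<in> U \<longleftrightarrow> R y \<in> R ` U"
      using orthogonal_transformation_inj[OF R] by (auto simp: inj_on_def)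
    ultimately show ?thesis
      using eq unfolding ey f_def p_def by blast
  qed
  ultimately show ?thesis using r unfolding graph_chart_def by blast
qed

section \<open>Closure and frontier of the domain in a chart\<close>

lemma closure_le_in_chart:
  assumes "graph_chart U V e f C" "open V" "y \<in> closure U" "y \<in> V"
  shows "f y \<le> e \<bullet> y"
proof (rule ccontr)
  assume "\<not> f y \<le> e \<bullet> y"
  have "continuous_on UNIV f"
    using assms(1) unfolding graph_chart_def by (auto intro: lipschitz_on_continuous_on)
  then have "open ({z. e \<bullet> z < f z} \<inter> V)"
    using \<open>open V\<close> by (intro open_Int open_Collect_less continuous_intros)
  moreover have "y \<in> {z. e \<bullet> z < f z} \<inter> V" using assms \<open>\<not> f y \<le> e \<bullet> y\<close> by auto
  moreover have "U \<inter> ({z. e \<bullet> z < f z} \<inter> V) = {}"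
    using assms(1) unfolding graph_chart_def by fastforce
  ultimately show False
    using assms(3) open_Int_closure_eq_empty[of "{z. e \<bullet> z < f z} \<inter> V" U] by (auto simp: Int_commute)
qed

text \<open>For the converse, a point on the graph is outside \<open>U\<close>, while the points
  \<open>y + t *\<^sub>R e\<close> slightly above it are in \<open>U\<close>, because
  \<open>f\<close> does not see the shift.\<close>

lemma frontier_in_chart:
  assumes chart: "graph_chart U V e f C" and "open V" "open U" "y \<in> V"
  shows "y \<in> frontier U \<longleftrightarrow> e \<bullet> y = f y"
proof
  assume "y \<in> frontier U"
  then have "y \<in> closure U" "y \<notin> U"
    using \<open>open U\<close> by (auto simp: frontier_def interior_open)
  then show "e \<bullet> y = f y"
    using closure_le_in_chart[OF chart \<open>open V\<close> _ \<open>y \<in> V\<close>] chart \<open>y \<in> V\<close>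
    unfolding graph_chart_def by fastforce
next
  assume eq: "e \<bullet> y = f y"
  then have "y \<notin> U" using chart \<open>y \<in> V\<close> unfolding graph_chart_def by fastforce
  obtain \<delta> where \<delta>: "\<delta> > 0" "ball y \<delta> \<subseteq> V"
    using \<open>open V\<close> \<open>y \<in> V\<close> openE by blast
  have e: "norm e = 1" "e \<bullet> e = 1" using chart unfolding graph_chart_def by (auto simp: norm_eq_1)
  have "y \<in> closure U"
    unfolding closure_approachable
  proof (intro allI impI)
    fix \<epsilon> :: real assume "\<epsilon> > 0"
    define t where "t = min \<epsilon> \<delta> / 2"
    have t: "0 < t" "t < \<epsilon>" "t < \<delta>" using \<open>\<epsilon> > 0\<close> \<delta>(1) by (auto simp: t_def)
    then have "y + t *\<^sub>R e \<in> V" using \<delta>(2) e by (auto simp: subset_iff dist_norm)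
    moreover have "f (y + t *\<^sub>R e) < e \<bullet> (y + t *\<^sub>R e)"
      using chart eq t e unfolding graph_chart_def by (simp add: inner_add_right)
    ultimately have "y + t *\<^sub>R e \<in> U" using chart unfolding graph_chart_def by blast
    then show "\<exists>u\<in>U. dist u y < \<epsilon>"
      using t e by (intro bexI[of _ "y + t *\<^sub>R e"]) (auto simp: dist_norm)
  qed
  then show "y \<in> frontier U"
    using \<open>y \<notin> U\<close> \<open>open U\<close> by (auto simp: frontier_def interior_open)
qed

text \<open>The vectors that are inward at \<open>x\<close> form the interior of Clarke's tangent cone; it is convex.\<close>

definition inward :: "'a::euclidean_space set \<Rightarrow> 'a \<Rightarrow> 'a \<Rightarrow> bool" where
  "inward U x v \<longleftrightarrow> (\<exists>\<rho>>0. \<forall>y\<in>closure U \<inter> ball x \<rho>. \<forall>w\<in>ball v \<rho>. \<forall>t. 0 < t \<and> t < \<rho> \<longrightarrow> y + t *\<^sub>R w \<in> U)"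

lemma inward_chart_direction:
  assumes chart: "graph_chart U (ball x \<rho>) e f C" and "\<rho> > 0"
  shows "inward U x e"
proof -
  have C: "0 \<le> C" using chart unfolding graph_chart_def by (auto intro: lipschitz_on_nonneg)
  have e: "norm e = 1" "e \<bullet> e = 1" using chart unfolding graph_chart_def by (auto simp: norm_eq_1)
  \<comment> \<open>\<open>3 * s \<le> \<rho>\<close> keeps \<open>y + t *\<^sub>R w\<close> in the
    chart, since its distance from \<open>x\<close> is below \<open>s + 2 * s\<close>. The bound
    \<open>s * (2 + C) \<le> 1\<close> gives \<open>C * s < 1 - s\<close>: \<open>f\<close> rises by
    at most \<open>t * (C * s)\<close>, the height by at least \<open>t * (1 - s)\<close>.\<close>
  define s where "s = min (\<rho> / 3) (1 / (2 + C))"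
  have s: "s > 0" "3 * s \<le> \<rho>" using \<open>\<rho> > 0\<close> C by (auto simp: s_def)
  have "s * (2 + C) \<le> 1"
    using C by (subst pos_le_divide_eq[symmetric]) (auto simp: s_def)
  moreover have "0 \<le> C * s" using s(1) C by simp
  ultimately have sC: "C * s < 1 - s" "s \<le> 1" using s(1) by (auto simp: algebra_simps)
  have "y + t *\<^sub>R w \<in> U" if y: "y \<in> closure U" "dist x y < s" and w: "dist e w < s" and t: "0 < t" "t < s" for y w t
  proof -
    have we: "norm (w - e) < s" using w by (simp add: dist_norm norm_minus_commute)
    then have "norm w < 1 + s" using norm_triangle_ineq[of "w - e" e] e by simp
    have "norm (t *\<^sub>R w) \<le> s * 2"
      using \<open>norm w < 1 + s\<close> sC t by (auto intro!: mult_mono)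
    then have "dist x (y + t *\<^sub>R w) < \<rho>"
      using y(2) s dist_triangle[of x "y + t *\<^sub>R w" y] by (simp add: dist_norm)
    moreover have "f (y + t *\<^sub>R w) < e \<bullet> (y + t *\<^sub>R w)"
    proof -
      have "f (y + t *\<^sub>R w) = f ((y + t *\<^sub>R (w - e)) + t *\<^sub>R e)"
        by (simp add: algebra_simps)
      also have "\<dots> = f (y + t *\<^sub>R (w - e))" using chart unfolding graph_chart_def by blast
      also have "\<dots> \<le> f y + C * norm (t *\<^sub>R (w - e))"
      proof -
        have "dist (f (y + t *\<^sub>R (w - e))) (f y) \<le> C * dist (y + t *\<^sub>R (w - e)) y"
          using chart unfolding graph_chart_def by (auto intro: lipschitz_onD)
        then show ?thesis by (simp add: dist_norm abs_le_iff)
      qed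
      also have "C * norm (t *\<^sub>R (w - e)) \<le> t * (C * s)"
        using C t we by (auto intro!: mult_left_mono mult_mono simp: mult.left_commute[of C])
      also have "t * (C * s) < t * (1 - s)" using sC t by simp
      also have "f y \<le> e \<bullet> y"
        using closure_le_in_chart[OF chart _ y(1)] y(2) s by auto
      also have "1 - s \<le> e \<bullet> w"
        using Cauchy_Schwarz_ineq2[of e "w - e"] we e by (simp add: inner_diff_right)
      finally show ?thesis using t by (simp add: inner_add_right)
    qed
    ultimately show ?thesis using chart unfolding graph_chart_def by auto
  qed
  then show ?thesis unfolding inward_def using s(1) by (intro exI[of _ s]) auto
qed

text \<open>The displacement by \<open>t *\<^sub>R z\<close>, with \<open>z\<close> near
  \<open>v + w\<close>, is done in two inward moves: first exactly \<open>t *\<^sub>R v\<close>,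
  which leads into \<open>U\<close>, then \<open>t *\<^sub>R (z - v)\<close> with
  \<open>z - v\<close> near \<open>w\<close>. The divisor \<open>1 + norm v\<close> in
  \<open>q\<close> allows for the shift of the base point by the first move.\<close>

lemma inward_add:
  assumes "inward U x v" "inward U x w"
  shows "inward U x (v + w)"
proof -
  obtain r where r: "r > 0" "\<And>y z t. y \<in> closure U \<Longrightarrow> dist x y < r \<Longrightarrow> dist v z < r \<Longrightarrow> 0 < t \<Longrightarrow> t < r \<Longrightarrow> y + t *\<^sub>R z \<in> U"
    using assms(1) unfolding inward_def by auto
  obtain s where s: "s > 0" "\<And>y z t. y \<in> closure U \<Longrightarrow> dist x y < s \<Longrightarrow> dist w z < s \<Longrightarrow> 0 < t \<Longrightarrow> t < s \<Longrightarrow> y + t *\<^sub>R z \<in> U"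
    using assms(2) unfolding inward_def by auto
  define q where "q = min r (s / (1 + norm v))"
  have "q > 0" using r(1) s(1) by (auto simp: q_def intro!: divide_pos_pos add_pos_nonneg)
  have "q * (1 + norm v) \<le> s"
    by (subst pos_le_divide_eq[symmetric]) (auto simp: q_def add_pos_nonneg)
  then have qs: "q + q * norm v \<le> s" by (simp add: algebra_simps)
  then have "q \<le> s" using \<open>q > 0\<close> by (smt (verit) mult_nonneg_nonneg norm_ge_zero)
  have "y + t *\<^sub>R z \<in> U" if "y \<in> closure U" "dist x y < q" "dist (v + w) z < q" "0 < t" "t < q" for y z t
  proof -
    have "y + t *\<^sub>R v \<in> closure U"
      using r(2)[of y v t] r(1) that closure_subset by (auto simp: q_def)
    moreover have "dist x (y + t *\<^sub>R v) < s"
    proof -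
      have "dist x (y + t *\<^sub>R v) \<le> dist x y + t * norm v"
        using dist_triangle[of x "y + t *\<^sub>R v" y] that by (simp add: dist_norm)
      also have "t * norm v \<le> q * norm v" using that by (intro mult_right_mono) auto
      finally show ?thesis using that qs by simp
    qed
    moreover have "dist w (z - v) < s"
      using that \<open>q \<le> s\<close> by (simp add: dist_norm algebra_simps)
    ultimately have "(y + t *\<^sub>R v) + t *\<^sub>R (z - v) \<in> U"
      using that \<open>q \<le> s\<close> by (intro s(2)) auto
    then show ?thesis by (simp add: algebra_simps)
  qed
  then show ?thesis unfolding inward_def using \<open>q > 0\<close> by (intro exI[of _ q]) auto
qed

lemma inward_scaleR:
  assumes "inward U x v" "c > 0"
  shows "inward U x (c *\<^sub>R v)"
proof -
  obtain r where r: "r > 0" "\<And>y z t. y \<in> closure U \<Longrightarrow> dist x y < r \<Longrightarrow> dist v z < r \<Longrightarrow> 0 < t \<Longrightarrow> t < r \<Longrightarrow> y + t *\<^sub>R z \<in> U"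
    using assms(1) unfolding inward_def by auto
  define q where "q = min r (min (c * r) (r / c))"
  have "q > 0" using r(1) \<open>c > 0\<close> by (simp add: q_def)
  have "y + t *\<^sub>R z \<in> U" if "y \<in> closure U" "dist x y < q" "dist (c *\<^sub>R v) z < q" "0 < t" "t < q" for y z t
  proof -
    have "dist v ((1 / c) *\<^sub>R z) < r"
    proof -
      have "c *\<^sub>R v - z = c *\<^sub>R (v - (1 / c) *\<^sub>R z)"
        using \<open>c > 0\<close> by (simp add: algebra_simps)
      then have "c * dist v ((1 / c) *\<^sub>R z) < c * r"
        using that(3) \<open>c > 0\<close> by (simp add: dist_norm q_def)
      then show ?thesis using \<open>c > 0\<close> by simp
    qed
    moreover have "t * c < r"
      using that(5) \<open>c > 0\<close> by (simp add: q_def pos_less_divide_eq)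
    ultimately have "y + (t * c) *\<^sub>R ((1 / c) *\<^sub>R z) \<in> U"
      using that \<open>c > 0\<close> by (intro r(2)) (auto simp: q_def)
    then show ?thesis using \<open>c > 0\<close> by simp
  qed
  then show ?thesis unfolding inward_def using \<open>q > 0\<close> by (intro exI[of _ q]) auto
qed

lemma inward_sum:
  assumes "finite J" "J \<noteq> {}" "\<And>j. j \<in> J \<Longrightarrow> inward U x (v j)"
  shows "inward U x (\<Sum>j\<in>J. v j)"
  using assms by (induction J rule: finite_ne_induct) (auto intro: inward_add)

lemma inward_nearby:
  assumes "inward U x v"
  shows "\<exists>\<rho>>0. \<forall>y\<in>ball x \<rho>. inward U y v"
proof -
  obtain r where r: "r > 0" "\<And>y z t. y \<in> closure U \<Longrightarrow> dist x y < r \<Longrightarrow> dist v z < r \<Longrightarrow> 0 < t \<Longrightarrow> t < r \<Longrightarrow> y + t *\<^sub>R z \<in> U"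
    using assms(1) unfolding inward_def by auto
  have "inward U y v" if "y \<in> ball x (r / 2)" for y
    unfolding inward_def
  proof (intro exI[of _ "r / 2"] conjI ballI allI impI)
    fix z w t assume *: "z \<in> closure U \<inter> ball y (r / 2)" "w \<in> ball v (r / 2)" "0 < t \<and> t < r / 2"
    then have "dist x z < r"
      using that dist_triangle[of x z y] by auto
    with * r(1) show "z + t *\<^sub>R w \<in> U" by (intro r(2)) auto
  qed (use r in auto)
  then show ?thesis using r(1) by (intro exI[of _ "r / 2"]) auto
qed

section \<open>A continuously differentiable transversal field\<close>

lemma has_real_derivative_max_0_squared:
  "((\<lambda>u::real. (max 0 u)\<^sup>2) has_real_derivative 2 * max 0 u) (at u)"
proof -
  consider "u > 0" | "u < 0" | "u = 0" by linarith
  then show ?thesis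
  proof cases
    case 1
    have "((\<lambda>u. u\<^sup>2) has_real_derivative 2 * max 0 u) (at u)"
      using 1 by (auto intro!: derivative_eq_intros)
    then show ?thesis
      by (rule has_field_derivative_transform_within_open[of _ _ _ "{0<..}"]) (use 1 in auto)
  next
    case 2
    have "((\<lambda>u. 0) has_real_derivative 2 * max 0 u) (at u)"
      using 2 by (auto intro!: derivative_eq_intros)
    then show ?thesis
      by (rule has_field_derivative_transform_within_open[of _ _ _ "{..<0}"]) (use 2 in auto)
  next
    case 3
    have "((\<lambda>y::real. max 0 y) \<longlongrightarrow> max 0 0) (at 0)"
      by (intro tendsto_intros)
    moreover have "\<forall>\<^sub>F y::real in at 0. max 0 y = ((max 0 y)\<^sup>2 - (max 0 0)\<^sup>2) / (y - 0)"
      by (auto simp: eventually_at_filter max_def power2_eq_square)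
    ultimately show ?thesis
      unfolding 3 has_field_derivative_iff by (simp add: tendsto_cong)
  qed
qed

lemma has_derivative_bump:
  fixes x y :: "'a::euclidean_space"
  shows "((\<lambda>y. (max 0 (r - (y - x) \<bullet> (y - x)))\<^sup>2) has_derivative
    (\<lambda>h. - 4 * max 0 (r - (y - x) \<bullet> (y - x)) * ((y - x) \<bullet> h))) (at y)"
proof -
  have "((\<lambda>y. r - (y - x) \<bullet> (y - x)) has_derivative (\<lambda>h. - 2 * ((y - x) \<bullet> h))) (at y)"
    by (auto intro!: derivative_eq_intros simp: inner_commute)
  from has_derivative_compose[OF this has_real_derivative_max_0_squared[unfolded has_field_derivative_def]]
  show ?thesis by (simp add: mult.assoc)
qed

text \<open>The coefficients need not sum to 1, since every positive combination of inward vectors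
  is inward. The squared bumps are continuously differentiable and positive exactly on their balls.
  The bound \<open>B\<close> serves as Lipschitz constant of the field, and the continuity of
  \<open>X'\<close> serves the measurability of the Jacobian.\<close>

lemma ex_transversal_field:
  fixes F U :: "'a::euclidean_space set"
  assumes "compact F" "\<And>x. x \<in> F \<Longrightarrow> \<exists>v. inward U x v"
  shows "\<exists>X X' B. (\<forall>y. (X has_derivative X' y) (at y)) \<and> (\<forall>h. continuous_on UNIV (\<lambda>y. X' y h)) \<and>
    (\<forall>y h. norm (X' y h) \<le> B * norm h) \<and> (\<forall>y\<in>F. inward U y (X y))"
proof -
  have "\<exists>v. \<exists>\<rho>>0. \<forall>y\<in>ball x \<rho>. inward U y v" if "x \<in> F" for x
    using assms(2)[OF that] inward_nearby by blast
  then obtain v \<rho> where \<rho>: "\<And>x. x \<in> F \<Longrightarrow> \<rho> x > 0"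
    and v: "\<And>x y. x \<in> F \<Longrightarrow> y \<in> ball x (\<rho> x) \<Longrightarrow> inward U y (v x)" by metis
  obtain J where J: "J \<subseteq> F" "finite J" "F \<subseteq> (\<Union>x\<in>J. ball x (\<rho> x))"
    using compactE_image[OF \<open>compact F\<close>, of F "\<lambda>x. ball x (\<rho> x)"] \<rho> by force
  define m where "m x y = max 0 ((\<rho> x)\<^sup>2 - (y - x) \<bullet> (y - x))" for x y
  have m: "0 \<le> m x y" "m x y \<le> (\<rho> x)\<^sup>2" for x y by (auto simp: m_def)
  have m0: "m x y > 0 \<longleftrightarrow> y \<in> ball x (\<rho> x)" if "x \<in> F" for x y
  proof -
    have "m x y > 0 \<longleftrightarrow> (norm (y - x))\<^sup>2 < (\<rho> x)\<^sup>2"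
      by (auto simp: m_def power2_norm_eq_inner)
    also have "\<dots> \<longleftrightarrow> norm (y - x) < \<rho> x"
      using \<rho>[OF that] by (auto intro: power_strict_mono dest: power_less_imp_less_base)
    finally show ?thesis by (simp add: dist_norm norm_minus_commute)
  qed
  define X where "X y = (\<Sum>x\<in>J. (m x y)\<^sup>2 *\<^sub>R v x)" for y
  define X' where "X' y h = (\<Sum>x\<in>J. (- 4 * m x y * ((y - x) \<bullet> h)) *\<^sub>R v x)" for y h
  \<comment> \<open>On its ball a bump has \<open>m x y\<close> at most the square of
    \<open>\<rho> x\<close> and \<open>norm (y - x) < \<rho> x\<close>; elsewhere its term
    vanishes.\<close>
  define B where "B = (\<Sum>x\<in>J. 4 * (\<rho> x)\<^sup>2 * \<rho> x * norm (v x))"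
  have "(X has_derivative X' y) (at y)" for y
    unfolding X_def[abs_def] X'_def[abs_def] m_def
    by (intro has_derivative_sum has_derivative_scaleR_left has_derivative_bump)
  moreover have "continuous_on UNIV (\<lambda>y. X' y h)" for h
    unfolding X'_def m_def by (intro continuous_intros)
  moreover have "norm (X' y h) \<le> B * norm h" for y h
  proof -
    have "norm (X' y h) \<le> (\<Sum>x\<in>J. 4 * (\<rho> x)\<^sup>2 * \<rho> x * norm (v x) * norm h)"
      unfolding X'_def
    proof (rule sum_norm_le)
      fix x assume "x \<in> J"
      then have x: "x \<in> F" using J by auto
      have "m x y * \<bar>(y - x) \<bullet> h\<bar> \<le> (\<rho> x)\<^sup>2 * (\<rho> x * norm h)"
      proof (cases "y \<in> ball x (\<rho> x)")
        case True
        have "\<bar>(y - x) \<bullet> h\<bar> \<le> norm (y - x) * norm h" by (rule Cauchy_Schwarz_ineq2)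
        also have "\<dots> \<le> \<rho> x * norm h"
          using True by (intro mult_right_mono) (auto simp: dist_norm norm_minus_commute)
        finally show ?thesis using m by (intro mult_mono) auto
      next
        case False
        then have "m x y = 0" using m0[OF x, of y] m(1)[of x y] by linarith
        then show ?thesis using \<rho>[OF x] by simp
      qed
      then have "4 * (m x y * \<bar>(y - x) \<bullet> h\<bar>) * norm (v x) \<le> 4 * ((\<rho> x)\<^sup>2 * (\<rho> x * norm h)) * norm (v x)"
        by (intro mult_right_mono) auto
      then show "norm ((- 4 * m x y * ((y - x) \<bullet> h)) *\<^sub>R v x) \<le> 4 * (\<rho> x)\<^sup>2 * \<rho> x * norm (v x) * norm h"
        using m(1)[of x y] by (simp add: abs_mult mult_ac)
    qed
    then show ?thesis by (simp add: B_def sum_distrib_right)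
  qed
  moreover have "inward U y (X y)" if "y \<in> F" for y
  proof -
    \<comment> \<open>Only the bumps active at \<open>y\<close> are kept: scaling preserves inward
      vectors for positive factors, and \<open>v x\<close> is known to be inward only near
      \<open>x\<close>.\<close>
    define J' where "J' = {x \<in> J. m x y > 0}"
    have "X y = (\<Sum>x\<in>J'. (m x y)\<^sup>2 *\<^sub>R v x)"
      unfolding X_def J'_def using J(2) m(1)
      by (intro sum.mono_neutral_right) (auto simp: not_less antisym)
    moreover have "J' \<noteq> {}"
      using J that m0 unfolding J'_def by fastforce
    ultimately show ?thesis
      using J m0 v by (auto intro!: inward_sum inward_scaleR simp: J'_def subset_iff)
  qed
  ultimately show ?thesis by blast
qed

lemma uniformly_inward:
  fixes F U :: "'a::euclidean_space set"
  assumes "compact F" "F \<subseteq> closure U" and lip: "B-lipschitz_on UNIV X"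
    and inw: "\<And>y. y \<in> F \<Longrightarrow> inward U y (X y)"
  shows "\<exists>\<rho>>0. \<forall>y\<in>F. \<forall>w\<in>ball (X y) \<rho>. \<forall>t. 0 < t \<and> t < \<rho> \<longrightarrow> y + t *\<^sub>R w \<in> U"
proof -
  have "0 \<le> B" using lip by (rule lipschitz_on_nonneg)
  obtain r where r: "\<And>x. x \<in> F \<Longrightarrow> r x > 0" "\<And>x y w t. x \<in> F \<Longrightarrow> y \<in> closure U \<Longrightarrow> dist x y < r x \<Longrightarrow>
      dist (X x) w < r x \<Longrightarrow> 0 < t \<Longrightarrow> t < r x \<Longrightarrow> y + t *\<^sub>R w \<in> U"
    using inw unfolding inward_def Ball_def Int_iff mem_ball by metis
  \<comment> \<open>On a ball of this radius \<open>X\<close> changes by at most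
    \<open>r x / 2\<close>, which leaves the other half of \<open>r x\<close> for the deviation of
    \<open>w\<close> from \<open>X y\<close>.\<close>
  define d where "d x = r x / (2 * (1 + B))" for x
  have d: "d x > 0" "B * d x \<le> r x / 2" "d x \<le> r x" if "x \<in> F" for x
    using r(1)[OF that] \<open>0 \<le> B\<close> by (auto simp: d_def field_simps)
  obtain J where J: "J \<subseteq> F" "finite J" "F \<subseteq> (\<Union>x\<in>J. ball x (d x))"
    using compactE_image[OF \<open>compact F\<close>, of F "\<lambda>x. ball x (d x)"] d(1) by force
  define \<rho> where "\<rho> = Min (insert 1 ((\<lambda>x. r x / 2) ` J))"
  have "\<rho> > 0" using J r(1) by (auto simp: \<rho>_def subset_iff)
  have \<rho>: "\<rho> \<le> r x / 2" if "x \<in> J" for x using J that unfolding \<rho>_def by (intro Min_le) auto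
  have "y + t *\<^sub>R w \<in> U" if "y \<in> F" "dist (X y) w < \<rho>" "0 < t" "t < \<rho>" for y w t
  proof -
    obtain x where x: "x \<in> J" "dist x y < d x" using J(3) \<open>y \<in> F\<close> by auto
    then have xF: "x \<in> F" using J by auto
    have "dist (X x) (X y) \<le> B * dist x y" by (rule lipschitz_onD[OF lip]) auto
    also have "\<dots> \<le> B * d x" using x \<open>0 \<le> B\<close> by (intro mult_left_mono) auto
    also have "\<dots> \<le> r x / 2" by (rule d(2)[OF xF])
    finally have "dist (X x) w < r x"
      using that \<rho>[OF x(1)] dist_triangle[of "X x" w "X y"] by linarith
    then show ?thesis
      using that \<rho>[OF x(1)] x d(3)[OF xF] r(1)[OF xF] \<open>F \<subseteq> closure U\<close>
      by (intro r(2)[OF xF]) auto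
  qed
  then show ?thesis using \<open>\<rho> > 0\<close> by auto
qed

section \<open>Bi-Lipschitz estimates for the displacement along the field\<close>

lemma bilipschitz_homeomorphism_onto_image_if_expanding:
  assumes lip: "L-lipschitz_on D f" and "c > 0"
    and exp: "\<And>x y. x \<in> D \<Longrightarrow> y \<in> D \<Longrightarrow> c * dist x y \<le> dist (f x) (f y)"
  shows "bilipschitz_homeomorphism_onto_image D f"
proof -
  have inj: "inj_on f D"
  proof (rule inj_onI)
    fix x y assume "x \<in> D" "y \<in> D" "f x = f y"
    then have "c * dist x y \<le> 0" using exp[of x y] by simp
    then show "x = y" using \<open>c > 0\<close> by (simp add: mult_le_0_iff)
  qed
  define g where "g = inv_into D f"
  have gf: "g (f x) = x" if "x \<in> D" for x using inj that by (simp add: g_def)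
  have glip: "(1 / c)-lipschitz_on (f ` D) g"
  proof (rule lipschitz_onI)
    fix u w assume "u \<in> f ` D" "w \<in> f ` D"
    then obtain x y where "x \<in> D" "y \<in> D" "u = f x" "w = f y" by auto
    then show "dist (g u) (g w) \<le> 1 / c * dist u w"
      using exp[of x y] \<open>c > 0\<close> by (simp add: gf field_simps)
  qed (use \<open>c > 0\<close> in simp)
  have "homeomorphism D (f ` D) f g"
    using lipschitz_on_continuous_on[OF lip] lipschitz_on_continuous_on[OF glip] gf
    by (intro homeomorphismI) auto
  then show ?thesis
    unfolding bilipschitz_homeomorphism_onto_image_def using lip glip by blast
qed

text \<open>
  Two frontier points never differ by a short inward vector, which makes \<open>(x, t) \<mapsto> x + t X(x)\<close>
  expanding.
\<close>

lemma flow_expanding: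
  fixes F U :: "'a::euclidean_space set"
  assumes disj: "F \<inter> U = {}" and lip: "B-lipschitz_on UNIV X" and K: "\<And>y. y \<in> F \<Longrightarrow> norm (X y) \<le> K"
    and "\<rho> > 0" and inw: "\<And>y w t. y \<in> F \<Longrightarrow> w \<in> ball (X y) \<rho> \<Longrightarrow> 0 < t \<Longrightarrow> t < \<rho> \<Longrightarrow> y + t *\<^sub>R w \<in> U"
    and "0 \<le> K"
    and \<epsilon>: "0 < \<epsilon>" "\<epsilon> < \<rho>" "\<epsilon> * B \<le> \<rho> / (\<rho> + K + 1) / 2"
    and "x \<in> F" "y \<in> F" "0 \<le> s" "s \<le> r" "r \<le> \<epsilon>"
  shows "\<rho> / (\<rho> + K + 1) / 2 * (dist x y + (r - s)) \<le> norm ((x + s *\<^sub>R X x) - (y + r *\<^sub>R X y))"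
proof -
  define c where "c = \<rho> / (\<rho> + K + 1)"
  define T where "T = r - s"
  define z where "z = x - y - T *\<^sub>R X y"
  have T: "0 \<le> T" "T < \<rho>" using assms by (auto simp: T_def)
  have 1: "\<rho> * T \<le> norm z"
  proof (cases "T = 0")
    case False
    then have "T > 0" using T by simp
    show ?thesis
    proof (rule ccontr)
      \<comment> \<open>Otherwise \<open>x\<close> would be reached from \<open>y\<close> in time
        \<open>T\<close> along a direction within \<open>\<rho>\<close> of \<open>X y\<close>, and
        would lie in \<open>U\<close>.\<close>
      assume neg: "\<not> \<rho> * T \<le> norm z"
      define w where "w = X y + (1 / T) *\<^sub>R z"
      have "dist (X y) w < \<rho>"
        using neg \<open>T > 0\<close> by (simp add: w_def dist_norm field_simps)
      then have "y + T *\<^sub>R w \<in> U" using inw[OF \<open>y \<in> F\<close>, of w T] \<open>T > 0\<close> T by simp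
      moreover have "y + T *\<^sub>R w = x" using \<open>T > 0\<close> by (simp add: w_def z_def scaleR_add_right)
      ultimately show False using disj \<open>x \<in> F\<close> by auto
    qed
  qed simp
  have 2: "dist x y - T * K \<le> norm z"
  proof -
    have "norm (T *\<^sub>R X y) \<le> T * K" using T K[OF \<open>y \<in> F\<close>] by (simp add: mult_left_mono)
    then show ?thesis using norm_triangle_ineq2[of "x - y" "T *\<^sub>R X y"] by (simp add: z_def dist_norm)
  qed
  have pos: "\<rho> + K + 1 > 0" using \<open>\<rho> > 0\<close> \<open>0 \<le> K\<close> by simp
  \<comment> \<open>With the weights \<open>K + 1\<close> and \<open>\<rho>\<close> the terms in
    \<open>T\<close> of the two estimates combine to \<open>\<rho> * T\<close>; this is the origin
    of \<open>c\<close>.\<close>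
  have "(K + 1) * (\<rho> * T) + \<rho> * (dist x y - T * K) \<le> (K + 1) * norm z + \<rho> * norm z"
    using 1 2 \<open>\<rho> > 0\<close> \<open>0 \<le> K\<close> by (intro add_mono mult_left_mono) auto
  then have "\<rho> * (dist x y + T) \<le> norm z * (\<rho> + K + 1)"
    by (simp add: algebra_simps)
  then have 3: "c * (dist x y + T) \<le> norm z"
    using pos by (simp add: c_def pos_divide_le_eq)
  have "norm (s *\<^sub>R (X x - X y)) \<le> \<epsilon> * (B * dist x y)"
    using assms lipschitz_onD[OF lip, of x y]
    by (auto simp: dist_norm intro!: mult_mono)
  \<comment> \<open>The bound on \<open>\<epsilon> * B\<close> lets the variation of
    \<open>X\<close> use up at most half of the lower bound for \<open>norm z\<close>.\<close>
  also have "\<dots> \<le> c / 2 * dist x y"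
    using \<epsilon>(3) by (subst mult.assoc[symmetric], intro mult_right_mono) (auto simp: c_def)
  also have "\<dots> \<le> c / 2 * (dist x y + T)"
    using T pos \<open>\<rho> > 0\<close> by (intro mult_left_mono) (auto simp: c_def)
  finally have 4: "norm (s *\<^sub>R (X x - X y)) \<le> c / 2 * (dist x y + T)" .
  have "(x + s *\<^sub>R X x) - (y + r *\<^sub>R X y) = z + s *\<^sub>R (X x - X y)"
    by (simp add: z_def T_def algebra_simps)
  then have "norm z - norm (s *\<^sub>R (X x - X y)) \<le> norm ((x + s *\<^sub>R X x) - (y + r *\<^sub>R X y))"
    using norm_diff_ineq[of z "s *\<^sub>R (X x - X y)"] by simp
  then have "c * (dist x y + T) - c / 2 * (dist x y + T) \<le> norm ((x + s *\<^sub>R X x) - (y + r *\<^sub>R X y))"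
    using 3 4 by linarith
  moreover have "c * (dist x y + T) - c / 2 * (dist x y + T) = c / 2 * (dist x y + T)" by (simp add: algebra_simps)
  ultimately show ?thesis unfolding c_def T_def by simp
qed

lemma ex_lipschitz_deformation_along_field:
  fixes U :: "(real ^ 'n) set"
  assumes "bounded U" "open U" and lip: "B-lipschitz_on UNIV X"
    and inw: "\<And>y. y \<in> frontier U \<Longrightarrow> inward U y (X y)"
  shows "\<exists>\<epsilon>>0. lipschitz_deformation U (\<lambda>(x, \<tau>). x + (\<epsilon> * \<tau>) *\<^sub>R X x)"
proof -
  define F where "F = frontier U"
  have "compact F" using \<open>bounded U\<close> by (simp add: F_def compact_frontier_bounded)
  have FU: "F \<subseteq> closure U" "F \<inter> U = {}"
    using \<open>open U\<close> by (auto simp: F_def frontier_def interior_open)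
  obtain \<rho> where \<rho>: "\<rho> > 0" "\<And>y w t. y \<in> F \<Longrightarrow> w \<in> ball (X y) \<rho> \<Longrightarrow> 0 < t \<Longrightarrow> t < \<rho> \<Longrightarrow> y + t *\<^sub>R w \<in> U"
    using uniformly_inward[OF \<open>compact F\<close> FU(1) lip] inw unfolding F_def by metis
  have "bounded (X ` F)"
    using \<open>compact F\<close> lipschitz_on_continuous_on[OF lip]
    by (meson compact_continuous_image compact_imp_bounded continuous_on_subset subset_UNIV)
  then obtain K where K: "K > 0" "\<And>y. y \<in> F \<Longrightarrow> norm (X y) \<le> K"
    by (auto simp: bounded_pos)
  have "0 \<le> B" using lip by (rule lipschitz_on_nonneg)
  define c where "c = \<rho> / (\<rho> + K + 1) / 2"
  have "c > 0" using \<rho>(1) K(1) by (simp add: c_def)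
  \<comment> \<open>The first entry keeps all times below \<open>\<rho>\<close>, the second bounds
    \<open>\<epsilon> * B\<close> by the constant of \<open>flow_expanding\<close>.\<close>
  define \<epsilon> where "\<epsilon> = min (\<rho> / 2) (c / (B + 1))"
  have \<epsilon>: "0 < \<epsilon>" "\<epsilon> < \<rho>" using \<rho>(1) \<open>c > 0\<close> \<open>0 \<le> B\<close> by (auto simp: \<epsilon>_def)
  have "\<epsilon> * (B + 1) \<le> c" using \<open>0 \<le> B\<close> by (subst pos_le_divide_eq[symmetric]) (auto simp: \<epsilon>_def)
  then have \<epsilon>B: "\<epsilon> * B \<le> c" using \<epsilon>(1) by (simp add: algebra_simps)
  define \<Psi> where "\<Psi> = (\<lambda>(x, \<tau>). x + (\<epsilon> * \<tau>) *\<^sub>R X x)"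
  define D where "D = F \<times> {0..1::real}"
  have "bilipschitz_homeomorphism_onto_image D \<Psi>"
  proof (rule bilipschitz_homeomorphism_onto_image_if_expanding)
    show "(1 + \<epsilon> * B + \<epsilon> * K)-lipschitz_on D \<Psi>"
    proof (rule lipschitz_onI)
      fix p q assume "p \<in> D" "q \<in> D"
      then obtain x \<tau> y \<sigma> where p: "p = (x, \<tau>)" "q = (y, \<sigma>)" "x \<in> F" "y \<in> F" "0 \<le> \<tau>" "\<tau> \<le> 1" "0 \<le> \<sigma>" "\<sigma> \<le> 1"
        by (auto simp: D_def)
      have d: "dist x y \<le> dist p q" "\<bar>\<tau> - \<sigma>\<bar> \<le> dist p q"
        using dist_fst_le[of p q] dist_snd_le[of p q] by (auto simp: p dist_real_def)
      have "\<Psi> p - \<Psi> q = (x - y) + (\<epsilon> * \<tau>) *\<^sub>R (X x - X y) + (\<epsilon> * (\<tau> - \<sigma>)) *\<^sub>R X y"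
        by (simp add: \<Psi>_def p algebra_simps)
      then have "dist (\<Psi> p) (\<Psi> q) \<le> norm (x - y) + norm ((\<epsilon> * \<tau>) *\<^sub>R (X x - X y)) + norm ((\<epsilon> * (\<tau> - \<sigma>)) *\<^sub>R X y)"
        unfolding dist_norm
        by (simp only:) (intro order_trans[OF norm_triangle_ineq] add_right_mono norm_triangle_ineq)
      also have "norm ((\<epsilon> * \<tau>) *\<^sub>R (X x - X y)) \<le> \<epsilon> * (B * dist p q)"
      proof -
        have "norm (X x - X y) \<le> B * dist x y" using lipschitz_onD[OF lip, of x y] by (simp add: dist_norm)
        also have "\<dots> \<le> B * dist p q" using d \<open>0 \<le> B\<close> by (intro mult_left_mono) auto
        finally have "\<epsilon> * \<tau> * norm (X x - X y) \<le> \<epsilon> * 1 * (B * dist p q)"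
          using p \<epsilon> by (intro mult_mono) auto
        then show ?thesis using p \<epsilon> by simp
      qed
      also have "norm ((\<epsilon> * (\<tau> - \<sigma>)) *\<^sub>R X y) \<le> \<epsilon> * dist p q * K"
        using d K(2)[of y] K(1) p \<epsilon> by (auto simp: abs_mult intro!: mult_mono)
      also have "norm (x - y) \<le> dist p q" using d by (simp add: dist_norm)
      finally show "dist (\<Psi> p) (\<Psi> q) \<le> (1 + \<epsilon> * B + \<epsilon> * K) * dist p q"
        by (simp add: algebra_simps)
    qed (use \<epsilon> \<open>0 \<le> B\<close> K in auto)
    \<comment> \<open>The parameter \<open>\<tau>\<close> enters as the time
      \<open>\<epsilon> * \<tau>\<close>, which costs the factor
      \<open>min 1 \<epsilon>\<close>.\<close>
    show "c * min 1 \<epsilon> > 0" using \<open>c > 0\<close> \<epsilon> by simp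
    show "c * min 1 \<epsilon> * dist p q \<le> dist (\<Psi> p) (\<Psi> q)" if pq: "p \<in> D" "q \<in> D" for p q
    proof -
      have *: "c * min 1 \<epsilon> * dist (x, \<tau>) (y, \<sigma>) \<le> dist (\<Psi> (x, \<tau>)) (\<Psi> (y, \<sigma>))"
        if "x \<in> F" "y \<in> F" "0 \<le> \<tau>" "\<tau> \<le> \<sigma>" "\<sigma> \<le> 1" for x y \<tau> \<sigma>
      proof -
        have "dist (x, \<tau>) (y, \<sigma>) \<le> dist x y + (\<sigma> - \<tau>)"
          using that sqrt_sum_squares_le_sum_abs[of "dist x y" "dist \<tau> \<sigma>"] by (simp add: dist_Pair_Pair dist_real_def)
        then have "min 1 \<epsilon> * dist (x, \<tau>) (y, \<sigma>) \<le> min 1 \<epsilon> * (dist x y + (\<sigma> - \<tau>))"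
          using \<epsilon> by (intro mult_left_mono) auto
        also have "\<dots> = min 1 \<epsilon> * dist x y + min 1 \<epsilon> * (\<sigma> - \<tau>)" by (simp add: distrib_left)
        also have "\<dots> \<le> 1 * dist x y + \<epsilon> * (\<sigma> - \<tau>)"
          using that by (intro add_mono mult_right_mono) auto
        finally have "c * (min 1 \<epsilon> * dist (x, \<tau>) (y, \<sigma>)) \<le> c * (dist x y + (\<epsilon> * \<sigma> - \<epsilon> * \<tau>))"
          using \<open>c > 0\<close> by (intro mult_left_mono) (auto simp: algebra_simps)
        also have "\<dots> \<le> norm ((x + (\<epsilon> * \<tau>) *\<^sub>R X x) - (y + (\<epsilon> * \<sigma>) *\<^sub>R X y))"
          unfolding c_def using that \<epsilon> K \<rho> \<epsilon>B FU
          by (intro flow_expanding[OF FU(2) lip K(2)]) (auto simp: c_def)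
        finally show ?thesis by (simp add: \<Psi>_def dist_norm mult.assoc)
      qed
      obtain x \<tau> y \<sigma> where p: "p = (x, \<tau>)" "q = (y, \<sigma>)" "x \<in> F" "y \<in> F" "0 \<le> \<tau>" "\<tau> \<le> 1" "0 \<le> \<sigma>" "\<sigma> \<le> 1"
        using pq by (auto simp: D_def)
      show ?thesis
        using *[of x y \<tau> \<sigma>] *[of y x \<sigma> \<tau>] p by (cases "\<tau> \<le> \<sigma>") (auto simp: dist_commute)
    qed
  qed
  moreover have "\<Psi> (x, \<tau>) \<in> closure U" if "x \<in> F" "0 \<le> \<tau>" "\<tau> \<le> 1" for x \<tau>
  proof (cases "\<tau> = 0")
    case False
    have "\<epsilon> * \<tau> \<le> \<epsilon> * 1" using that \<epsilon> by (intro mult_left_mono) auto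
    then have "\<epsilon> * \<tau> < \<rho>" using \<epsilon>(2) by linarith
    then have "x + (\<epsilon> * \<tau>) *\<^sub>R X x \<in> U"
      using False that \<epsilon> \<rho>(1) by (intro \<rho>(2)) auto
    then show ?thesis using closure_subset by (auto simp: \<Psi>_def)
  qed (use that FU in \<open>auto simp: \<Psi>_def\<close>)
  ultimately have "lipschitz_deformation U \<Psi>"
    unfolding lipschitz_deformation_def D_def F_def by (auto simp: \<Psi>_def)
  then show ?thesis using \<epsilon>(1) unfolding \<Psi>_def by blast
qed

section \<open>Tangent cones\<close>

text \<open>This makes the choice in \<open>frechet_derivative\<close> harmless for the tangential
  Jacobian. The difference \<open>D\<close> is a derivative of the zero function within
  \<open>M\<close>, so \<open>D (y i - x)\<close> is small against \<open>norm (y i - x)\<close>;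
  homogeneity carries this over to the rescaled vectors, which tend to \<open>v\<close>.\<close>

lemma derivative_unique_on_tangent_cone:
  fixes f :: "'a::euclidean_space \<Rightarrow> 'b::real_normed_vector"
  assumes L: "(f has_derivative L) (at x within M)" and L': "(f has_derivative L') (at x within M)"
    and "v \<in> tangent_cone M x"
  shows "L v = L' v"
proof -
  define D where "D h = L h - L' h" for h
  have D: "((\<lambda>y. f y - f y) has_derivative D) (at x within M)"
    unfolding D_def by (rule has_derivative_diff[OF L L'])
  have bl: "bounded_linear D" using D by (rule has_derivative_bounded_linear)
  obtain y t where yt: "\<And>i::nat. y i \<in> M" "\<And>i. t i > (0::real)" "y \<longlonglongrightarrow> x"
    "(\<lambda>i. t i *\<^sub>R (y i - x)) \<longlonglongrightarrow> v"
    using \<open>v \<in> tangent_cone M x\<close> by (auto simp: tangent_cone_def)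
  have "norm (D v) \<le> e * norm v" if "e > 0" for e
  proof -
    obtain d where d: "d > 0" "\<And>z. z \<in> M \<Longrightarrow> norm (z - x) < d \<Longrightarrow> norm (D (z - x)) \<le> e * norm (z - x)"
      using D \<open>e > 0\<close> unfolding has_derivative_within_alt by auto
    have "\<forall>\<^sub>F i in sequentially. dist (y i) x < d"
      using tendstoD[OF yt(3) \<open>d > 0\<close>] .
    then have ev: "\<forall>\<^sub>F i in sequentially. norm (D (t i *\<^sub>R (y i - x))) \<le> e * norm (t i *\<^sub>R (y i - x))"
    proof eventually_elim
      case (elim i)
      then have "t i * norm (D (y i - x)) \<le> t i * (e * norm (y i - x))"
        using d(2)[OF yt(1), of i] yt(2)[of i] by (intro mult_left_mono) (auto simp: dist_norm)
      then show ?case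
        using yt(2)[of i] by (simp add: linear_scale[OF bounded_linear.linear[OF bl]] mult_ac)
    qed
    have 1: "(\<lambda>i. norm (D (t i *\<^sub>R (y i - x)))) \<longlonglongrightarrow> norm (D v)"
      by (intro tendsto_norm bounded_linear.tendsto[OF bl] yt(4))
    have 2: "(\<lambda>i. e * norm (t i *\<^sub>R (y i - x))) \<longlonglongrightarrow> e * norm v"
      by (intro tendsto_intros yt(4))
    show ?thesis by (rule tendsto_le[OF _ 2 1 ev]) simp
  qed
  then have "norm (D v) \<le> 0 + e" if "e > 0" for e
  proof -
    have "norm (D v) \<le> e / (norm v + 1) * norm v"
      using that by (intro \<open>\<And>e. e > 0 \<Longrightarrow> norm (D v) \<le> e * norm v\<close>) (auto simp: add_nonneg_pos)
    also have "\<dots> \<le> e"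
      using that by (simp add: pos_divide_le_eq add_pos_nonneg algebra_simps)
    finally show ?thesis by simp
  qed
  then have "norm (D v) \<le> 0" by (rule field_le_epsilon)
  then show ?thesis by (simp add: D_def)
qed

lemma has_real_derivative_along_line:
  assumes "(f has_derivative D) (at y)"
  shows "((\<lambda>t. f (y + t *\<^sub>R h)) has_real_derivative D h) (at 0)"
proof -
  have lin: "linear D" using assms by (simp add: has_derivative_linear)
  have "((\<lambda>t. y + t *\<^sub>R h) has_derivative (\<lambda>t. t *\<^sub>R h)) (at (0::real))"
    by (auto intro!: derivative_eq_intros)
  from has_derivative_compose[OF this, of f D] assms
  have "((\<lambda>t. f (y + t *\<^sub>R h)) has_derivative (\<lambda>t. D (t *\<^sub>R h))) (at 0)" by simp
  moreover have "(\<lambda>t. D (t *\<^sub>R h)) = (*) (D h)"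
    by (auto simp: linear_scale[OF lin])
  ultimately show ?thesis unfolding has_field_derivative_def by simp
qed

text \<open>On the frontier \<open>f z\<close> coincides with \<open>e \<bullet> z\<close>, so both
  \<open>D\<close> and the inner product with \<open>e\<close> are derivatives of \<open>f\<close>
  within it and agree on the tangent cone. Conversely, moving along \<open>h\<close> and correcting
  vertically back to the graph gives points \<open>z i\<close> whose rescaled differences tend to
  \<open>h + (D h - e \<bullet> h) *\<^sub>R e\<close>, which is \<open>h\<close>.\<close>

lemma tangent_cone_frontier_in_chart:
  assumes chart: "graph_chart U V e f C" and "open V" "open U" "y \<in> V" "y \<in> frontier U"
    and D: "(f has_derivative D) (at y)"
  shows "tangent_cone (frontier U) y = {h. D h = e \<bullet> h}"
proof (intro set_eqI iffI)
  fix h assume h: "h \<in> tangent_cone (frontier U) y"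
  obtain \<delta> where \<delta>: "\<delta> > 0" "ball y \<delta> \<subseteq> V"
    using \<open>open V\<close> \<open>y \<in> V\<close> openE by blast
  have "((\<lambda>z. e \<bullet> z) has_derivative (\<lambda>z. e \<bullet> z)) (at y within frontier U)"
    by (auto intro!: derivative_eq_intros)
  then have "(f has_derivative (\<lambda>z. e \<bullet> z)) (at y within frontier U)"
  proof (rule has_derivative_transform_within)
    show "e \<bullet> z = f z" if "z \<in> frontier U" "dist z y < \<delta>" for z
      using frontier_in_chart[OF chart \<open>open V\<close> \<open>open U\<close>, of z] that \<delta> by (auto simp: dist_commute)
  qed fact+
  moreover have "(f has_derivative D) (at y within frontier U)"
    using D by (rule has_derivative_at_withinI)
  ultimately show "h \<in> {h. D h = e \<bullet> h}"
    using derivative_unique_on_tangent_cone[OF _ _ h] by auto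
next
  fix h assume "h \<in> {h. D h = e \<bullet> h}"
  then have Dh: "D h = e \<bullet> h" by simp
  have e: "e \<bullet> e = 1" and inv: "\<And>z t. f (z + t *\<^sub>R e) = f z"
    and cont: "continuous_on UNIV f"
    using chart unfolding graph_chart_def by (auto simp: norm_eq_1 intro: lipschitz_on_continuous_on)
  have fy: "f y = e \<bullet> y" using frontier_in_chart[OF assms(1-4)] assms(5) by simp
  define s where "s i = 1 / (real i + 1)" for i
  have s: "s i > 0" for i by (simp add: s_def)
  have s0: "s \<longlonglongrightarrow> 0"
    using LIMSEQ_inverse_real_of_nat by (simp add: s_def[abs_def] inverse_eq_divide add.commute)
  define p where "p i = y + s i *\<^sub>R h" for i
  define z where "z i = p i + (f (p i) - e \<bullet> p i) *\<^sub>R e" for i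
  have "isCont f y" using cont by (simp add: continuous_on_eq_continuous_at)
  have "p \<longlonglongrightarrow> y + 0 *\<^sub>R h"
    unfolding p_def by (intro tendsto_intros s0)
  then have py: "p \<longlonglongrightarrow> y" by simp
  then have "(\<lambda>i. f (p i)) \<longlonglongrightarrow> f y" by (rule isCont_tendsto_compose[OF \<open>isCont f y\<close>])
  then have "z \<longlonglongrightarrow> y + (f y - e \<bullet> y) *\<^sub>R e"
    unfolding z_def by (intro tendsto_intros py)
  then have zy: "z \<longlonglongrightarrow> y" by (simp add: fy)
  have "((\<lambda>t. (f (y + t *\<^sub>R h) - f y) / t) \<longlongrightarrow> D h) (at 0)"
    using has_real_derivative_along_line[OF D, of h] by (simp add: has_field_derivative_iff)
  moreover have "filterlim s (at 0) sequentially"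
    using s0 s by (auto simp: filterlim_at less_imp_neq[symmetric])
  ultimately have "(\<lambda>i. (f (p i) - f y) / s i) \<longlonglongrightarrow> D h"
    unfolding p_def by (rule filterlim_compose)
  then have "(\<lambda>i. h + ((f (p i) - f y) / s i - e \<bullet> h) *\<^sub>R e) \<longlonglongrightarrow> h + (D h - e \<bullet> h) *\<^sub>R e"
    by (intro tendsto_intros)
  moreover have "(1 / s i) *\<^sub>R (z i - y) = h + ((f (p i) - f y) / s i - e \<bullet> h) *\<^sub>R e" for i
  proof -
    have "(1 / s i) *\<^sub>R (z i - y) = (1 / s i) *\<^sub>R (s i *\<^sub>R h) + ((1 / s i) * (f (p i) - e \<bullet> p i)) *\<^sub>R e"
      by (simp add: z_def p_def scaleR_add_right)
    also have "(1 / s i) * (f (p i) - e \<bullet> p i) = (f (p i) - f y) / s i - e \<bullet> h"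
      using s[of i] by (simp add: fy p_def inner_add_right field_simps)
    finally show ?thesis using s[of i] by simp
  qed
  ultimately have lim: "(\<lambda>i. (1 / s i) *\<^sub>R (z i - y)) \<longlonglongrightarrow> h" by (simp add: Dh)
  have "\<forall>\<^sub>F i in sequentially. z i \<in> V"
    using zy \<open>open V\<close> \<open>y \<in> V\<close> by (rule topological_tendstoD)
  then obtain N where N: "\<And>i. i \<ge> N \<Longrightarrow> z i \<in> V" by (auto simp: eventually_sequentially)
  \<comment> \<open>All \<open>z i\<close> lie on the graph of \<open>f\<close>, but the graph is
    the frontier only inside \<open>V\<close>; hence the shift by \<open>N\<close>.\<close>
  have "z (i + N) \<in> frontier U" for i
    using frontier_in_chart[OF chart \<open>open V\<close> \<open>open U\<close> N[of "i + N"]] inv e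
    by (simp add: z_def inner_add_right)
  then show "h \<in> tangent_cone (frontier U) y"
    unfolding tangent_cone_def mem_Collect_eq using s lim zy
    by (intro exI[of _ "\<lambda>i. z (i + N)"] exI[of _ "\<lambda>i. 1 / s (i + N)"])
       (auto intro: LIMSEQ_ignore_initial_segment simp: LIMSEQ_ignore_initial_segment[of _ _ N])
qed

text \<open>Where \<open>f\<close> is differentiable this is \<open>e - \<nabla>f\<close>; it is a Borel function everywhere.\<close>

definition chart_normal :: "'a::euclidean_space \<Rightarrow> ('a \<Rightarrow> real) \<Rightarrow> 'a \<Rightarrow> 'a" where
  "chart_normal e f y = e - (\<Sum>b\<in>Basis. lim (\<lambda>m. (f (y + (1 / real (Suc m)) *\<^sub>R b) - f y) / (1 / real (Suc m))) *\<^sub>R b)"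

lemma borel_measurable_chart_normal:
  assumes "C-lipschitz_on UNIV f"
  shows "chart_normal e f \<in> borel_measurable borel"
proof -
  have [measurable]: "f \<in> borel_measurable borel"
    using lipschitz_on_continuous_on[OF assms] by (rule borel_measurable_continuous_onI)
  show ?thesis unfolding chart_normal_def[abs_def] by measurable
qed

text \<open>\<open>chart_normal e f y \<bullet> h\<close> is \<open>e \<bullet> h - D h\<close>. It
  is 1 for \<open>h = e\<close>, because \<open>f\<close> is constant along \<open>e\<close>, so the
  normal cannot vanish.\<close>

lemma chart_normal_at_differentiable:
  assumes chart: "graph_chart U V e f C" and D: "(f has_derivative D) (at y)"
  shows "{h. D h = e \<bullet> h} = {h. chart_normal e f y \<bullet> h = 0}" "chart_normal e f y \<noteq> 0"
proof -
  have e: "e \<bullet> e = 1" and inv: "\<And>z t. f (z + t *\<^sub>R e) = f z"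
    using chart unfolding graph_chart_def by (auto simp: norm_eq_1)
  have lin: "linear D" using D by (simp add: has_derivative_linear)
  have "lim (\<lambda>m. (f (y + (1 / real (Suc m)) *\<^sub>R b) - f y) / (1 / real (Suc m))) = D b" for b
  proof (rule limI)
    have "((\<lambda>t. (f (y + t *\<^sub>R b) - f y) / t) \<longlongrightarrow> D b) (at 0)"
      using has_real_derivative_along_line[OF D, of b] by (simp add: has_field_derivative_iff)
    moreover have "filterlim (\<lambda>m. 1 / real (Suc m)) (at 0) sequentially"
      using LIMSEQ_inverse_real_of_nat by (auto simp: filterlim_at inverse_eq_divide)
    ultimately show "(\<lambda>m. (f (y + (1 / real (Suc m)) *\<^sub>R b) - f y) / (1 / real (Suc m))) \<longlonglongrightarrow> D b"
      by (rule filterlim_compose)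
  qed
  then have n: "chart_normal e f y \<bullet> h = e \<bullet> h - D h" for h
  proof -
    have "D h = D (\<Sum>b\<in>Basis. (h \<bullet> b) *\<^sub>R b)" by (simp add: euclidean_representation)
    also have "\<dots> = (\<Sum>b\<in>Basis. (h \<bullet> b) * D b)"
      by (simp add: linear_sum[OF lin] linear_scale[OF lin])
    also have "\<dots> = (\<Sum>b\<in>Basis. D b *\<^sub>R b) \<bullet> h"
      by (simp add: inner_sum_left inner_commute[of h] mult.commute)
    finally show ?thesis
      using \<open>\<And>b. lim _ = D b\<close> by (simp add: chart_normal_def inner_diff_left)
  qed
  then show "{h. D h = e \<bullet> h} = {h. chart_normal e f y \<bullet> h = 0}" by auto
  have "D e = 0"
    using DERIV_unique[OF has_real_derivative_along_line[OF D, of e], of 0] by (simp add: inv)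
  then have "chart_normal e f y \<bullet> e = 1" by (simp add: n e)
  then show "chart_normal e f y \<noteq> 0" by auto
qed

section \<open>Jacobians on hyperplanes\<close>

lemma det_on_cong:
  assumes "\<And>b c. b \<in> I \<Longrightarrow> c \<in> I \<Longrightarrow> A b c = A' b c"
  shows "det_on I A = det_on I A'"
  unfolding det_on_def
  by (intro sum.cong arg_cong2[where f = "(*)"] prod.cong) (auto simp: assms permutes_in_image)

lemma det_on_image:
  assumes inj: "inj_on \<beta> I" and "finite I"
  shows "det_on (\<beta> ` I) A = det_on I (\<lambda>i j. A (\<beta> i) (\<beta> j))"
proof -
  have bij: "bij_betw \<beta> I (\<beta> ` I)" using inj by (simp add: bij_betw_def)
  have eq: "map_permutation I \<beta> p = (\<lambda>x. if x \<in> \<beta> ` I then \<beta> (p (inv_into I \<beta> x)) else x)" for p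
    by (auto simp: map_permutation_def restrict_id_def fun_eq_iff)
  have "bij_betw (map_permutation I \<beta>) {p. p permutes I} {p. p permutes \<beta> ` I}"
    using bij_betw_permutations[OF bij] by (simp add: eq[abs_def])
  then have "det_on (\<beta> ` I) A = (\<Sum>p | p permutes I. of_int (sign (map_permutation I \<beta> p)) *
      (\<Prod>i\<in>\<beta> ` I. A i (map_permutation I \<beta> p i)))"
    unfolding det_on_def by (rule sum.reindex_bij_betw[symmetric])
  also have "\<dots> = det_on I (\<lambda>i j. A (\<beta> i) (\<beta> j))"
    unfolding det_on_def
  proof (intro sum.cong refl arg_cong2[where f = "(*)"])
    fix p assume "p \<in> {p. p permutes I}"
    then have p: "p permutes I" by simp
    show "of_int (sign (map_permutation I \<beta> p)) = (of_int (sign p) :: real)"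
      using sign_map_permutation[OF inj p \<open>finite I\<close>] by simp
    show "(\<Prod>i\<in>\<beta> ` I. A i (map_permutation I \<beta> p i)) = (\<Prod>i\<in>I. A (\<beta> i) (\<beta> (p i)))"
      using inj by (subst prod.reindex) (auto intro!: prod.cong simp: map_permutation_apply)
  qed
  finally show ?thesis .
qed

text \<open>Permutations that move \<open>k\<close> meet a zero of row \<open>k\<close>; the others
  are the permutations of the remaining indices. This links determinants indexed by the type with
  \<open>det_on\<close> over one index fewer.\<close>

lemma det_bordered:
  fixes A :: "real ^ 'n ^ 'n"
  assumes row: "\<And>j. A $ k $ j = (if j = k then 1 else 0)"
  shows "det A = det_on (UNIV - {k}) (\<lambda>i j. A $ i $ j)"
proof -
  have "det A = (\<Sum>p | p permutes UNIV - {k}. of_int (sign p) * (\<Prod>i\<in>UNIV. A $ i $ p i))"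
    unfolding det_def
  proof (rule sum.mono_neutral_right)
    show "finite {p :: 'n \<Rightarrow> 'n. p permutes UNIV}" by (simp add: finite_permutations)
    show "{p. p permutes UNIV - {k}} \<subseteq> {p. p permutes UNIV}"
      using permutes_subset by blast
    show "\<forall>p\<in>{p. p permutes UNIV} - {p. p permutes UNIV - {k}}. of_int (sign p) * (\<Prod>i\<in>UNIV. A $ i $ p i) = 0"
    proof
      fix p assume p: "p \<in> {p. p permutes UNIV} - {p. p permutes UNIV - {k}}"
      then have "p k \<noteq> k" by (auto simp: permutes_def)
      then have "A $ k $ p k = 0" by (simp add: row)
      then have "(\<Prod>i\<in>UNIV. A $ i $ p i) = 0" by (intro prod_zero) auto
      then show "of_int (sign p) * (\<Prod>i\<in>UNIV. A $ i $ p i) = 0" by simp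
    qed
  qed
  also have "\<dots> = det_on (UNIV - {k}) (\<lambda>i j. A $ i $ j)"
    unfolding det_on_def
  proof (intro sum.cong refl arg_cong2[where f = "(*)"])
    fix p assume "p \<in> {p. p permutes UNIV - {k}}"
    then have "p k = k" by (auto simp: permutes_def)
    then show "(\<Prod>i\<in>UNIV. A $ i $ p i) = (\<Prod>i\<in>UNIV - {k}. A $ i $ p i)"
      by (subst prod.remove[of _ k]) (auto simp: row)
  qed
  finally show ?thesis .
qed

lemma orthonormal_basis_of_some:
  assumes "subspace T"
  shows "orthonormal_basis_of T (SOME B. orthonormal_basis_of T B)"
proof -
  obtain B where "B \<subseteq> T" "pairwise orthogonal B" "\<And>x. x \<in> B \<Longrightarrow> norm x = 1" "span B = T"
    using orthonormal_basis_subspace[OF assms] by metis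
  then have "orthonormal_basis_of T B" by (auto simp: orthonormal_basis_of_def)
  then show ?thesis by (rule someI)
qed

lemma orthonormal_basis_ofD:
  assumes "orthonormal_basis_of T B"
  shows "finite B" "card B = dim T" "B \<subseteq> T"
    "\<And>b c. b \<in> B \<Longrightarrow> c \<in> B \<Longrightarrow> b \<bullet> c = (if b = c then 1 else 0)"
proof -
  have B: "B \<subseteq> T" "span B = T" "pairwise orthogonal B" "\<And>b. b \<in> B \<Longrightarrow> norm b = 1"
    using assms by (auto simp: orthonormal_basis_of_def)
  have ind: "independent B"
    using B by (intro pairwise_orthogonal_independent) force+
  show "finite B" by (rule independent_imp_finite[OF ind])
  show "card B = dim T" using dim_span_eq_card_independent[OF ind] B(2) by simp
  show "B \<subseteq> T" by fact
  show "b \<bullet> c = (if b = c then 1 else 0)" if "b \<in> B" "c \<in> B" for b c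
    using that B(3,4) by (auto simp: pairwise_def orthogonal_def norm_eq_1)
qed

lemma jacobian_on_cong:
  assumes "subspace T" "\<And>v. v \<in> T \<Longrightarrow> L v = L' v"
  shows "jacobian_on T L = jacobian_on T L'"
  using orthonormal_basis_ofD(3)[OF orthonormal_basis_of_some[OF assms(1)]] assms(2)
  unfolding jacobian_on_def Let_def by (intro arg_cong[where f = sqrt] det_on_cong) (auto simp: subset_iff)

text \<open>The right-hand side depends on the normal alone, in a visibly measurable way, whereas
  the basis in \<open>jacobian_on\<close> is an arbitrary choice. With P the orthogonal projection
  onto the hyperplane, the matrix is the Gram matrix of the vectors L (P (axis i 1)) plus the outer
  square of \<open>\<nu>\<close>. In an orthonormal basis completed by \<open>\<nu>\<close> it
  becomes the Gram matrix over the hyperplane, bordered by a 1.\<close>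

lemma jacobian_on_hyperplane:
  fixes L :: "real ^ 'n \<Rightarrow> 'b::real_inner"
  assumes \<nu>: "norm \<nu> = 1" and lin: "linear L"
  shows "jacobian_on {h. \<nu> \<bullet> h = 0} L = sqrt (det (\<chi> i j.
    L (axis i 1 - (\<nu> $ i) *\<^sub>R \<nu>) \<bullet> L (axis j 1 - (\<nu> $ j) *\<^sub>R \<nu>) + \<nu> $ i * \<nu> $ j))"
proof -
  define T where "T = {h. \<nu> \<bullet> h = 0}"
  have "subspace T" unfolding T_def by (rule subspace_hyperplane)
  define B where "B = (SOME B. orthonormal_basis_of T B)"
  note B = orthonormal_basis_ofD[OF orthonormal_basis_of_some[OF \<open>subspace T\<close>, folded B_def]]
  have "\<nu> \<noteq> 0" "\<nu> \<bullet> \<nu> = 1" using \<nu> by (auto simp: norm_eq_1)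
  then have "\<nu> \<notin> T" by (simp add: T_def)
  then have "\<nu> \<notin> B" using B(3) by auto
  have "dim T = CARD('n) - 1"
    unfolding T_def using dim_hyperplane[OF \<open>\<nu> \<noteq> 0\<close>] by simp
  then have "card (insert \<nu> B) = CARD('n)"
    using \<open>\<nu> \<notin> B\<close> B(1,2) by simp
  \<comment> \<open>Enumerates \<open>\<nu>\<close> and the chosen basis by the index type, so that
    they become the columns of an orthogonal matrix.\<close>
  then obtain \<beta> :: "'n \<Rightarrow> real ^ 'n" where \<beta>: "bij_betw \<beta> UNIV (insert \<nu> B)"
    using B(1) by (metis finite_same_card_bij finite_insert finite)
  obtain k where k: "\<beta> k = \<nu>" using \<beta> by (metis bij_betw_iff_bijections insertI1)
  have inj: "inj \<beta>" using \<beta> by (simp add: bij_betw_def)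
  have \<beta>B: "\<beta> i \<in> B" if "i \<noteq> k" for i
    using \<beta> inj k that by (metis bij_betwE UNIV_I insertE injD)
  have img: "\<beta> ` (UNIV - {k}) = B"
    using \<beta> inj k \<open>\<nu> \<notin> B\<close> by (auto simp: bij_betw_def image_set_diff)
  have \<nu>\<beta>: "\<nu> \<bullet> \<beta> i = (if i = k then 1 else 0)" for i
    using \<beta>B[of i] B(3) k \<open>\<nu> \<bullet> \<nu> = 1\<close> by (auto simp: T_def)
  have orth: "\<beta> i \<bullet> \<beta> j = (if i = j then 1 else 0)" for i j
  proof (cases "i = k \<or> j = k")
    case True
    then show ?thesis using \<nu>\<beta>[of i] \<nu>\<beta>[of j] k by (auto simp: inner_commute)
  next
    case False
    then show ?thesis using B(4)[OF \<beta>B \<beta>B, of i j] inj by (auto simp: inj_eq)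
  qed
  define A :: "real ^ 'n ^ 'n" where "A = (\<chi> i j. \<beta> j $ i)"
  define G :: "real ^ 'n ^ 'n" where "G = (\<chi> i j.
    L (axis i 1 - (\<nu> $ i) *\<^sub>R \<nu>) \<bullet> L (axis j 1 - (\<nu> $ j) *\<^sub>R \<nu>) + \<nu> $ i * \<nu> $ j)"
  have "(\<Sum>q\<in>UNIV. \<beta> i $ q * \<beta> j $ q) = (if i = j then 1 else 0)" for i j
    using orth[of i j] by (simp add: inner_vec_def)
  then have "orthogonal_matrix A"
    unfolding orthogonal_matrix
    by (simp add: vec_eq_iff matrix_matrix_mult_def transpose_def A_def mat_def)
  then have "det A * det A = 1"
    using det_orthogonal_matrix[of A] by auto
  moreover have "det (transpose A ** G ** A) = (det A * det A) * det G"
    by (simp add: det_mul)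
  ultimately have detG: "det G = det (transpose A ** G ** A)" by simp
  define W where "W v = L (v - (\<nu> \<bullet> v) *\<^sub>R \<nu>)" for v
  have "linear (\<lambda>v. v - (\<nu> \<bullet> v) *\<^sub>R \<nu>)"
    by (rule linearI) (auto simp: inner_add_right algebra_simps)
  from linear_compose[OF this lin] have "linear W" by (simp add: W_def[abs_def] o_def)
  have W: "(\<Sum>q\<in>UNIV. v $ q *\<^sub>R W (axis q 1)) = W v" for v
  proof -
    have "W v = W (\<Sum>q\<in>UNIV. v $ q *\<^sub>R axis q 1)"
      by (rule arg_cong[where f = W]) (simp add: vec_eq_iff axis_def if_distrib[of "\<lambda>x. _ * x"] cong: if_cong)
    then show ?thesis
      by (simp add: linear_sum[OF \<open>linear W\<close>] linear_scale[OF \<open>linear W\<close>])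
  qed
  have G: "G $ p $ q = W (axis p 1) \<bullet> W (axis q 1) + \<nu> $ p * \<nu> $ q" for p q
    by (simp add: G_def W_def inner_axis)
  have entry: "(transpose A ** G ** A) $ i $ j = W (\<beta> i) \<bullet> W (\<beta> j) + (\<nu> \<bullet> \<beta> i) * (\<nu> \<bullet> \<beta> j)" for i j
  proof -
    have "(transpose A ** G ** A) $ i $ j = (\<Sum>q\<in>UNIV. \<Sum>p\<in>UNIV. \<beta> i $ p * G $ p $ q * \<beta> j $ q)"
      by (simp add: matrix_matrix_mult_def transpose_def A_def sum_distrib_right)
    also have "\<dots> = (\<Sum>q\<in>UNIV. \<Sum>p\<in>UNIV. (\<beta> i $ p *\<^sub>R W (axis p 1)) \<bullet> (\<beta> j $ q *\<^sub>R W (axis q 1))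
        + (\<beta> i $ p * \<nu> $ p) * (\<beta> j $ q * \<nu> $ q))"
      by (simp add: G algebra_simps)
    also have "\<dots> = (\<Sum>p\<in>UNIV. \<beta> i $ p *\<^sub>R W (axis p 1)) \<bullet> (\<Sum>q\<in>UNIV. \<beta> j $ q *\<^sub>R W (axis q 1))
        + (\<Sum>p\<in>UNIV. \<beta> i $ p * \<nu> $ p) * (\<Sum>q\<in>UNIV. \<beta> j $ q * \<nu> $ q)"
      by (simp add: sum.distrib inner_sum_left inner_sum_right sum_distrib_left sum_distrib_right)
    finally show ?thesis
      by (simp add: W inner_vec_def mult.commute)
  qed
  have Wk: "W (\<beta> k) = 0"
    using \<open>\<nu> \<bullet> \<nu> = 1\<close> linear_0[OF lin] by (simp add: W_def k)
  have "det (transpose A ** G ** A) = det_on (UNIV - {k}) (\<lambda>i j. (transpose A ** G ** A) $ i $ j)"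
    by (rule det_bordered) (simp add: entry Wk \<nu>\<beta>)
  also have "\<dots> = det_on (UNIV - {k}) (\<lambda>i j. L (\<beta> i) \<bullet> L (\<beta> j))"
    by (rule det_on_cong) (simp add: entry \<nu>\<beta>, simp add: W_def \<nu>\<beta>)
  also have "\<dots> = det_on B (\<lambda>b c. L b \<bullet> L c)"
    using det_on_image[of \<beta> "UNIV - {k}" "\<lambda>b c. L b \<bullet> L c"] inj unfolding img
    by (simp add: inj_on_subset)
  finally show ?thesis
    using detG unfolding jacobian_on_def Let_def G_def T_def[symmetric] B_def[symmetric] by simp
qed

section \<open>Uniform bound and limit of Jacobians\<close>

lemma abs_det_on_le:
  assumes "finite B" "\<And>b c. b \<in> B \<Longrightarrow> c \<in> B \<Longrightarrow> \<bar>A b c\<bar> \<le> K"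
  shows "\<bar>det_on B A\<bar> \<le> fact (card B) * K ^ card B"
proof -
  have "\<bar>det_on B A\<bar> \<le> (\<Sum>p | p permutes B. K ^ card B)"
    unfolding det_on_def
  proof (intro order_trans[OF sum_abs] sum_mono)
    fix p assume "p \<in> {p. p permutes B}"
    then have "\<bar>\<Prod>i\<in>B. A i (p i)\<bar> \<le> (\<Prod>i\<in>B. K)"
      unfolding abs_prod by (intro prod_mono) (auto simp: assms permutes_in_image)
    then show "\<bar>of_int (sign p) * (\<Prod>i\<in>B. A i (p i))\<bar> \<le> K ^ card B"
      by (simp add: abs_mult sign_def)
  qed
  also have "\<dots> = fact (card B) * K ^ card B"
    using card_permutations[OF refl \<open>finite B\<close>] by simp
  finally show ?thesis .
qed

lemma det_on_identity:
  assumes "finite B"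
  shows "det_on B (\<lambda>b c. if b = c then 1 else 0) = 1"
proof -
  have "det_on B (\<lambda>b c. if b = c then 1 else 0) = (\<Sum>p\<in>{id}. of_int (sign p) * (\<Prod>i\<in>B. if i = p i then 1 else 0))"
    unfolding det_on_def
  proof (rule sum.mono_neutral_right)
    show "finite {p. p permutes B}" by (rule finite_permutations[OF assms])
    show "{id} \<subseteq> {p. p permutes B}" by (simp add: permutes_id)
    show "\<forall>p\<in>{p. p permutes B} - {id}. of_int (sign p) * (\<Prod>i\<in>B. if i = p i then 1 else 0) = (0::real)"
    proof
      fix p assume "p \<in> {p. p permutes B} - {id}"
      then obtain i where "i \<in> B" "p i \<noteq> i"
        by (auto simp: fun_eq_iff) (metis permutes_not_in)
      then have "(\<Prod>i\<in>B. if i = p i then 1 else 0) = (0::real)"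
        using assms by (intro prod_zero bexI[of _ i]) (auto simp: eq_commute[of i])
      then show "of_int (sign p) * (\<Prod>i\<in>B. if i = p i then 1 else 0) = (0::real)" by simp
    qed
  qed
  then show ?thesis by simp
qed

lemma jacobian_on_le:
  fixes T :: "'a::euclidean_space set"
  assumes "subspace T" and L: "\<And>h. norm (L h) \<le> K * norm h" and "1 \<le> K"
  shows "\<bar>jacobian_on T L\<bar> \<le> sqrt (fact DIM('a) * (K * K) ^ DIM('a))"
proof -
  define B where "B = (SOME B. orthonormal_basis_of T B)"
  note B = orthonormal_basis_ofD[OF orthonormal_basis_of_some[OF \<open>subspace T\<close>, folded B_def]]
  have "card B \<le> DIM('a)" using B(2) dim_subset_UNIV by simp
  have "\<bar>L b \<bullet> L c\<bar> \<le> K * K" if "b \<in> B" "c \<in> B" for b c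
  proof -
    have "norm b = 1" "norm c = 1" using B(4) that by (auto simp: norm_eq_1)
    then have "norm (L b) * norm (L c) \<le> K * K"
      using L[of b] L[of c] \<open>1 \<le> K\<close> by (intro mult_mono) auto
    then show ?thesis using Cauchy_Schwarz_ineq2[of "L b" "L c"] by linarith
  qed
  then have "\<bar>det_on B (\<lambda>b c. L b \<bullet> L c)\<bar> \<le> fact (card B) * (K * K) ^ card B"
    by (rule abs_det_on_le[OF B(1)])
  also have "\<dots> \<le> fact DIM('a) * (K * K) ^ DIM('a)"
    using \<open>card B \<le> DIM('a)\<close> \<open>1 \<le> K\<close>
    by (intro mult_mono fact_mono power_increasing) (auto simp: mult_ge1_I)
  finally have "sqrt \<bar>det_on B (\<lambda>b c. L b \<bullet> L c)\<bar> \<le> sqrt (fact DIM('a) * (K * K) ^ DIM('a))"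
    by (rule real_sqrt_le_mono)
  \<comment> \<open>The real \<open>sqrt\<close> is odd, so the absolute value passes inside
    whatever the sign of the argument.\<close>
  moreover have "\<bar>sqrt x\<bar> = sqrt \<bar>x\<bar>" for x :: real
    by (auto simp: abs_if real_sqrt_minus)
  ultimately show ?thesis
    unfolding jacobian_on_def Let_def B_def[symmetric] by simp
qed

lemma jacobian_on_tendsto_1:
  fixes T :: "'a::euclidean_space set"
  assumes "subspace T" and L: "\<And>h. h \<in> T \<Longrightarrow> ((\<lambda>t. L t h) \<longlongrightarrow> h) F"
  shows "((\<lambda>t. jacobian_on T (L t)) \<longlongrightarrow> 1) F"
proof -
  define B where "B = (SOME B. orthonormal_basis_of T B)"
  note B = orthonormal_basis_ofD[OF orthonormal_basis_of_some[OF \<open>subspace T\<close>, folded B_def]]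
  have "((\<lambda>t. sqrt (det_on B (\<lambda>b c. L t b \<bullet> L t c))) \<longlongrightarrow> sqrt (det_on B (\<lambda>b c. b \<bullet> c))) F"
    unfolding det_on_def using B(3)
    by (intro tendsto_intros L) (auto simp: permutes_in_image subset_iff)
  moreover have "det_on B (\<lambda>b c. b \<bullet> c) = 1"
    using det_on_cong[of B "\<lambda>b c. b \<bullet> c" "\<lambda>b c. if b = c then 1 else 0"] det_on_identity[OF B(1)] B(4) by simp
  ultimately show ?thesis
    unfolding jacobian_on_def Let_def B_def[symmetric] by simp
qed

section \<open>The regular deformation\<close>

lemma hausdorff_null_set:
  assumes "hausdorff_outer k S = 0"
  shows "S \<in> null_sets (hausdorff_measure k)"
proof -
  have "hausdorff_outer k (S \<inter> A) + hausdorff_outer k (- S \<inter> A) = hausdorff_outer k A" for A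
  proof -
    have "hausdorff_outer k (S \<inter> A) = 0"
      using hausdorff_outer_mono[of "S \<inter> A" S k] assms by simp
    moreover have "hausdorff_outer k A \<le> hausdorff_outer k (S \<inter> A) + hausdorff_outer k (- S \<inter> A)"
      by (rule order_trans[OF hausdorff_outer_mono hausdorff_outer_Un_le]) auto
    ultimately show ?thesis
      using hausdorff_outer_mono[of "- S \<inter> A" A k] by simp
  qed
  then have "S \<in> sets (hausdorff_measure k)"
    by (simp add: sets_hausdorff_measure lambda_system_def flip: Compl_eq_Diff_UNIV)
  then show ?thesis using assms by (simp add: null_sets_def emeasure_hausdorff_measure)
qed

text \<open>Made for a function given by measurable formulas only off exceptional sets: a sublevel
  set consists of measurable parts coming from the formulas and of subsets of the
  \<open>N x\<close>, which are measurable whatever the values there.\<close>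

lemma borel_measurable_piecewise_up_to_null:
  fixes g :: "'a \<Rightarrow> real"
  assumes "finite J" and F: "F = (\<Union>x\<in>J. A x)"
    and [measurable]: "\<And>x. x \<in> J \<Longrightarrow> A x \<in> sets M" "\<And>x. x \<in> J \<Longrightarrow> \<phi> x \<in> borel_measurable M"
    and N: "\<And>x S. x \<in> J \<Longrightarrow> S \<subseteq> N x \<Longrightarrow> S \<in> sets M"
    and g: "\<And>x y. x \<in> J \<Longrightarrow> y \<in> A x - N x \<Longrightarrow> g y = \<phi> x y"
  shows "(\<lambda>y. indicator F y *\<^sub>R g y) \<in> borel_measurable M"
  unfolding borel_measurable_iff_less
proof
  fix a
  have [measurable]: "F \<in> sets M" using \<open>finite J\<close> assms(3) by (auto simp: F)
  have "{y \<in> space M. indicator F y *\<^sub>R g y < a} = {y \<in> space M - F. 0 < a} \<union>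
    (\<Union>x\<in>J. {y \<in> space M. y \<in> A x - N x \<and> \<phi> x y < a} \<union> {y \<in> A x \<inter> N x. g y < a})" (is "?l = ?r")
  proof (intro set_eqI iffI)
    fix y assume y: "y \<in> ?l"
    show "y \<in> ?r"
    proof (cases "y \<in> F")
      case True
      then obtain x where x: "x \<in> J" "y \<in> A x" by (auto simp: F)
      then have "y \<in> {y \<in> space M. y \<in> A x - N x \<and> \<phi> x y < a} \<union> {y \<in> A x \<inter> N x. g y < a}"
        using y True g[OF x(1), of y] by (cases "y \<in> N x") auto
      then show ?thesis using x(1) by blast
    qed (use y in auto)
  next
    fix y assume "y \<in> ?r"
    moreover have "A x \<subseteq> space M" "A x \<subseteq> F" if "x \<in> J" for x
      using sets.sets_into_space[OF assms(3)[OF that]] that by (auto simp: F)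
    ultimately show "y \<in> ?l" using g by (auto simp: subset_iff)
  qed
  also have "\<dots> \<in> sets M"
  proof (intro sets.Un sets.finite_UN \<open>finite J\<close>)
    fix x assume x: "x \<in> J"
    note [measurable] = N[OF x order_refl] assms(3,4)[OF x]
    show "{y \<in> space M. y \<in> A x - N x \<and> \<phi> x y < a} \<in> sets M" by measurable
    show "{y \<in> A x \<inter> N x. g y < a} \<in> sets M" by (rule N[OF x]) auto
  qed measurable
  finally show "{y \<in> space M. indicator F y *\<^sub>R g y < a} \<in> sets M" .
qed

text \<open>As \<open>f\<close> is invariant along \<open>e\<close>, differentiability at one point
  of a line parallel to \<open>e\<close> spreads along the line. Hence the lines over the bad points
  stay in the Lebesgue null set of Rademacher's theorem.\<close>

lemma hausdorff_null_not_differentiable_in_chart: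
  fixes U :: "'a::euclidean_space set"
  assumes chart: "graph_chart U V e f C" and "open V" "open U" "bounded V"
  shows "hausdorff_outer (DIM('a) - 1) {y \<in> frontier U \<inter> V. \<not> f differentiable (at y)} = 0"
proof (rule hausdorff_outer_graph_null)
  show "norm e = 1" and lip: "C-lipschitz_on UNIV f" and inv: "\<And>y t. f (y + t *\<^sub>R e) = f y"
    using chart by (auto simp: graph_chart_def)
  show "bounded {y \<in> frontier U \<inter> V. \<not> f differentiable (at y)}"
    using \<open>bounded V\<close> by (rule bounded_subset) auto
  show "e \<bullet> y = f y" if "y \<in> {y \<in> frontier U \<inter> V. \<not> f differentiable (at y)}" for y
    using that frontier_in_chart[OF chart \<open>open V\<close> \<open>open U\<close>] by auto
  show "negligible {y. \<not> f differentiable (at y)}" by (rule rademacher[OF lip])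
  fix y t assume y: "y \<in> {y \<in> frontier U \<inter> V. \<not> f differentiable (at y)}"
  show "y + t *\<^sub>R e \<in> {y. \<not> f differentiable (at y)}"
  proof (rule ccontr)
    assume "\<not> ?thesis"
    then obtain D where "(f has_derivative D) (at (y + t *\<^sub>R e))"
      by (auto simp: differentiable_def)
    moreover have "((\<lambda>z. z + t *\<^sub>R e) has_derivative (\<lambda>h. h)) (at y)"
      by (auto intro!: derivative_eq_intros)
    ultimately have "((\<lambda>z. f (z + t *\<^sub>R e)) has_derivative D) (at y)"
      using has_derivative_compose[of "\<lambda>z. z + t *\<^sub>R e" "\<lambda>h. h" y UNIV f D] by simp
    then show False using y by (simp add: inv differentiable_def)
  qed
qed

text \<open>\<open>L\<close> is the derivative in the full space. The
  \<open>frechet_derivative\<close> within the frontier may differ from it, but not on the tangent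
  cone, which is all that the Jacobian sees.\<close>

lemma tangential_jacobian_in_chart:
  assumes chart: "graph_chart U V e f C" and "open V" "open U" "y \<in> V" "y \<in> frontier U"
    and "f differentiable (at y)" and g: "(g has_derivative L) (at y)"
  shows "tangential_jacobian (DIM('a) - 1) (frontier U) g y
    = jacobian_on {h :: 'a::euclidean_space. chart_normal e f y \<bullet> h = 0} L"
proof -
  obtain D where D: "(f has_derivative D) (at y)"
    using assms(6) by (auto simp: differentiable_def)
  have T: "tangent_cone (frontier U) y = {h. chart_normal e f y \<bullet> h = 0}"
    using tangent_cone_frontier_in_chart[OF assms(1-5) D] chart_normal_at_differentiable[OF chart D] by simp
  have sub: "subspace (tangent_cone (frontier U) y)" unfolding T by (rule subspace_hyperplane)
  moreover have "dim (tangent_cone (frontier U) y) = DIM('a) - 1"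
    unfolding T using chart_normal_at_differentiable[OF chart D] by (intro dim_hyperplane)
  moreover have g': "(g has_derivative L) (at y within frontier U)"
    using g by (rule has_derivative_at_withinI)
  moreover have diff: "g differentiable (at y within frontier U)"
    using g' by (auto simp: differentiable_def)
  moreover have "jacobian_on (tangent_cone (frontier U) y) (frechet_derivative g (at y within frontier U))
     = jacobian_on (tangent_cone (frontier U) y) L"
    using derivative_unique_on_tangent_cone[OF diff[unfolded frechet_derivative_works] g']
    by (intro jacobian_on_cong sub)
  ultimately show ?thesis by (simp add: tangential_jacobian_def T)
qed

lemma borel_measurable_jacobian_on_hyperplane:
  fixes \<nu> :: "real ^ 'n \<Rightarrow> real ^ 'n" and L :: "real ^ 'n \<Rightarrow> real ^ 'n \<Rightarrow> real ^ 'n"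
  assumes [measurable]: "\<nu> \<in> borel_measurable borel" and lin: "\<And>y. linear (L y)"
    and L [measurable]: "\<And>h. (\<lambda>y. L y h) \<in> borel_measurable borel"
  shows "\<exists>\<phi>. \<phi> \<in> borel_measurable borel \<and>
    (\<forall>y. \<nu> y \<noteq> 0 \<longrightarrow> jacobian_on {h. \<nu> y \<bullet> h = 0} (L y) = \<phi> y)"
proof -
  define u where "u y = \<nu> y /\<^sub>R norm (\<nu> y)" for y
  have [measurable]: "u \<in> borel_measurable borel" unfolding u_def[abs_def] by measurable
  define v where "v i y = axis i 1 - (u y $ i) *\<^sub>R u y" for i y
  have [measurable]: "(\<lambda>y. u y $ i) \<in> borel_measurable borel" for i
    unfolding cart_eq_inner_axis by measurable
  then have [measurable]: "v i \<in> borel_measurable borel" for i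
    unfolding v_def[abs_def] by measurable
  \<comment> \<open>The argument \<open>v i y\<close> varies with \<open>y\<close>; its expansion
    leaves only values of \<open>L y\<close> at fixed vectors, which are measurable.\<close>
  have Lv: "L y (v i y) = (\<Sum>b\<in>Basis. (v i y \<bullet> b) *\<^sub>R L y b)" for i y
    using linear_sum[OF lin, of y "\<lambda>b. (v i y \<bullet> b) *\<^sub>R b" Basis] linear_scale[OF lin]
    by (simp add: euclidean_representation)
  have [measurable]: "(\<lambda>y. L y (v i y)) \<in> borel_measurable borel" for i
    unfolding Lv by measurable
  define \<phi> where "\<phi> y = sqrt (det (\<chi> i j. L y (v i y) \<bullet> L y (v j y) + u y $ i * u y $ j))" for y
  have "\<phi> \<in> borel_measurable borel"
    unfolding \<phi>_def[abs_def] det_def vec_lambda_beta by measurable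
  moreover have "jacobian_on {h. \<nu> y \<bullet> h = 0} (L y) = \<phi> y" if "\<nu> y \<noteq> 0" for y
  proof -
    have "{h. \<nu> y \<bullet> h = 0} = {h. u y \<bullet> h = 0}" using that by (simp add: u_def)
    moreover have "norm (u y) = 1" using that by (simp add: u_def)
    ultimately show ?thesis
      using jacobian_on_hyperplane[OF _ lin, of "u y"] by (simp add: \<phi>_def v_def)
  qed
  ultimately show ?thesis by blast
qed

lemma regular_lipschitz_deformation_along_field:
  fixes U :: "(real ^ 'n) set"
  assumes "bounded U" "open U" "lipschitz_boundary U"
    and X: "\<And>y. (X has_derivative X' y) (at y)" "\<And>h. continuous_on UNIV (\<lambda>y. X' y h)"
      "\<And>y h. norm (X' y h) \<le> B * norm h"
    and "\<epsilon> > 0" and \<Psi>: "\<Psi> = (\<lambda>(x, \<tau>). x + (\<epsilon> * \<tau>) *\<^sub>R X x)" and def: "lipschitz_deformation U \<Psi>"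
  shows "regular_lipschitz_deformation U \<Psi>"
proof -
  define F where "F = frontier U"
  define k where "k = CARD('n) - 1"
  define M where "M = (hausdorff_measure k :: (real ^ 'n) measure)"
  define g where "g \<tau> = tangential_jacobian k F (\<lambda>x. \<Psi> (x, \<tau>))" for \<tau>
  define L where "L \<tau> y h = h + (\<epsilon> * \<tau>) *\<^sub>R X' y h" for \<tau> y h
  have borel: "S \<in> sets M" if "S \<in> sets borel" for S
    using borel_sets_hausdorff_measure[of k] that by (auto simp: M_def)
  have borel': "\<phi> \<in> borel_measurable M" if "\<phi> \<in> borel_measurable borel" for \<phi> :: "real ^ 'n \<Rightarrow> real"
    using that borel by (auto simp: measurable_def M_def)
  have "compact F" using \<open>bounded U\<close> by (simp add: F_def compact_frontier_bounded)
  obtain \<rho> e f C where \<rho>: "\<And>x. x \<in> F \<Longrightarrow> \<rho> x > 0"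
    and chart: "\<And>x. x \<in> F \<Longrightarrow> graph_chart U (ball x (\<rho> x)) (e x) (f x) (C x)"
    using ex_graph_chart[OF \<open>lipschitz_boundary U\<close>] unfolding F_def by metis
  obtain J where J: "J \<subseteq> F" "finite J" "F \<subseteq> (\<Union>x\<in>J. ball x (\<rho> x))"
    using compactE_image[OF \<open>compact F\<close>, of F "\<lambda>x. ball x (\<rho> x)"] \<rho> by force
  define A where "A x = F \<inter> ball x (\<rho> x)" for x
  \<comment> \<open>Here the tangent cone may fail to be a hyperplane, and the Jacobian may have its
    default value.\<close>
  define N where "N x = {y \<in> A x. \<not> f x differentiable (at y)}" for x
  have F: "F = (\<Union>x\<in>J. A x)" using J by (auto simp: A_def)
  have "closed F" by (simp add: F_def)
  then have AM: "A x \<in> sets M" for x by (intro borel) (auto simp: A_def)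
  have "F \<in> sets M" using \<open>closed F\<close> by (intro borel) auto
  have N0: "hausdorff_outer k (N x) = 0" if "x \<in> F" for x
    using hausdorff_null_not_differentiable_in_chart[OF chart[OF that] open_ball \<open>open U\<close> bounded_ball]
    by (simp add: N_def A_def F_def k_def)
  have Nsub: "S \<in> sets M" if "x \<in> J" "S \<subseteq> N x" for x S
  proof -
    have "x \<in> F" using that(1) J(1) by auto
    then have "hausdorff_outer k S = 0" using hausdorff_outer_mono[OF that(2), of k] N0 by simp
    then show ?thesis using null_setsD2[OF hausdorff_null_set] by (simp add: M_def)
  qed
  have good: "g \<tau> y = jacobian_on {h. chart_normal (e x) (f x) y \<bullet> h = 0} (L \<tau> y)"
    and normal: "chart_normal (e x) (f x) y \<noteq> 0"
    if "x \<in> J" "y \<in> A x - N x" for x y \<tau>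
  proof -
    have x: "x \<in> F" using that J by auto
    have diff: "f x differentiable (at y)" using that by (auto simp: N_def)
    have "((\<lambda>x. \<Psi> (x, \<tau>)) has_derivative L \<tau> y) (at y)"
      unfolding \<Psi> L_def[abs_def] prod.case by (intro derivative_intros X(1))
    then show "g \<tau> y = jacobian_on {h. chart_normal (e x) (f x) y \<bullet> h = 0} (L \<tau> y)"
      using tangential_jacobian_in_chart[OF chart[OF x] open_ball \<open>open U\<close> _ _ diff] that
      by (simp add: g_def k_def F_def A_def)
    show "chart_normal (e x) (f x) y \<noteq> 0"
      using diff chart_normal_at_differentiable(2)[OF chart[OF x]] by (auto simp: differentiable_def)
  qed
  have lin: "linear (L \<tau> y)" for \<tau> y
    unfolding L_def[abs_def] using has_derivative_linear[OF X(1)]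
    by (intro linear_compose_add linear_compose_scale_right) (auto simp: linear_id[unfolded id_def])
  have gM: "(\<lambda>y. indicator F y *\<^sub>R g \<tau> y) \<in> borel_measurable M" for \<tau>
  proof -
    have "\<forall>x\<in>J. \<exists>\<phi>. \<phi> \<in> borel_measurable borel \<and> (\<forall>y. chart_normal (e x) (f x) y \<noteq> 0 \<longrightarrow>
        jacobian_on {h. chart_normal (e x) (f x) y \<bullet> h = 0} (L \<tau> y) = \<phi> y)"
    proof (intro ballI borel_measurable_jacobian_on_hyperplane[OF _ lin])
      fix x assume "x \<in> J"
      show "chart_normal (e x) (f x) \<in> borel_measurable borel"
        using chart[of x] \<open>x \<in> J\<close> J by (auto simp: graph_chart_def intro: borel_measurable_chart_normal)
      show "(\<lambda>y. L \<tau> y h) \<in> borel_measurable borel" for h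
        unfolding L_def using X(2)[of h]
        by (intro borel_measurable_continuous_onI continuous_intros)
    qed
    from bchoice[OF this] obtain \<phi> where \<phi>: "\<forall>x\<in>J. \<phi> x \<in> borel_measurable borel \<and>
        (\<forall>y. chart_normal (e x) (f x) y \<noteq> 0 \<longrightarrow>
          jacobian_on {h. chart_normal (e x) (f x) y \<bullet> h = 0} (L \<tau> y) = \<phi> x y)"
      by blast
    show ?thesis
    proof (rule borel_measurable_piecewise_up_to_null[OF J(2) F AM _ Nsub])
      show "\<phi> x \<in> borel_measurable M" if "x \<in> J" for x
        using \<phi> that by (intro borel') blast
      show "g \<tau> y = \<phi> x y" if "x \<in> J" "y \<in> A x - N x" for x y
        using \<phi> normal[OF that] that(1) unfolding good[OF that] by blast
    qed
  qed
  have "AE y in M. y \<notin> (\<Union>x\<in>J. N x)"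
    using J N0 by (intro AE_not_in null_sets_UN' hausdorff_null_set countable_finite) (auto simp: M_def hausdorff_null_set)
  then have AE_good: "AE y in M. y \<in> F \<longrightarrow> (\<exists>x\<in>J. y \<in> A x - N x)"
    by eventually_elim (auto simp: F)
  have "emeasure M F < top"
  proof -
    have "emeasure M F \<le> (\<Sum>x\<in>J. emeasure M (A x))"
      unfolding F using AM J(2) by (intro emeasure_subadditive_finite) auto
    also have "\<dots> < top"
    proof (simp add: J(2) less_top[symmetric], intro ballI)
      fix x assume "x \<in> J"
      then have x: "x \<in> F" using J by auto
      have "hausdorff_outer (DIM(real ^ 'n) - 1) (A x) < top"
      proof (rule hausdorff_outer_graph_finite)
        show "norm (e x) = 1" "(C x)-lipschitz_on UNIV (f x)" "\<And>y t. f x (y + t *\<^sub>R e x) = f x y"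
          using chart[OF x] by (auto simp: graph_chart_def)
        show "bounded (A x)" unfolding A_def by (rule bounded_subset[OF bounded_ball]) auto
        show "e x \<bullet> y = f x y" if "y \<in> A x" for y
          using frontier_in_chart[OF chart[OF x] open_ball \<open>open U\<close>] that by (auto simp: A_def F_def)
      qed
      then show "emeasure M (A x) \<noteq> top"
        using AM[of x] by (simp add: M_def k_def emeasure_hausdorff_measure)
    qed
    finally show ?thesis .
  qed
  \<comment> \<open>The bound on \<open>X'\<close> is tested on a unit vector; any index would
    do.\<close>
  have "0 \<le> B" using order_trans[OF norm_ge_zero X(3)[of 0 "axis undefined 1"]] by simp
  define K where "K = 1 + \<epsilon> * B"
  \<comment> \<open>\<open>K\<close> bounds the differentials for parameters below 1, and
    \<open>K'\<close> is the resulting bound for the Jacobians; as a constant it is integrable over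
    \<open>F\<close>, which has finite measure.\<close>
  define K' where "K' = sqrt (fact CARD('n) * (K * K) ^ CARD('n))"
  have "1 \<le> K" using \<open>\<epsilon> > 0\<close> \<open>0 \<le> B\<close> by (simp add: K_def)
  have LK: "norm (L \<tau> y h) \<le> K * norm h" if "\<tau> \<in> {0<..<1}" for \<tau> y h
  proof -
    have "norm (L \<tau> y h) \<le> norm h + \<epsilon> * \<tau> * norm (X' y h)"
      unfolding L_def using norm_triangle_ineq[of h "(\<epsilon> * \<tau>) *\<^sub>R X' y h"] that \<open>\<epsilon> > 0\<close> by simp
    also have "\<epsilon> * \<tau> * norm (X' y h) \<le> \<epsilon> * 1 * (B * norm h)"
      using that \<open>\<epsilon> > 0\<close> X(3) by (intro mult_mono) auto
    finally show ?thesis by (simp add: K_def algebra_simps)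
  qed
  have gK: "AE y in M. y \<in> F \<longrightarrow> \<bar>g \<tau> y\<bar> \<le> K'" if "\<tau> \<in> {0<..<1}" for \<tau>
    using AE_good
  proof eventually_elim
    case (elim y)
    show ?case
    proof
      assume "y \<in> F"
      then obtain x where x: "x \<in> J" "y \<in> A x - N x" using elim by auto
      show "\<bar>g \<tau> y\<bar> \<le> K'"
        unfolding good[OF x] K'_def
        using jacobian_on_le[OF subspace_hyperplane LK[OF that] \<open>1 \<le> K\<close>] by simp
    qed
  qed
  have glim: "AE y in M. y \<in> F \<longrightarrow> (\<lambda>n. g (s n) y) \<longlonglongrightarrow> 1" if "s \<longlonglongrightarrow> 0" for s
    using AE_good
  proof eventually_elim
    case (elim y)
    show ?case
    proof
      assume "y \<in> F"
      then obtain x where x: "x \<in> J" "y \<in> A x - N x" using elim by auto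
      show "(\<lambda>n. g (s n) y) \<longlonglongrightarrow> 1"
        unfolding good[OF x]
      proof (intro jacobian_on_tendsto_1 subspace_hyperplane)
        fix h
        have "(\<lambda>n. h + (\<epsilon> * s n) *\<^sub>R X' y h) \<longlonglongrightarrow> h + (\<epsilon> * 0) *\<^sub>R X' y h"
          by (intro tendsto_intros that)
        then show "(\<lambda>n. L (s n) y h) \<longlonglongrightarrow> h" by (simp add: L_def)
      qed
    qed
  qed
  have int1: "set_integrable M F (\<lambda>x. 1 :: real)"
    using \<open>F \<in> sets M\<close> \<open>emeasure M F < top\<close> by (simp add: set_integrable_def)
  have intg: "set_integrable M F (g \<tau>)" if "\<tau> \<in> {0<..<1}" for \<tau>
    unfolding set_integrable_def
  proof (rule integrableI_bounded_set[OF \<open>F \<in> sets M\<close> gM])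
    show "AE y in M. y \<in> F \<longrightarrow> norm (indicator F y *\<^sub>R g \<tau> y) \<le> K'"
      using gK[OF that] by eventually_elim auto
  qed (use \<open>emeasure M F < top\<close> in auto)
  have "((\<lambda>\<tau>. LINT x:F|M. \<bar>g \<tau> x - 1\<bar>) \<longlongrightarrow> 0) (at_right 0)"
  \<comment> \<open>Sequences allow dominated convergence; restricting them to values below 1 makes
    the bound \<open>gK\<close> apply.\<close>
  proof (rule tendsto_at_right_sequentially[of 0 1])
    fix s :: "nat \<Rightarrow> real" assume s: "\<And>n. 0 < s n" "\<And>n. s n < 1" "s \<longlonglongrightarrow> 0"
    have "(\<lambda>n. \<integral>y. indicator F y *\<^sub>R \<bar>g (s n) y - 1\<bar> \<partial>M) \<longlonglongrightarrow> (\<integral>y. 0 \<partial>M)"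
    proof (rule integral_dominated_convergence[where w = "\<lambda>y. indicator F y *\<^sub>R (K' + 1)"])
      show "integrable M (\<lambda>y. indicator F y *\<^sub>R (K' + 1))"
        using \<open>F \<in> sets M\<close> \<open>emeasure M F < top\<close> by simp
      show "(\<lambda>y. indicator F y *\<^sub>R \<bar>g (s n) y - 1\<bar>) \<in> borel_measurable M" for n
      proof -
        have "(\<lambda>y. \<bar>indicator F y *\<^sub>R g (s n) y - indicator F y *\<^sub>R 1\<bar>) \<in> borel_measurable M"
          using gM \<open>F \<in> sets M\<close> by (intro borel_measurable_abs borel_measurable_diff) auto
        also have "(\<lambda>y. \<bar>indicator F y *\<^sub>R g (s n) y - indicator F y *\<^sub>R 1\<bar>) = (\<lambda>y. indicator F y *\<^sub>R \<bar>g (s n) y - 1\<bar>)"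
          by (auto simp: indicator_def)
        finally show ?thesis .
      qed
      show "AE y in M. (\<lambda>n. indicator F y *\<^sub>R \<bar>g (s n) y - 1\<bar>) \<longlonglongrightarrow> 0"
        using glim[OF s(3)]
      proof eventually_elim
        case (elim y)
        show ?case
        proof (cases "y \<in> F")
          case True
          then have "(\<lambda>n. \<bar>g (s n) y - 1\<bar>) \<longlonglongrightarrow> \<bar>1 - 1\<bar>"
            using elim by (intro tendsto_intros) auto
          then show ?thesis using True by simp
        qed simp
      qed
      show "AE y in M. norm (indicator F y *\<^sub>R \<bar>g (s n) y - 1\<bar>) \<le> indicator F y *\<^sub>R (K' + 1)" for n
        using gK[of "s n"] s(1,2)[of n] by (auto elim!: eventually_mono simp: indicator_def)
    qed simp
    then show "(\<lambda>n. LINT x:F|M. \<bar>g (s n) x - 1\<bar>) \<longlonglongrightarrow> 0"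
      by (simp add: set_lebesgue_integral_def)
  qed simp
  moreover have "\<forall>\<^sub>F \<tau> in at_right 0. set_integrable M F (g \<tau>)"
    using eventually_at_right_real[of 0 1] by (auto elim!: eventually_mono intro: intg)
  ultimately show ?thesis
    using def int1 unfolding regular_lipschitz_deformation_def tendsto_L1_on_def
    by (simp add: M_def k_def F_def g_def[abs_def])
qed

theorem theorem8p5:
  fixes U :: "(real ^ 'n) set"
  assumes "bounded U" and "open U" and "lipschitz_boundary U"
  shows "\<exists>\<Psi>. regular_lipschitz_deformation U \<Psi>"
proof -
  have "compact (frontier U)" using \<open>bounded U\<close> by (rule compact_frontier_bounded)
  moreover have "\<exists>v. inward U x v" if "x \<in> frontier U" for x
    using ex_graph_chart[OF assms(3) that] inward_chart_direction by blast
  ultimately obtain X X' B where X: "\<And>y. (X has_derivative X' y) (at y)"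
      "\<And>h. continuous_on UNIV (\<lambda>y. X' y h)" "\<And>y h. norm (X' y h) \<le> B * norm h"
      "\<And>y. y \<in> frontier U \<Longrightarrow> inward U y (X y)"
    using ex_transversal_field[of "frontier U" U] by metis
  have "0 \<le> B" using order_trans[OF norm_ge_zero X(3)[of 0 "axis undefined 1"]] by simp
  then have "B-lipschitz_on UNIV X"
    using X(1,3) by (intro bounded_derivative_imp_lipschitz[where f' = X'] onorm_bound) auto
  then obtain \<epsilon> where "\<epsilon> > 0" "lipschitz_deformation U (\<lambda>(x, \<tau>). x + (\<epsilon> * \<tau>) *\<^sub>R X x)"
    using ex_lipschitz_deformation_along_field[OF assms(1,2)] X(4) by blast
  then show ?thesis
    using regular_lipschitz_deformation_along_field[OF assms X(1-3)] by blast
qed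

end
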